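(* Let $0<\alpha<d$, $\theta\in[0,1]$, $d\theta<s$, and let $\mu$ be a non-zero, finite, compactly supported Borel measure on $\mathbb{R}^d$ such that $$\mu(B(x,r))\lesssim r^\alpha\quad\text{for all }x\in\mathbb{R}^d,\ r>0,\qquad\text{and}\qquad \mathcal{J}_{s,\theta}(\mu)<\infty.$$ Let $$q_0=2+2\,\frac{(d-\alpha)(2-\theta)}{s-\alpha\theta}.$$ Then for all $f\in L^2(\mu)$, $$\|\widehat{f\mu}\|_{L^{q_0}(\mathbb{R}^d)}\lesssim\|f\|_{L^2(\mu)}.$$ Equivalently, let $$q_0'=1+\frac{s-\alpha\theta}{s+4(d-\alpha)-\theta(2d-\alpha)}.$$ Then for all $f\in L^{q_0'}(\mathbb{R}^d)$, $$\|\widehat f\,\|_{L^2(\mu)}\lesssim\|f\|_{L^{q_0'}(\mathbb{R}^d)}.$$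
   Context: $A\lesssim B$ means $A\leq CB$ with a constant $C>0$ independent of $f$ (respectively of $x,r$). Fourier transforms: $\widehat f(\xi)=\int_{\mathbb{R}^d}e^{-2\pi i\xi\cdot x}f(x)\,dx$, $\widehat\mu(\xi)=\int e^{-2\pi i\xi\cdot x}\,d\mu(x)$, $\widehat{f\mu}(\xi)=\int e^{-2\pi i\xi\cdot x}f(x)\,d\mu(x)$. The estimate for $\|\widehat f\,\|_{L^2(\mu)}$ is understood as an estimate for Schwartz functions $f$, extended by density. For $\theta\in(0,1]$, $\mathcal{J}_{s,\theta}(\mu)=\Big(\int_{\mathbb{R}^d}|\widehat\mu(\xi)|^{2/\theta}|\xi|^{s/\theta-d}\,d\xi\Big)^\theta$, and $\mathcal{J}_{s,0}(\mu)=\sup_{\xi\in\mathbb{R}^d}|\widehat\mu(\xi)|^2|\xi|^s$. *)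

theory Defs
  imports "HOL-Analysis.Analysis"
begin

definition ennreal_powr :: "ennreal \<Rightarrow> real \<Rightarrow> ennreal" where
  "ennreal_powr x a = (if x = \<infinity> then \<infinity> else ennreal (enn2real x powr a))"
  (* meant for exponents a > 0 *)

definition Lp_norm :: "real \<Rightarrow> 'a measure \<Rightarrow> ('a \<Rightarrow> complex) \<Rightarrow> ennreal" where
  "Lp_norm p M f = ennreal_powr (\<integral>\<^sup>+x. ennreal (cmod (f x) powr p) \<partial>M) (1 / p)"

definition Lp_space :: "real \<Rightarrow> 'a measure \<Rightarrow> ('a \<Rightarrow> complex) set" where
  "Lp_space p M = {f \<in> borel_measurable M. Lp_norm p M f < \<infinity>}"

text \<open>\<open>fourier M f\<close> is the transform of the complex measure \<open>f M\<close>. The transforms of a function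
  \<open>f\<close>, of a measure \<open>\<mu>\<close> and of \<open>f \<mu>\<close> are \<open>fourier lborel f\<close>, \<open>fourier \<mu> (\<lambda>_. 1)\<close> and \<open>fourier \<mu> f\<close>.\<close>

definition fourier :: "'a::euclidean_space measure \<Rightarrow> ('a \<Rightarrow> complex) \<Rightarrow> 'a \<Rightarrow> complex" where
  "fourier M f \<xi> = (\<integral>x. exp (- (2 * of_real pi * \<i> * of_real (\<xi> \<bullet> x))) * f x \<partial>M)"

text \<open>Isabelle has \<open>0 powr a = 0\<close> for every \<open>a\<close>. In the integral this concerns only the null set
  \<open>{0}\<close>; in the supremum it agrees with the usual convention whenever \<open>s > 0\<close>.\<close>

definition fourier_energy :: "real \<Rightarrow> real \<Rightarrow> 'a::euclidean_space measure \<Rightarrow> ennreal" where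
  "fourier_energy s \<theta> \<mu> =
    (if \<theta> = 0
     then (SUP \<xi>. ennreal (cmod (fourier \<mu> (\<lambda>_. 1) \<xi>) ^ 2 * norm \<xi> powr s))
     else ennreal_powr
       (\<integral>\<^sup>+\<xi>. ennreal (cmod (fourier \<mu> (\<lambda>_. 1) \<xi>) powr (2 / \<theta>)
                   * norm \<xi> powr (s / \<theta> - real DIM('a))) \<partial>lborel) \<theta>)"

fun iter_partial :: "'a::euclidean_space list \<Rightarrow> ('a \<Rightarrow> complex) \<Rightarrow> 'a \<Rightarrow> complex" where
  "iter_partial [] f = f"
| "iter_partial (b # bs) f = (\<lambda>x. frechet_derivative (iter_partial bs f) (at x) b)"

text \<open>Differentiability of all iterated partial derivatives expresses that \<open>f\<close> is smooth; a list
  of basis vectors plays the role of a multi-index.\<close>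

definition schwartz :: "('a::euclidean_space \<Rightarrow> complex) \<Rightarrow> bool" where
  "schwartz f \<longleftrightarrow> (\<forall>bs. set bs \<subseteq> Basis \<longrightarrow>
     (\<forall>x. iter_partial bs f differentiable (at x)) \<and>
     (\<forall>k::nat. bounded (range (\<lambda>x. norm x ^ k *\<^sub>R iter_partial bs f x))))"

definition schwartz_approx ::
  "real \<Rightarrow> ('a::euclidean_space \<Rightarrow> complex) \<Rightarrow> (nat \<Rightarrow> 'a \<Rightarrow> complex) \<Rightarrow> bool" where
  "schwartz_approx p f \<phi> \<longleftrightarrow> (\<forall>n. schwartz (\<phi> n)) \<and>
     (\<lambda>n. Lp_norm p lborel (\<lambda>x. \<phi> n x - f x)) \<longlonglongrightarrow> 0"

text \<open>\<open>g\<close> represents the Fourier transform of \<open>f \<in> L\<^sup>p\<close> as an element of \<open>L\<^sup>2(\<mu>)\<close>, defined from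
  Schwartz functions by density: approximating sequences exist, and the transforms of every one of
  them converge to \<open>g\<close>. This determines \<open>g\<close> up to a \<open>\<mu>\<close>-null set.\<close>

definition fourier_by_density ::
  "real \<Rightarrow> 'a::euclidean_space measure \<Rightarrow> ('a \<Rightarrow> complex) \<Rightarrow> ('a \<Rightarrow> complex) \<Rightarrow> bool" where
  "fourier_by_density p \<mu> f g \<longleftrightarrow> g \<in> Lp_space 2 \<mu> \<and>
     (\<exists>\<phi>. schwartz_approx p f \<phi>) \<and>
     (\<forall>\<phi>. schwartz_approx p f \<phi> \<longrightarrow>
        (\<lambda>n. Lp_norm 2 \<mu> (\<lambda>\<xi>. fourier lborel (\<phi> n) \<xi> - g \<xi>)) \<longlonglongrightarrow> 0)"

end

theory Submission
  imports Defs "HOL-Probability.Probability"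
begin

text \<open>
  Put \<open>A = d - \<alpha>\<close> and \<open>B = (s - d \<theta>) / 2\<close>. Multiplying the transform of \<open>\<mu>\<close> by
  \<open>1 - (1 - exp (- pi t |v|\<^sup>2))\<^sup>M\<close> replaces \<open>\<mu>\<close> by a combination of Gaussian averages of \<open>\<mu>\<close>, whose
  densities are at most \<open>C t powr (- A / 2)\<close> by the ball condition; the remaining kernel has
  \<open>L\<^bsup>2/\<theta>\<^esup>\<close> norm at most \<open>C t powr (B / 2)\<close> by the energy condition.

  For the dual exponent \<open>p = q\<^sub>0'\<close> split \<open>f\<close> into its level pieces \<open>f\<^sub>k\<close> with \<open>|f\<^sub>k|\<close> comparable to
  \<open>2\<^sup>k\<close>, and expand \<open>\<integral> |fourier f|\<^sup>2 d\<mu>\<close> into pairings of \<open>f\<^sub>k\<close> and \<open>f\<^sub>l\<close>. The low frequencies of a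
  pairing are estimated by Cauchy-Schwarz, with Plancherel for one factor and, since averaging over
  translates of \<open>\<mu>\<close> is averaging over modulations of \<open>f\<^sub>k\<close>, the restriction inequality itself for
  the other. With the scale \<open>t\<close> optimised for each pair, the pairings decay geometrically in
  \<open>|k - l|\<close>, which gives the endpoint exponent without logarithmic loss. Thus the best constant \<open>N\<close>
  on truncated functions satisfies \<open>N \<le> C\<^sub>1 + C\<^sub>2 sqrt N\<close>, uniformly in the truncation.
\<close>

section \<open>Gaussians, pairings and smeared measures\<close>

text \<open>An inequality \<open>N \<le> C\<^sub>1 + C\<^sub>2 sqrt N\<close> says nothing about an
  infinite \<open>N\<close>. This is why the bootstrap runs on functions that are bounded above and
  below on a bounded support: for these some constant exists for trivial reasons, and the class
  survives modulation and restriction. In a pairing with l \<le> k the Plancherel factor is the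
  lower piece. At total mass one its L^2 norm is of order 2^(l (1 - p/2)) at most, and p < 2, so
  this choice brings decay in k - l, while the high-frequency bound sees k + l only. The scale hands
  half of that decay over to the high frequencies. The exponent p is the one for which the
  dependence on k + l cancels in both terms. Gaussians are chosen as cutoffs because powers of
  Gaussians are Gaussians and because smearing keeps the measure positive, so that Cauchy-Schwarz
  applies. The power M makes the remaining kernel small enough near the origin to exploit the full
  weight of the energy. Duality is used twice: truncated restriction gives extension for all of
  L^2(\<mu>), and this gives restriction back for every integrable function, with no approximation
  in between.\<close>

definition wave :: "'a::euclidean_space \<Rightarrow> 'a \<Rightarrow> complex" where
  "wave \<xi> x = cis (- (2 * pi * (\<xi> \<bullet> x)))"

lemma fourier_wave: "fourier M f \<xi> = (\<integral>x. wave \<xi> x * f x \<partial>M)"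
proof -
  have "exp (- (2 * of_real pi * \<i> * of_real (\<xi> \<bullet> x))) = wave \<xi> x" for x
    unfolding wave_def cis_conv_exp by (simp add: mult_ac)
  thus ?thesis unfolding fourier_def by simp
qed

lemma norm_wave [simp]: "cmod (wave \<xi> x) = 1"
  by (simp add: wave_def)

lemma wave_0 [simp]: "wave 0 x = 1" "wave \<xi> 0 = 1"
  by (simp_all add: wave_def)

lemma wave_add: "wave (\<xi> + \<eta>) x = wave \<xi> x * wave \<eta> x"
  by (simp add: wave_def cis_mult inner_add_left algebra_simps)

lemma wave_commute: "wave \<xi> x = wave x \<xi>"
  by (simp add: wave_def inner_commute)

lemma wave_diff: "wave \<xi> (x - y) = wave \<xi> x * cnj (wave \<xi> y)"
  by (simp add: wave_def cis_mult cis_cnj inner_diff_right algebra_simps)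

lemma borel_measurable_wave [measurable]:
  fixes f g :: "'b \<Rightarrow> 'a::euclidean_space"
  assumes [measurable]: "f \<in> borel_measurable M" "g \<in> borel_measurable M"
  shows "(\<lambda>x. wave (f x) (g x)) \<in> borel_measurable M"
  unfolding wave_def cis_conv_exp by measurable

text \<open>The substitution x = c u with c^2 = 2 pi / t turns the integral into the characteristic
  function of the standard normal distribution.\<close>

lemma gaussian_line:
  assumes t: "t > 0"
  shows "integrable lborel (\<lambda>u::real. complex_of_real (exp (- pi * u^2 / t)) * cis (- (2 * pi * v * u)))"
    and "(\<integral>u. complex_of_real (exp (- pi * u^2 / t)) * cis (- (2 * pi * v * u)) \<partial>lborel)
         = of_real (sqrt t * exp (- pi * t * v^2))"
proof -
  define c where "c = sqrt (2 * pi / t)"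
  define w where "w = - 2 * pi * v / c"
  have c: "c > 0" using t by (simp add: c_def)
  have c2: "c^2 = 2 * pi / t" using t by (simp add: c_def)
  define F where "F = (\<lambda>x. std_normal_density x *\<^sub>R cis (w * x))"
  have iF: "integrable lborel F"
    unfolding F_def by (rule Bochner_Integration.integrable_bound[OF integrable_normal_density[of 1 0]])
      (auto simp: cis_conv_exp)
  have "complex_of_real (exp (- (w^2) / 2)) = char std_normal_distribution w"
    by (simp add: char_std_normal_distribution)
  also have "\<dots> = (\<integral>x. F x \<partial>lborel)"
    unfolding char_def F_def
    by (subst integral_density) (auto simp: cis_conv_exp)
  finally have F1: "(\<integral>x. F x \<partial>lborel) = of_real (exp (- (w^2) / 2))" by simp
  have Fc: "F (0 + c * u) = (1 / sqrt (2 * pi)) *\<^sub>R (complex_of_real (exp (- pi * u^2 / t)) * cis (- (2 * pi * v * u)))" for u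
  proof -
    have "(c * u)^2 / 2 = pi * u^2 / t" by (simp add: power_mult_distrib c2)
    moreover have "w * (c * u) = - (2 * pi * v * u)" using c by (simp add: w_def)
    ultimately show ?thesis
      by (simp add: F_def std_normal_density_def scaleR_conv_of_real)
  qed
  have "integrable lborel (\<lambda>u. F (0 + c * u))"
    using iF c by (intro lborel_integrable_real_affine) auto
  then have i1: "integrable lborel (\<lambda>u. sqrt (2*pi) *\<^sub>R ((1 / sqrt (2 * pi)) *\<^sub>R (complex_of_real (exp (- pi * u^2 / t)) * cis (- (2 * pi * v * u)))))"
    unfolding Fc by (rule integrable_scaleR_right)
  then show "integrable lborel (\<lambda>u::real. complex_of_real (exp (- pi * u^2 / t)) * cis (- (2 * pi * v * u)))"
    by simp
  define J where "J = (\<integral>u. complex_of_real (exp (- pi * u^2 / t)) * cis (- (2 * pi * v * u)) \<partial>lborel)"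
  have "(\<integral>x. F x \<partial>lborel) = \<bar>c\<bar> *\<^sub>R (\<integral>u. F (0 + c * u) \<partial>lborel)"
    using c by (intro lborel_integral_real_affine) auto
  also have "\<dots> = (c / sqrt (2 * pi)) *\<^sub>R J"
    unfolding Fc J_def using c by (simp add: scaleR_conv_of_real)
  also have "c / sqrt (2 * pi) = 1 / sqrt t" by (simp add: c_def real_sqrt_divide)
  finally have "J = sqrt t *\<^sub>R of_real (exp (- (w^2) / 2))" using t F1 by simp
  also have "- (w^2) / 2 = - pi * t * v^2"
    unfolding w_def power_divide c2 using t by (simp add: field_simps power2_eq_square)
  finally show "J = of_real (sqrt t * exp (- pi * t * v^2))" by (simp add: scaleR_conv_of_real)
qed

text \<open>\<open>lborel\<close> is the image of the product of one-dimensional Lebesgue measures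
  under the coordinate map, so this is Fubini for a product of functions of one variable
  each.\<close>

lemma integrable_lborel_prod_Basis:
  fixes g :: "'a::euclidean_space \<Rightarrow> real \<Rightarrow> complex"
  assumes i: "\<And>b. b \<in> Basis \<Longrightarrow> integrable lborel (g b)"
  shows "integrable lborel (\<lambda>x::'a. \<Prod>b\<in>Basis. g b (x \<bullet> b))"
    and "(\<integral>x. (\<Prod>b\<in>Basis. g b (x \<bullet> b)) \<partial>lborel) = (\<Prod>b\<in>Basis. (\<integral>u. g b u \<partial>lborel))"
proof -
  interpret product_sigma_finite "\<lambda>b::'a. lborel :: real measure" ..
  have [measurable]: "g b \<in> borel_measurable borel" if "b \<in> Basis" for b
    using i[OF that] by (simp add: integrable_iff_bounded)
  have T: "(\<lambda>f. \<Sum>b\<in>(Basis::'a set). f b *\<^sub>R b) \<in> measurable (\<Pi>\<^sub>M b\<in>Basis. lborel) borel"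
    by measurable
  have G: "(\<lambda>x::'a. \<Prod>b\<in>Basis. g b (x \<bullet> b)) \<in> borel_measurable borel"
    by measurable
  have *: "(\<Prod>b\<in>Basis. g b ((\<Sum>c\<in>(Basis::'a set). f c *\<^sub>R c) \<bullet> b)) = (\<Prod>b\<in>Basis. g b (f b))" for f
    by (intro prod.cong) (auto simp: inner_sum_left inner_Basis if_distrib cong: if_cong)
  have "integrable (\<Pi>\<^sub>M b\<in>Basis. lborel) (\<lambda>f. \<Prod>b\<in>(Basis::'a set). g b (f b))"
    by (rule product_integrable_prod) (auto simp: i)
  then show "integrable lborel (\<lambda>x::'a. \<Prod>b\<in>Basis. g b (x \<bullet> b))"
    by (subst lborel_eq) (simp only: integrable_distr_eq[OF T G] *)
  have "(\<integral>f. (\<Prod>b\<in>(Basis::'a set). g b (f b)) \<partial>(\<Pi>\<^sub>M b\<in>Basis. lborel)) = (\<Prod>b\<in>Basis. (\<integral>u. g b u \<partial>lborel))"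
    by (rule product_integral_prod) (auto simp: i)
  then show "(\<integral>x. (\<Prod>b\<in>Basis. g b (x \<bullet> b)) \<partial>lborel) = (\<Prod>b\<in>Basis. (\<integral>u. g b u \<partial>lborel))"
    by (subst lborel_eq) (simp only: integral_distr[OF T G] *)
qed

lemma gaussian_transform:
  fixes v :: "'a::euclidean_space"
  assumes t: "t > 0"
  shows "integrable lborel (\<lambda>x::'a. complex_of_real (exp (- pi * (norm x)^2 / t)) * wave v x)"
    and "(\<integral>x. complex_of_real (exp (- pi * (norm x)^2 / t)) * wave v x \<partial>lborel)
         = of_real (t powr (DIM('a) / 2) * exp (- pi * t * (norm v)^2))"
proof -
  define g where "g = (\<lambda>b u. complex_of_real (exp (- pi * u^2 / t)) * cis (- (2 * pi * (v \<bullet> b) * u)))"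
  have nn: "(norm x)^2 = (\<Sum>b\<in>Basis. (x \<bullet> b)^2)" for x :: 'a
    unfolding power2_norm_eq_inner by (subst euclidean_inner) (simp add: power2_eq_square)
  have cisprod: "cis (\<Sum>b\<in>B. f b) = (\<Prod>b\<in>B. cis (f b))" if "finite B" for B :: "'a set" and f
    using that by (induction) (auto simp: cis_mult[symmetric])
  have E: "complex_of_real (exp (- pi * (norm x)^2 / t)) * wave v x = (\<Prod>b\<in>Basis. g b (x \<bullet> b))" for x
  proof -
    have "- pi * (norm x)^2 / t = (\<Sum>b\<in>Basis. - pi * (x \<bullet> b)^2 / t)"
      by (simp add: nn sum_distrib_left sum_divide_distrib sum_negf)
    then have "complex_of_real (exp (- pi * (norm x)^2 / t)) = (\<Prod>b\<in>Basis. complex_of_real (exp (- pi * (x \<bullet> b)^2 / t)))"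
      by (simp only: exp_sum[OF finite_Basis] of_real_prod)
    moreover have "- (2 * pi * (v \<bullet> x)) = (\<Sum>b\<in>Basis. - (2 * pi * (v \<bullet> b) * (x \<bullet> b)))"
      by (subst euclidean_inner) (simp add: sum_distrib_left sum_negf mult.assoc)
    then have "wave v x = (\<Prod>b\<in>Basis. cis (- (2 * pi * (v \<bullet> b) * (x \<bullet> b))))"
      unfolding wave_def by (simp only: cisprod[OF finite_Basis])
    ultimately show ?thesis by (simp only: g_def prod.distrib)
  qed
  have ig: "integrable lborel (g b)" for b unfolding g_def by (rule gaussian_line(1)[OF t])
  show "integrable lborel (\<lambda>x::'a. complex_of_real (exp (- pi * (norm x)^2 / t)) * wave v x)"
    unfolding E by (rule integrable_lborel_prod_Basis(1)) (rule ig)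
  have "(\<integral>x. complex_of_real (exp (- pi * (norm x)^2 / t)) * wave v x \<partial>lborel) = (\<Prod>b\<in>Basis. (\<integral>u. g b u \<partial>lborel))"
    unfolding E by (rule integrable_lborel_prod_Basis(2)) (rule ig)
  also have "\<dots> = (\<Prod>b\<in>(Basis::'a set). of_real (sqrt t * exp (- pi * t * (v \<bullet> b)^2)))"
    unfolding g_def gaussian_line(2)[OF t] ..
  also have "\<dots> = of_real ((\<Prod>b\<in>(Basis::'a set). sqrt t) * exp (\<Sum>b\<in>Basis. - pi * t * (v \<bullet> b)^2))"
    by (simp add: prod.distrib exp_sum)
  also have "(\<Sum>b\<in>Basis. - pi * t * (v \<bullet> b)^2) = - pi * t * (norm v)^2"
    by (simp add: nn sum_distrib_left sum_negf)
  also have "(\<Prod>b\<in>(Basis::'a set). sqrt t) = t powr (DIM('a) / 2)"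
    using t by (simp add: powr_half_sqrt[symmetric] powr_powr powr_realpow[symmetric])
  finally show "(\<integral>x. complex_of_real (exp (- pi * (norm x)^2 / t)) * wave v x \<partial>lborel)
         = of_real (t powr (DIM('a) / 2) * exp (- pi * t * (norm v)^2))" .
qed

text \<open>The heat kernel, normalised to have integral 1 and transform exp(-pi t |v|^2). Thus
  \<open>t\<close> is the square of a length, and frequencies well above 1 / sqrt t are
  suppressed.\<close>

definition gauss :: "real \<Rightarrow> 'a::euclidean_space \<Rightarrow> real" where
  "gauss t x = t powr (- (DIM('a) / 2)) * exp (- pi * (norm x)^2 / t)"

lemma borel_measurable_gauss [measurable]: "gauss t \<in> borel_measurable borel"
  unfolding gauss_def by measurable

lemma gauss_nonneg [simp]: "gauss t x \<ge> 0"
  by (simp add: gauss_def)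

lemma gauss_fourier:
  fixes v :: "'a::euclidean_space"
  assumes t: "t > 0"
  shows "integrable lborel (\<lambda>x::'a. complex_of_real (gauss t x) * wave v x)"
    and "(\<integral>x. complex_of_real (gauss t x) * wave v x \<partial>lborel) = of_real (exp (- pi * t * (norm v)^2))"
proof -
  let ?c = "t powr (- (DIM('a) / 2))"
  have E: "complex_of_real (gauss t x) * wave v x = of_real ?c * (complex_of_real (exp (- pi * (norm x)^2 / t)) * wave v x)" for x
    by (simp add: gauss_def)
  show "integrable lborel (\<lambda>x::'a. complex_of_real (gauss t x) * wave v x)"
    unfolding E by (intro integrable_mult_right gaussian_transform(1) t)
  have "?c * t powr (DIM('a) / 2) = 1" using t by (simp add: powr_add[symmetric])
  then show "(\<integral>x. complex_of_real (gauss t x) * wave v x \<partial>lborel) = of_real (exp (- pi * t * (norm v)^2))"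
    unfolding E integral_mult_right_zero gaussian_transform(2)[OF t] by (simp add: mult.assoc[symmetric] flip: of_real_mult)
qed

lemma gauss_integral:
  assumes t: "t > 0"
  shows "integrable lborel (gauss t :: 'a::euclidean_space \<Rightarrow> real)"
    and "(\<integral>\<^sup>+x. ennreal (gauss t (x::'a)) \<partial>lborel) = 1"
proof -
  have "integrable lborel (\<lambda>x::'a. complex_of_real (gauss t x))"
    using gauss_fourier(1)[OF t, of 0] by simp
  then show i: "integrable lborel (gauss t :: 'a::euclidean_space \<Rightarrow> real)" by (simp add: complex_of_real_integrable_eq)
  have "complex_of_real (\<integral>x. gauss t (x::'a) \<partial>lborel) = 1"
    using gauss_fourier(2)[OF t, of "0::'a"] by simp
  then have "(\<integral>x. gauss t (x::'a) \<partial>lborel) = 1" by (simp only: of_real_eq_1_iff)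
  then show "(\<integral>\<^sup>+x. ennreal (gauss t (x::'a)) \<partial>lborel) = 1"
    by (subst nn_integral_eq_integral[OF i]) auto
qed

section \<open>Translation invariance, Hoelder's inequality and Fatou's lemma\<close>

lemma nn_integral_lborel_translate:
  fixes f :: "'a::euclidean_space \<Rightarrow> ennreal"
  assumes [measurable]: "f \<in> borel_measurable borel"
  shows "(\<integral>\<^sup>+x. f (c + x) \<partial>lborel) = (\<integral>\<^sup>+x. f x \<partial>lborel)"
  by (subst (2) lborel_distr_plus[of c, symmetric]) (simp add: nn_integral_distr)

lemma nn_integral_lborel_reflect:
  fixes f :: "'a::euclidean_space \<Rightarrow> ennreal"
  assumes [measurable]: "f \<in> borel_measurable borel"
  shows "(\<integral>\<^sup>+x. f (c - x) \<partial>lborel) = (\<integral>\<^sup>+x. f x \<partial>lborel)"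
proof -
  have "lborel = distr lborel borel (\<lambda>x::'a. c - x)"
    using lborel_affine_euclidean[where c="\<lambda>_. -1" and t=c]
    by (simp add: density_1 euclidean_representation sum_negf)
  then have "(\<integral>\<^sup>+x. f x \<partial>lborel) = (\<integral>\<^sup>+x. f x \<partial>distr lborel borel (\<lambda>x::'a. c - x))" by simp
  also have "\<dots> = (\<integral>\<^sup>+x. f (c - x) \<partial>lborel)" by (simp add: nn_integral_distr)
  finally show ?thesis ..
qed

text \<open>Young's inequality for the normalised functions f / P^(1/p) and g / Q^(1/q), integrated
  with weights 1/p + 1/q = 1. The real bounds \<open>P\<close> and \<open>Q\<close> replace the
  integrals themselves so that infinite values never enter; the normalisation breaks down only when
  one of them is 0, and then the product vanishes almost everywhere.\<close>

lemma nn_integral_Holder: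
  fixes f g :: "'b \<Rightarrow> real" and p q P Q :: real
  assumes pq: "p > 1" "q > 1" "1/p + 1/q = 1"
    and [measurable]: "f \<in> borel_measurable M" "g \<in> borel_measurable M"
    and nn: "\<And>x. f x \<ge> 0" "\<And>x. g x \<ge> 0"
    and PQ: "P \<ge> 0" "Q \<ge> 0"
    and P: "(\<integral>\<^sup>+x. ennreal (f x powr p) \<partial>M) \<le> ennreal P"
    and Q: "(\<integral>\<^sup>+x. ennreal (g x powr q) \<partial>M) \<le> ennreal Q"
  shows "(\<integral>\<^sup>+x. ennreal (f x * g x) \<partial>M) \<le> ennreal (P powr (1/p) * Q powr (1/q))"
proof (cases "P = 0 \<or> Q = 0")
  case True
  have "AE x in M. f x * g x = 0"
  proof (cases "P = 0")
    case True
    then have "(\<integral>\<^sup>+x. ennreal (f x powr p) \<partial>M) = 0" using P by simp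
    then have "AE x in M. ennreal (f x powr p) = 0" by (subst (asm) nn_integral_0_iff_AE) auto
    then show ?thesis by eventually_elim (simp add: ennreal_eq_0_iff)
  next
    case False
    then have "(\<integral>\<^sup>+x. ennreal (g x powr q) \<partial>M) = 0" using Q True by simp
    then have "AE x in M. ennreal (g x powr q) = 0" by (subst (asm) nn_integral_0_iff_AE) auto
    then show ?thesis by eventually_elim (simp add: ennreal_eq_0_iff)
  qed
  then have "(\<integral>\<^sup>+x. ennreal (f x * g x) \<partial>M) = (\<integral>\<^sup>+x. 0 \<partial>M)"
    by (intro nn_integral_cong_AE) auto
  then show ?thesis by simp
next
  case False
  then have P0: "P > 0" "Q > 0" using PQ by auto
  define c where "c = P powr (1/p) * Q powr (1/q)"
  have c: "c > 0" using P0 by (simp add: c_def)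
  have "f x * g x \<le> c / (p * P) * f x powr p + c / (q * Q) * g x powr q" for x
  proof -
    let ?a = "f x / P powr (1/p)" and ?b = "g x / Q powr (1/q)"
    have "?a * ?b \<le> ?a powr p / p + ?b powr q / q"
      using pq nn P0 by (intro Youngs_inequality) auto
    also have "?a powr p = f x powr p / P" using nn P0 pq by (simp add: powr_divide powr_powr)
    also have "?b powr q = g x powr q / Q" using nn P0 pq by (simp add: powr_divide powr_powr)
    finally have "c * (?a * ?b) \<le> c * (f x powr p / P / p + g x powr q / Q / q)"
      using c by (intro mult_left_mono) auto
    moreover have "c * (?a * ?b) = f x * g x" using P0 by (simp add: c_def)
    ultimately show ?thesis by (simp add: algebra_simps)
  qed
  then have "(\<integral>\<^sup>+x. ennreal (f x * g x) \<partial>M)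
      \<le> (\<integral>\<^sup>+x. ennreal (c / (p * P)) * ennreal (f x powr p) + ennreal (c / (q * Q)) * ennreal (g x powr q) \<partial>M)"
    using c P0 pq by (intro nn_integral_mono) (simp flip: ennreal_mult' ennreal_plus)
  also have "\<dots> = ennreal (c / (p * P)) * (\<integral>\<^sup>+x. ennreal (f x powr p) \<partial>M) + ennreal (c / (q * Q)) * (\<integral>\<^sup>+x. ennreal (g x powr q) \<partial>M)"
    by (simp add: nn_integral_add nn_integral_cmult)
  also have "\<dots> \<le> ennreal (c / (p * P)) * ennreal P + ennreal (c / (q * Q)) * ennreal Q"
    by (intro add_mono mult_left_mono P Q) auto
  also have "\<dots> = ennreal (c / (p * P) * P + c / (q * Q) * Q)"
    using c P0 pq by (simp flip: ennreal_mult' ennreal_plus)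
  also have "c / (p * P) * P + c / (q * Q) * Q = c * (1/p + 1/q)" using P0 by (simp add: field_simps)
  finally show ?thesis by (simp add: pq c_def)
qed

lemma nn_integral_Cauchy_Schwarz:
  fixes f g :: "'b \<Rightarrow> real"
  assumes [measurable]: "f \<in> borel_measurable M" "g \<in> borel_measurable M"
    and nn: "\<And>x. f x \<ge> 0" "\<And>x. g x \<ge> 0"
    and PQ: "P \<ge> 0" "Q \<ge> 0"
    and P: "(\<integral>\<^sup>+x. ennreal ((f x)\<^sup>2) \<partial>M) \<le> ennreal P"
    and Q: "(\<integral>\<^sup>+x. ennreal ((g x)\<^sup>2) \<partial>M) \<le> ennreal Q"
  shows "(\<integral>\<^sup>+x. ennreal (f x * g x) \<partial>M) \<le> ennreal (sqrt P * sqrt Q)"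
  using nn_integral_Holder[of 2 2 f M g P Q] assms by (simp add: powr_half_sqrt)

text \<open>Fatou's lemma in the form that carries a uniform bound over to an almost everywhere
  limit.\<close>

lemma nn_integral_le_of_tendsto:
  fixes u :: "nat \<Rightarrow> 'b \<Rightarrow> ennreal"
  assumes [measurable]: "\<And>n. u n \<in> borel_measurable M"
    and lim: "AE x in M. (\<lambda>n. u n x) \<longlonglongrightarrow> v x"
    and le: "\<And>n. (\<integral>\<^sup>+x. u n x \<partial>M) \<le> C"
  shows "(\<integral>\<^sup>+x. v x \<partial>M) \<le> C"
proof -
  have "(\<integral>\<^sup>+x. v x \<partial>M) = (\<integral>\<^sup>+x. liminf (\<lambda>n. u n x) \<partial>M)"
    using lim by (intro nn_integral_cong_AE) (auto elim!: eventually_mono simp: lim_imp_Liminf)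
  also have "\<dots> \<le> liminf (\<lambda>n. \<integral>\<^sup>+x. u n x \<partial>M)" by (intro nn_integral_liminf) auto
  also have "\<dots> \<le> liminf (\<lambda>n::nat. C)" by (intro Liminf_mono) (simp add: le)
  also have "\<dots> = C" by (simp add: Liminf_const)
  finally show ?thesis .
qed

section \<open>Transforms of measures and their bilinear pairings\<close>

lemma borel_measurable_cnj [measurable (raw)]:
  "f \<in> borel_measurable M \<Longrightarrow> (\<lambda>x. cnj (f x)) \<in> borel_measurable M"
  by (rule borel_measurable_continuous_on) (auto intro: continuous_intros)

lemma integrable_wave:
  assumes [measurable_cong]: "sets M = sets borel" and f: "integrable M f"
  shows "integrable M (\<lambda>x. wave \<xi> x * f x)"
proof (rule Bochner_Integration.integrable_bound[OF f])
  have [measurable]: "f \<in> borel_measurable M" using f by (rule borel_measurable_integrable)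
  show "(\<lambda>x. wave \<xi> x * f x) \<in> borel_measurable M" by measurable
qed (simp add: norm_mult)

lemma fourier_bound: "cmod (fourier M f \<xi>) \<le> (\<integral>x. cmod (f x) \<partial>M)"
  using integral_norm_bound[of M "\<lambda>x. wave \<xi> x * f x"] by (simp add: fourier_wave norm_mult)

lemma borel_measurable_fourier:
  assumes "sigma_finite_measure M" and [measurable_cong]: "sets M = sets borel"
    and [measurable]: "f \<in> borel_measurable borel"
  shows "fourier M f \<in> borel_measurable borel"
proof -
  interpret sigma_finite_measure M by fact
  show ?thesis unfolding fourier_wave by measurable
qed

lemma borel_measurable_fourier_lborel [measurable]:
  "f \<in> borel_measurable borel \<Longrightarrow> fourier lborel f \<in> borel_measurable borel"
  by (rule borel_measurable_fourier) (auto intro: sigma_finite_lborel)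

lemma fourier_modulate: "fourier M (\<lambda>x. wave w x * f x) \<xi> = fourier M f (\<xi> + w)"
  by (simp add: fourier_wave wave_add mult.assoc)

lemma fourier_swap:
  fixes f g :: "'a::euclidean_space \<Rightarrow> complex"
  assumes "sigma_finite_measure M" "sigma_finite_measure N"
    and [measurable_cong]: "sets M = sets borel" "sets N = sets borel"
    and f: "integrable M f" and g: "integrable N g"
  shows "(\<integral>\<xi>. g \<xi> * fourier M f \<xi> \<partial>N) = (\<integral>x. f x * fourier N g x \<partial>M)"
proof -
  interpret M: sigma_finite_measure M by fact
  interpret N: sigma_finite_measure N by fact
  interpret pair_sigma_finite N M ..
  have [measurable]: "f \<in> borel_measurable borel" "g \<in> borel_measurable borel"
    using borel_measurable_integrable[OF f] borel_measurable_integrable[OF g]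
    unfolding measurable_cong_sets[OF assms(3) refl] measurable_cong_sets[OF assms(4) refl] by auto
  have 1: "integrable (N \<Otimes>\<^sub>M M) (\<lambda>(\<xi>,x). g \<xi> * (wave \<xi> x * f x))"
  proof (rule Fubini_integrable)
    show "integrable N (\<lambda>\<xi>. \<integral>x. cmod (case (\<xi>,x) of (\<xi>,x) \<Rightarrow> g \<xi> * (wave \<xi> x * f x)) \<partial>M)"
      using g by (simp add: norm_mult)
    show "AE \<xi> in N. integrable M (\<lambda>x. case (\<xi>,x) of (\<xi>,x) \<Rightarrow> g \<xi> * (wave \<xi> x * f x))"
      using integrable_wave[OF assms(3) f] by auto
  qed measurable
  have "(\<integral>\<xi>. g \<xi> * fourier M f \<xi> \<partial>N) = (\<integral>\<xi>. \<integral>x. g \<xi> * (wave \<xi> x * f x) \<partial>M \<partial>N)"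
    by (simp add: fourier_wave)
  also have "\<dots> = (\<integral>x. \<integral>\<xi>. g \<xi> * (wave \<xi> x * f x) \<partial>N \<partial>M)"
    using Fubini_integral[OF 1] by simp
  also have "\<dots> = (\<integral>x. \<integral>\<xi>. f x * (wave x \<xi> * g \<xi>) \<partial>N \<partial>M)"
  proof (intro Bochner_Integration.integral_cong refl)
    fix x \<xi> show "g \<xi> * (wave \<xi> x * f x) = f x * (wave x \<xi> * g \<xi>)"
      by (simp add: wave_commute[of \<xi> x])
  qed
  also have "\<dots> = (\<integral>x. f x * fourier N g x \<partial>M)" by (simp add: fourier_wave)
  finally show ?thesis .
qed

text \<open>The T T* identity: on the right the measure occurs only through its transform, as a
  convolution kernel. Splitting the kernel therefore splits the pairing.\<close>

lemma fourier_pairing: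
  fixes g h :: "'a::euclidean_space \<Rightarrow> complex"
  assumes "finite_measure \<nu>" and sets [measurable_cong]: "sets \<nu> = sets borel"
    and g: "integrable lborel g" and h: "integrable lborel h"
  shows "(\<integral>\<xi>. fourier lborel g \<xi> * cnj (fourier lborel h \<xi>) \<partial>\<nu>)
       = (\<integral>x. \<integral>y. g x * cnj (h y) * fourier \<nu> (\<lambda>_. 1) (x - y) \<partial>lborel \<partial>lborel)"
proof -
  interpret finite_measure \<nu> by fact
  have [measurable]: "g \<in> borel_measurable borel" "h \<in> borel_measurable borel"
    using borel_measurable_integrable[OF g] borel_measurable_integrable[OF h] by auto
  have hb: "integrable \<nu> (\<lambda>\<xi>. cnj (fourier lborel h \<xi>))"
    by (rule integrable_const_bound[where B="\<integral>x. cmod (h x) \<partial>lborel"]) (auto simp: fourier_bound)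
  have inner: "fourier \<nu> (\<lambda>\<xi>. cnj (fourier lborel h \<xi>)) x
      = (\<integral>y. cnj (h y) * fourier \<nu> (\<lambda>_. 1) (x - y) \<partial>lborel)" for x
  proof -
    have i: "integrable \<nu> (\<lambda>\<xi>. wave x (- \<xi>))"
      by (rule integrable_const_bound[where B=1]) auto
    \<comment> \<open>Conjugating the whole expression leaves the plain transform of
      \<open>h\<close> under the integral, to which \<open>fourier_swap\<close> applies.\<close>
    have "cnj (fourier \<nu> (\<lambda>\<xi>. cnj (fourier lborel h \<xi>)) x) = (\<integral>\<xi>. cnj (wave x \<xi>) * fourier lborel h \<xi> \<partial>\<nu>)"
      unfolding fourier_wave[of \<nu>] by (simp flip: Bochner_Integration.integral_cnj)
    also have "\<dots> = (\<integral>\<xi>. wave x (- \<xi>) * fourier lborel h \<xi> \<partial>\<nu>)"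
      using wave_diff[of x 0] by simp
    also have "\<dots> = (\<integral>y. h y * fourier \<nu> (\<lambda>\<xi>. wave x (- \<xi>)) y \<partial>lborel)"
      by (rule fourier_swap[OF sigma_finite_lborel sigma_finite_measure_axioms _ sets h i]) simp
    also have "\<dots> = (\<integral>y. cnj (cnj (h y) * fourier \<nu> (\<lambda>_. 1) (x - y)) \<partial>lborel)"
    proof (intro Bochner_Integration.integral_cong refl)
      fix y
      have "cnj (fourier \<nu> (\<lambda>_. 1) (x - y)) = (\<integral>\<xi>. cnj (wave (x - y) \<xi>) \<partial>\<nu>)"
        unfolding fourier_wave by (simp flip: Bochner_Integration.integral_cnj)
      also have "\<dots> = fourier \<nu> (\<lambda>\<xi>. wave x (- \<xi>)) y"
        unfolding fourier_wave
        by (intro Bochner_Integration.integral_cong refl)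
           (simp add: wave_def cis_cnj cis_mult inner_diff_left algebra_simps)
      finally show "h y * fourier \<nu> (\<lambda>\<xi>. wave x (- \<xi>)) y = cnj (cnj (h y) * fourier \<nu> (\<lambda>_. 1) (x - y))"
        by simp
    qed
    also have "\<dots> = cnj (\<integral>y. cnj (h y) * fourier \<nu> (\<lambda>_. 1) (x - y) \<partial>lborel)"
      by (rule Bochner_Integration.integral_cnj)
    finally show ?thesis by (simp only: complex_cnj_cancel_iff)
  qed
  have "(\<integral>\<xi>. fourier lborel g \<xi> * cnj (fourier lborel h \<xi>) \<partial>\<nu>)
      = (\<integral>\<xi>. cnj (fourier lborel h \<xi>) * fourier lborel g \<xi> \<partial>\<nu>)" by (simp add: mult.commute)
  also have "\<dots> = (\<integral>x. g x * fourier \<nu> (\<lambda>\<xi>. cnj (fourier lborel h \<xi>)) x \<partial>lborel)"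
    by (rule fourier_swap[OF sigma_finite_lborel sigma_finite_measure_axioms _ sets g hb]) simp
  finally show ?thesis by (simp add: inner mult.assoc)
qed

section \<open>Gaussian smearing of a measure\<close>

text \<open>The convolution of \<mu> with a Gaussian, encoded as the image of a product measure
  under addition. It is again a finite positive measure, so both \<open>fourier_pairing\<close> and
  the Cauchy-Schwarz inequality are available for it.\<close>

definition smear :: "real \<Rightarrow> 'a::euclidean_space measure \<Rightarrow> 'a measure" where
  "smear t \<mu> = distr (\<mu> \<Otimes>\<^sub>M density lborel (\<lambda>w. ennreal (gauss t w))) borel (\<lambda>(x, w). x + w)"

lemma sets_smear [simp, measurable_cong]: "sets (smear t \<mu>) = sets borel"
  by (simp add: smear_def)

lemma finite_measure_gauss:
  assumes "t > 0"
  shows "finite_measure (density lborel (\<lambda>w::'a::euclidean_space. ennreal (gauss t w)))"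
  by (rule finite_measureI) (simp add: emeasure_density gauss_integral(2)[OF assms])

context
  fixes \<mu> :: "'a::euclidean_space measure" and t :: real
  assumes fin: "finite_measure \<mu>" and sets_mu [measurable_cong]: "sets \<mu> = sets borel" and t: "t > 0"
begin

lemma finite_measure_smear: "finite_measure (smear t \<mu>)"
  unfolding smear_def
  by (intro finite_measure.finite_measure_distr finite_measure_pair_measure fin finite_measure_gauss t) measurable

lemma nn_integral_smear:
  assumes [measurable]: "f \<in> borel_measurable borel"
  shows "(\<integral>\<^sup>+x. f x \<partial>smear t \<mu>) = (\<integral>\<^sup>+\<xi>. \<integral>\<^sup>+w. ennreal (gauss t w) * f (\<xi> + w) \<partial>lborel \<partial>\<mu>)"
proof -
  interpret N: finite_measure "density lborel (\<lambda>w::'a. ennreal (gauss t w))"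
    by (rule finite_measure_gauss[OF t])
  show ?thesis
    unfolding smear_def
    by (simp add: nn_integral_distr N.nn_integral_fst[symmetric] nn_integral_density)
qed

lemma fourier_smear:
  "fourier (smear t \<mu>) (\<lambda>_. 1) v = fourier \<mu> (\<lambda>_. 1) v * of_real (exp (- pi * t * (norm v)\<^sup>2))"
proof -
  let ?G = "density lborel (\<lambda>w::'a. ennreal (gauss t w))"
  interpret M: finite_measure \<mu> by (rule fin)
  interpret N: finite_measure ?G by (rule finite_measure_gauss[OF t])
  interpret pair_sigma_finite \<mu> ?G ..
  interpret MN: finite_measure "\<mu> \<Otimes>\<^sub>M ?G"
    by (intro finite_measure_pair_measure fin finite_measure_gauss t)
  have i: "integrable (\<mu> \<Otimes>\<^sub>M ?G) (\<lambda>(x, w). wave v x * wave v w)"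
    by (rule MN.integrable_const_bound[where B=1]) (auto simp: norm_mult)
  have G: "(\<integral>w. wave v w \<partial>?G) = of_real (exp (- pi * t * (norm v)\<^sup>2))"
    by (subst integral_density) (auto simp: gauss_fourier(2)[OF t] scaleR_conv_of_real)
  have "fourier (smear t \<mu>) (\<lambda>_. 1) v = (\<integral>z. (case z of (x, w) \<Rightarrow> wave v (x + w)) \<partial>(\<mu> \<Otimes>\<^sub>M ?G))"
    unfolding smear_def fourier_wave by (subst integral_distr) (auto simp: case_prod_unfold)
  also have "\<dots> = (\<integral>z. (case z of (x, w) \<Rightarrow> wave v x * wave v w) \<partial>(\<mu> \<Otimes>\<^sub>M ?G))"
    by (simp only: wave_commute[of v] wave_add)
  also have "\<dots> = (\<integral>x. \<integral>w. wave v x * wave v w \<partial>?G \<partial>\<mu>)"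
    using integral_fst'[OF i] by simp
  also have "\<dots> = fourier \<mu> (\<lambda>_. 1) v * of_real (exp (- pi * t * (norm v)\<^sup>2))"
    by (simp add: G fourier_wave)
  finally show ?thesis .
qed

end

section \<open>Schur's test and the Plancherel inequality\<close>

text \<open>The squared L^2(\<nu>) norm of the transform. It is extended real, so that \<mu>, its
  smeared versions and Lebesgue measure can be treated alike without integrability
  conditions.\<close>

definition energy2 :: "'a::euclidean_space measure \<Rightarrow> ('a \<Rightarrow> complex) \<Rightarrow> ennreal" where
  "energy2 \<nu> f = (\<integral>\<^sup>+\<xi>. ennreal ((cmod (fourier lborel f \<xi>))\<^sup>2) \<partial>\<nu>)"

lemma nn_integral_exp_norm:
  fixes x :: "'a::euclidean_space"
  assumes T: "T > 0"
  shows "(\<integral>\<^sup>+y. ennreal (exp (- pi * T * (norm (x - y))\<^sup>2)) \<partial>lborel) = ennreal (T powr - (DIM('a) / 2))"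
    (is "?L = _")
proof -
  have "?L = (\<integral>\<^sup>+y. ennreal (exp (- pi * T * (norm (y::'a))\<^sup>2)) \<partial>lborel)"
    by (rule nn_integral_lborel_reflect[where f="\<lambda>y. ennreal (exp (- pi * T * (norm y)\<^sup>2))"]) measurable
  also have "\<dots> = (\<integral>\<^sup>+y. ennreal (T powr - (DIM('a) / 2)) * ennreal (gauss (1/T) (y::'a)) \<partial>lborel)"
  proof (intro nn_integral_cong)
    fix y :: 'a
    have "T powr - (DIM('a) / 2) * gauss (1/T) y = exp (- pi * T * (norm y)\<^sup>2)"
      using T by (simp add: gauss_def powr_divide powr_minus mult_ac)
    then show "ennreal (exp (- pi * T * (norm y)\<^sup>2)) = ennreal (T powr - (DIM('a) / 2)) * ennreal (gauss (1/T) y)"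
      by (simp flip: ennreal_mult)
  qed
  also have "\<dots> = ennreal (T powr - (DIM('a) / 2))"
    using T by (simp add: nn_integral_cmult gauss_integral(2))
  finally show ?thesis .
qed

text \<open>The arithmetic-geometric mean inequality splits the product |h(x)| |h(y)| into two
  squares; by the symmetry of \<open>K\<close> both halves give the same integral.\<close>

lemma Schur_symmetric:
  fixes h :: "'a::euclidean_space \<Rightarrow> complex" and K :: "'a \<Rightarrow> real"
  assumes [measurable]: "h \<in> borel_measurable borel" "K \<in> borel_measurable borel"
    and K: "\<And>x. K x \<ge> 0" "\<And>x. (\<integral>\<^sup>+y. ennreal (K (x - y)) \<partial>lborel) \<le> B" "\<And>x. K (- x) = K x"
  shows "(\<integral>\<^sup>+x. \<integral>\<^sup>+y. ennreal (cmod (h x) * cmod (h y) * K (x - y)) \<partial>lborel \<partial>lborel)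
     \<le> B * (\<integral>\<^sup>+x. ennreal ((cmod (h x))\<^sup>2) \<partial>lborel)"
proof -
  let ?f = "\<lambda>x y. ennreal ((cmod (h x))\<^sup>2 / 2) * ennreal (K (x - y))"
  let ?g = "\<lambda>x y. ennreal ((cmod (h y))\<^sup>2 / 2) * ennreal (K (x - y))"
  have "(\<integral>\<^sup>+x. \<integral>\<^sup>+y. ennreal (cmod (h x) * cmod (h y) * K (x - y)) \<partial>lborel \<partial>lborel)
     \<le> (\<integral>\<^sup>+x. \<integral>\<^sup>+y. ?f x y + ?g x y \<partial>lborel \<partial>lborel)"
  proof (intro nn_integral_mono)
    fix x y
    have "cmod (h x) * cmod (h y) \<le> 1/2 * (cmod (h x))\<^sup>2 + 1/2 * (cmod (h y))\<^sup>2"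
      using sum_squares_bound[of "cmod (h x)" "cmod (h y)"] by simp
    then have "cmod (h x) * cmod (h y) * K (x - y) \<le> (1/2 * (cmod (h x))\<^sup>2 + 1/2 * (cmod (h y))\<^sup>2) * K (x - y)"
      by (rule mult_right_mono) (rule K(1))
    also have "\<dots> = (cmod (h x))\<^sup>2 / 2 * K (x - y) + (cmod (h y))\<^sup>2 / 2 * K (x - y)"
      by (simp add: distrib_right)
    finally have "cmod (h x) * cmod (h y) * K (x - y) \<le> (cmod (h x))\<^sup>2 / 2 * K (x - y) + (cmod (h y))\<^sup>2 / 2 * K (x - y)" .
    then show "ennreal (cmod (h x) * cmod (h y) * K (x - y)) \<le> ?f x y + ?g x y"
      using K(1) by (simp flip: ennreal_mult' ennreal_plus)
  qed
  also have "\<dots> = (\<integral>\<^sup>+x. \<integral>\<^sup>+y. ?f x y \<partial>lborel \<partial>lborel) + (\<integral>\<^sup>+x. \<integral>\<^sup>+y. ?g x y \<partial>lborel \<partial>lborel)"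
    by (simp add: nn_integral_add)
  also have "(\<integral>\<^sup>+x. \<integral>\<^sup>+y. ?g x y \<partial>lborel \<partial>lborel) = (\<integral>\<^sup>+y. \<integral>\<^sup>+x. ?g x y \<partial>lborel \<partial>lborel)"
    by (rule lborel_pair.Fubini'[symmetric]) measurable
  also have "\<dots> = (\<integral>\<^sup>+x. \<integral>\<^sup>+y. ?f x y \<partial>lborel \<partial>lborel)"
  proof (intro nn_integral_cong)
    fix y x
    have "K (x - y) = K (y - x)" using K(3)[of "x - y"] by simp
    then show "?g x y = ?f y x" by simp
  qed
  also have "(\<integral>\<^sup>+x. \<integral>\<^sup>+y. ?f x y \<partial>lborel \<partial>lborel) = (\<integral>\<^sup>+x. ennreal ((cmod (h x))\<^sup>2 / 2) * (\<integral>\<^sup>+y. ennreal (K (x - y)) \<partial>lborel) \<partial>lborel)"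
    by (simp add: nn_integral_cmult)
  also have "\<dots> + \<dots> \<le> (\<integral>\<^sup>+x. ennreal ((cmod (h x))\<^sup>2 / 2) * B \<partial>lborel) + (\<integral>\<^sup>+x. ennreal ((cmod (h x))\<^sup>2 / 2) * B \<partial>lborel)"
    by (intro add_mono nn_integral_mono mult_left_mono K) auto
  also have "\<dots> = (\<integral>\<^sup>+x. (ennreal ((cmod (h x))\<^sup>2 / 2) + ennreal ((cmod (h x))\<^sup>2 / 2)) * B \<partial>lborel)"
    by (simp only: distrib_right) (rule nn_integral_add[symmetric]; measurable)
  also have "\<dots> = B * (\<integral>\<^sup>+x. ennreal ((cmod (h x))\<^sup>2) \<partial>lborel)"
    by (subst nn_integral_multc) (auto simp: mult.commute simp flip: ennreal_plus)
  finally show ?thesis .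
qed

text \<open>No integrability is assumed: the integral of a function that is not integrable is 0 by
  convention, and the bound is then trivial.\<close>

lemma norm_integral_le_nn:
  fixes F :: "'a \<Rightarrow> complex"
  assumes "(\<integral>\<^sup>+x. ennreal (cmod (F x)) \<partial>M) \<le> ennreal b" "b \<ge> 0"
  shows "cmod (\<integral>x. F x \<partial>M) \<le> b"
proof (cases "integrable M F")
  case True
  then have "ennreal (\<integral>x. cmod (F x) \<partial>M) \<le> ennreal b"
    using assms by (subst nn_integral_eq_integral[symmetric]) auto
  then have "(\<integral>x. cmod (F x) \<partial>M) \<le> b" using assms by (simp add: ennreal_le_iff)
  then show ?thesis using integral_norm_bound order_trans by blast
qed (use assms in \<open>simp add: not_integrable_integral_eq\<close>)

lemma norm_double_integral_le:
  fixes F :: "'a::euclidean_space \<Rightarrow> 'a \<Rightarrow> complex"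
  shows "ennreal (cmod (\<integral>x. \<integral>y. F x y \<partial>lborel \<partial>lborel))
    \<le> (\<integral>\<^sup>+x. \<integral>\<^sup>+y. ennreal (cmod (F x y)) \<partial>lborel \<partial>lborel)"
proof -
  have L: "ennreal (cmod (\<integral>x. G x \<partial>M)) \<le> (\<integral>\<^sup>+x. ennreal (cmod (G x)) \<partial>M)"
    for G :: "'a \<Rightarrow> complex" and M
  proof (cases "integrable M G")
    case True
    then show ?thesis
      by (subst nn_integral_eq_integral) (auto intro: ennreal_leI)
  qed (simp add: not_integrable_integral_eq)
  show ?thesis
    by (rule order_trans[OF L nn_integral_mono]) (rule L)
qed

text \<open>The weight exp(-pi |\<xi>|^2 / T) is T^(d/2) times a Gaussian density. In the pairing it
  becomes the kernel exp(-pi T |x - y|^2), whose integral T^(-d/2) cancels that factor, so Schur's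
  test yields the constant 1 for every T. Then T tends to infinity by Fatou.\<close>

lemma Plancherel_le:
  fixes h :: "'a::euclidean_space \<Rightarrow> complex"
  assumes h: "integrable lborel h"
  shows "energy2 lborel h \<le> (\<integral>\<^sup>+x. ennreal ((cmod (h x))\<^sup>2) \<partial>lborel)"
proof -
  have [measurable]: "h \<in> borel_measurable borel"
    using borel_measurable_integrable[OF h] by auto
  let ?I = "\<integral>\<^sup>+x. ennreal ((cmod (h x))\<^sup>2) \<partial>lborel"
  let ?F = "\<lambda>\<xi>. fourier lborel h \<xi>"
  have main: "(\<integral>\<^sup>+\<xi>. ennreal (exp (- pi * (norm \<xi>)\<^sup>2 / T) * (cmod (?F \<xi>))\<^sup>2) \<partial>lborel) \<le> ?I" if T: "T > 0" for T
  proof -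
    let ?G = "density lborel (\<lambda>w::'a. ennreal (gauss T w))"
    interpret G: finite_measure ?G by (rule finite_measure_gauss[OF T])
    have hat: "fourier ?G (\<lambda>_. 1) v = of_real (exp (- pi * T * (norm v)\<^sup>2))" for v
      unfolding fourier_wave by (subst integral_density) (auto simp: gauss_fourier(2)[OF T] scaleR_conv_of_real)
    have i: "integrable ?G (\<lambda>\<xi>. (cmod (?F \<xi>))\<^sup>2)"
      by (rule G.integrable_const_bound[where B="(\<integral>x. cmod (h x) \<partial>lborel)\<^sup>2"])
         (auto intro!: power_mono fourier_bound)
    have "(\<integral>\<^sup>+\<xi>. ennreal ((cmod (?F \<xi>))\<^sup>2) \<partial>?G) = ennreal (\<integral>\<xi>. (cmod (?F \<xi>))\<^sup>2 \<partial>?G)"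
      by (rule nn_integral_eq_integral[OF i]) auto
    also have "(\<integral>\<xi>. (cmod (?F \<xi>))\<^sup>2 \<partial>?G) \<le> cmod (of_real (\<integral>\<xi>. (cmod (?F \<xi>))\<^sup>2 \<partial>?G))"
      by (metis abs_ge_self norm_of_real)
    also have "complex_of_real (\<integral>\<xi>. (cmod (?F \<xi>))\<^sup>2 \<partial>?G) = (\<integral>\<xi>. ?F \<xi> * cnj (?F \<xi>) \<partial>?G)"
      by (simp flip: integral_complex_of_real complex_norm_square)
    also have "\<dots> = (\<integral>x. \<integral>y. h x * cnj (h y) * fourier ?G (\<lambda>_. 1) (x - y) \<partial>lborel \<partial>lborel)"
      by (rule fourier_pairing[OF G.finite_measure_axioms _ h h]) simp
    finally have "(\<integral>\<^sup>+\<xi>. ennreal ((cmod (?F \<xi>))\<^sup>2) \<partial>?G)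
       \<le> ennreal (cmod (\<integral>x. \<integral>y. h x * cnj (h y) * fourier ?G (\<lambda>_. 1) (x - y) \<partial>lborel \<partial>lborel))"
      by (simp add: ennreal_leI)
    also have "\<dots> \<le> (\<integral>\<^sup>+x. \<integral>\<^sup>+y. ennreal (cmod (h x * cnj (h y) * fourier ?G (\<lambda>_. 1) (x - y))) \<partial>lborel \<partial>lborel)"
      by (rule norm_double_integral_le)
    also have "\<dots> = (\<integral>\<^sup>+x. \<integral>\<^sup>+y. ennreal (cmod (h x) * cmod (h y) * exp (- pi * T * (norm (x - y))\<^sup>2)) \<partial>lborel \<partial>lborel)"
      by (simp add: hat norm_mult)
    also have "\<dots> \<le> ennreal (T powr - (DIM('a) / 2)) * ?I"
      by (rule Schur_symmetric) (auto simp: nn_integral_exp_norm[OF T, simplified])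
    finally have "(\<integral>\<^sup>+\<xi>. ennreal (gauss T \<xi>) * ennreal ((cmod (?F \<xi>))\<^sup>2) \<partial>lborel) \<le> ennreal (T powr - (DIM('a) / 2)) * ?I"
      by (simp add: nn_integral_density)
    then have "ennreal (T powr (DIM('a) / 2)) * (\<integral>\<^sup>+\<xi>. ennreal (gauss T \<xi>) * ennreal ((cmod (?F \<xi>))\<^sup>2) \<partial>lborel)
       \<le> ennreal (T powr (DIM('a) / 2)) * (ennreal (T powr - (DIM('a) / 2)) * ?I)"
      by (rule mult_left_mono) simp
    also have "\<dots> = ?I"
      using T by (simp add: mult.assoc[symmetric] powr_add[symmetric] flip: ennreal_mult)
    also have "ennreal (T powr (DIM('a) / 2)) * (\<integral>\<^sup>+\<xi>. ennreal (gauss T \<xi>) * ennreal ((cmod (?F \<xi>))\<^sup>2) \<partial>lborel)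
       = (\<integral>\<^sup>+\<xi>. ennreal (T powr (DIM('a) / 2)) * (ennreal (gauss T \<xi>) * ennreal ((cmod (?F \<xi>))\<^sup>2)) \<partial>lborel)"
      by (rule nn_integral_cmult[symmetric]) measurable
    also have "\<dots> = (\<integral>\<^sup>+\<xi>. ennreal (exp (- pi * (norm \<xi>)\<^sup>2 / T) * (cmod (?F \<xi>))\<^sup>2) \<partial>lborel)"
    proof (intro nn_integral_cong)
      fix \<xi> :: 'a
      have "T powr (DIM('a) / 2) * gauss T \<xi> = exp (- pi * (norm \<xi>)\<^sup>2 / T)"
        using T by (simp add: gauss_def mult.assoc[symmetric] powr_add[symmetric])
      then show "ennreal (T powr (DIM('a) / 2)) * (ennreal (gauss T \<xi>) * ennreal ((cmod (?F \<xi>))\<^sup>2))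
        = ennreal (exp (- pi * (norm \<xi>)\<^sup>2 / T) * (cmod (?F \<xi>))\<^sup>2)"
        by (simp add: mult.assoc[symmetric] flip: ennreal_mult)
    qed
    finally show ?thesis .
  qed
  show ?thesis unfolding energy2_def
  proof (rule nn_integral_le_of_tendsto)
    show "AE \<xi> in lborel. (\<lambda>n. ennreal (exp (- pi * (norm \<xi>)\<^sup>2 / real (Suc n)) * (cmod (?F \<xi>))\<^sup>2)) \<longlonglongrightarrow> ennreal ((cmod (?F \<xi>))\<^sup>2)"
    proof (intro AE_I2 tendsto_ennrealI)
      fix \<xi> :: 'a
      have "(\<lambda>n. - pi * (norm \<xi>)\<^sup>2 / real (Suc n)) \<longlonglongrightarrow> 0"
        by (intro tendsto_divide_0[OF tendsto_const] filterlim_at_top_imp_at_infinity filterlim_compose[OF filterlim_real_sequentially] filterlim_Suc)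
      then have "(\<lambda>n. exp (- pi * (norm \<xi>)\<^sup>2 / real (Suc n)) * (cmod (?F \<xi>))\<^sup>2) \<longlonglongrightarrow> exp 0 * (cmod (?F \<xi>))\<^sup>2"
        by (intro tendsto_intros)
      then show "(\<lambda>n. exp (- pi * (norm \<xi>)\<^sup>2 / real (Suc n)) * (cmod (?F \<xi>))\<^sup>2) \<longlonglongrightarrow> (cmod (?F \<xi>))\<^sup>2"
        by simp
    qed
    show "(\<integral>\<^sup>+\<xi>. ennreal (exp (- pi * (norm \<xi>)\<^sup>2 / real (Suc n)) * (cmod (?F \<xi>))\<^sup>2) \<partial>lborel) \<le> ?I" for n
      by (rule main) simp
  qed measurable
qed

section \<open>Low frequencies: consequences of the ball condition\<close>

lemma ennreal_le_suminf: "f j \<le> (\<Sum>j. f j)" for f :: "nat \<Rightarrow> ennreal"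
  using sum_le_suminf[OF summableI, of "{j}" f] by simp

text \<open>Shells of width sqrt t around \<open>u\<close>: on the j-th one the Gaussian is at most
  t^(-d/2) exp(-pi j^2), and its mass is at most that of the ball of radius (j + 1) sqrt t, which is
  C (j + 1)^\<alpha> t^(\<alpha>/2). The Gaussian factor makes the sum over j converge.\<close>

lemma gauss_growth:
  fixes \<mu> :: "'a::euclidean_space measure" and \<alpha> :: real
  assumes "finite_measure \<mu>" and [measurable_cong]: "sets \<mu> = sets borel"
    and C: "C > 0" "\<And>x r. r > 0 \<Longrightarrow> measure \<mu> (ball x r) \<le> C * r powr \<alpha>"
    and \<alpha>: "0 < \<alpha>"
  shows "\<exists>C'>0. \<forall>t>0. \<forall>u. (\<integral>\<^sup>+\<xi>. ennreal (gauss t (u - \<xi>)) \<partial>\<mu>) \<le> ennreal (C' * t powr (- ((DIM('a) - \<alpha>) / 2)))"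
proof -
  interpret finite_measure \<mu> by fact
  have [measurable]: "ball x r \<in> sets \<mu>" for x r by (simp add: assms(2))
  define a where "a = (\<lambda>j::nat. exp (- pi * (real j)\<^sup>2) * (real j + 1) powr \<alpha>)"
  have sa: "summable a"
  proof (rule summable_comparison_test_bigo)
    show "summable (\<lambda>j. norm (exp (- real j)))"
      using summable_geometric[of "exp (-1::real)"] by (simp add: exp_of_nat_mult[symmetric])
    show "a \<in> O(\<lambda>j. exp (- real j))" unfolding a_def by real_asymp
  qed
  have a0: "a j > 0" for j by (simp add: a_def add_pos_nonneg)
  have S0: "suminf a > 0" by (rule suminf_pos[OF sa]) (rule a0)
  show ?thesis
  proof (intro exI[of _ "C * suminf a"] conjI allI impI)
    show "C * suminf a > 0" using C S0 by simp
    fix t :: real and u :: 'a assume t: "t > 0"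
    define c where "c = t powr (- (DIM('a) / 2))"
    have c: "c > 0" using t by (simp add: c_def)
    have pt: "ennreal (gauss t (u - \<xi>)) \<le> (\<Sum>j. ennreal (c * exp (- pi * (real j)\<^sup>2)) * indicator (ball u ((real j + 1) * sqrt t)) \<xi>)" for \<xi>
    proof -
      define j where "j = nat \<lfloor>norm (u - \<xi>) / sqrt t\<rfloor>"
      have j: "real j \<le> norm (u - \<xi>) / sqrt t" "norm (u - \<xi>) / sqrt t < real j + 1"
        unfolding j_def using t by (simp_all add: of_nat_nat)
      have "\<xi> \<in> ball u ((real j + 1) * sqrt t)"
        using j(2) t by (simp add: dist_norm field_simps)
      moreover have "gauss t (u - \<xi>) \<le> c * exp (- pi * (real j)\<^sup>2)"
      proof -
        have "(real j)\<^sup>2 \<le> (norm (u - \<xi>) / sqrt t)\<^sup>2" using j(1) by (intro power_mono) auto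
        also have "\<dots> = (norm (u - \<xi>))\<^sup>2 / t" using t by (simp add: power_divide)
        finally have "pi * (real j)\<^sup>2 \<le> pi * ((norm (u - \<xi>))\<^sup>2 / t)"
          by (intro mult_left_mono) auto
        then show ?thesis using c by (simp add: gauss_def c_def)
      qed
      ultimately have "ennreal (gauss t (u - \<xi>)) \<le> ennreal (c * exp (- pi * (real j)\<^sup>2)) * indicator (ball u ((real j + 1) * sqrt t)) \<xi>"
        by (simp add: ennreal_leI)
      also have "\<dots> \<le> (\<Sum>j. ennreal (c * exp (- pi * (real j)\<^sup>2)) * indicator (ball u ((real j + 1) * sqrt t)) \<xi>)"
        by (rule ennreal_le_suminf)
      finally show ?thesis .
    qed
    have "(\<integral>\<^sup>+\<xi>. ennreal (gauss t (u - \<xi>)) \<partial>\<mu>)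
       \<le> (\<integral>\<^sup>+\<xi>. (\<Sum>j. ennreal (c * exp (- pi * (real j)\<^sup>2)) * indicator (ball u ((real j + 1) * sqrt t)) \<xi>) \<partial>\<mu>)"
      by (intro nn_integral_mono pt)
    also have "\<dots> = (\<Sum>j. ennreal (c * exp (- pi * (real j)\<^sup>2)) * emeasure \<mu> (ball u ((real j + 1) * sqrt t)))"
      by (subst nn_integral_suminf) (auto simp: nn_integral_cmult_indicator assms(2))
    also have "\<dots> \<le> (\<Sum>j. ennreal (C * t powr (- ((DIM('a) - \<alpha>) / 2)) * a j))"
    proof (intro suminf_le allI summableI)
      fix j
      have "c * exp (- pi * (real j)\<^sup>2) * measure \<mu> (ball u ((real j + 1) * sqrt t))
          \<le> c * exp (- pi * (real j)\<^sup>2) * (C * ((real j + 1) * sqrt t) powr \<alpha>)"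
        using c t by (intro mult_left_mono C(2)) auto
      also have "((real j + 1) * sqrt t) powr \<alpha> = (real j + 1) powr \<alpha> * t powr (\<alpha> / 2)"
        using t by (simp add: powr_mult powr_half_sqrt[symmetric] powr_powr)
      also have "c * exp (- pi * (real j)\<^sup>2) * (C * ((real j + 1) powr \<alpha> * t powr (\<alpha> / 2))) = C * (c * t powr (\<alpha> / 2)) * a j"
        by (simp add: a_def)
      also have "c * t powr (\<alpha> / 2) = t powr (- ((DIM('a) - \<alpha>) / 2))"
        by (simp add: c_def powr_add[symmetric] diff_divide_distrib)
      finally show "ennreal (c * exp (- pi * (real j)\<^sup>2)) * emeasure \<mu> (ball u ((real j + 1) * sqrt t))
         \<le> ennreal (C * t powr (- ((DIM('a) - \<alpha>) / 2)) * a j)"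
        using c by (simp add: emeasure_eq_measure ennreal_leI flip: ennreal_mult)
    qed
    also have "\<dots> = ennreal (\<Sum>j. C * t powr (- ((DIM('a) - \<alpha>) / 2)) * a j)"
      using C sa by (intro suminf_ennreal2 summable_mult) (auto intro!: mult_nonneg_nonneg simp: less_imp_le a0)
    also have "(\<Sum>j. C * t powr (- ((DIM('a) - \<alpha>) / 2)) * a j) = C * suminf a * t powr (- ((DIM('a) - \<alpha>) / 2))"
      using suminf_mult[OF sa] by simp
    finally show "(\<integral>\<^sup>+\<xi>. ennreal (gauss t (u - \<xi>)) \<partial>\<mu>) \<le> ennreal (C * suminf a * t powr (- ((DIM('a) - \<alpha>) / 2)))" .
  qed
qed

context
  fixes \<mu> :: "'a::euclidean_space measure" and t :: real
  assumes fin: "finite_measure \<mu>" and sets_mu [measurable_cong]: "sets \<mu> = sets borel" and t: "t > 0"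
begin

text \<open>Only the total mass 1 of the Gaussian enters, so the bound is the same at every
  scale.\<close>

lemma energy2_smear_modulate:
  assumes [measurable]: "g \<in> borel_measurable borel"
    and N: "\<And>w. energy2 \<mu> (\<lambda>x. wave w x * g x) \<le> B"
  shows "energy2 (smear t \<mu>) g \<le> B"
proof -
  interpret finite_measure \<mu> by (rule fin)
  interpret pair_sigma_finite \<mu> "lborel::'a measure" ..
  have "energy2 (smear t \<mu>) g = (\<integral>\<^sup>+\<xi>. \<integral>\<^sup>+w. ennreal (gauss t w) * ennreal ((cmod (fourier lborel g (\<xi> + w)))\<^sup>2) \<partial>lborel \<partial>\<mu>)"
    unfolding energy2_def by (rule nn_integral_smear[OF fin sets_mu t]) measurable
  also have "\<dots> = (\<integral>\<^sup>+w. \<integral>\<^sup>+\<xi>. ennreal (gauss t w) * ennreal ((cmod (fourier lborel g (\<xi> + w)))\<^sup>2) \<partial>\<mu> \<partial>lborel)"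
    by (rule Fubini'[symmetric]) measurable
  also have "\<dots> = (\<integral>\<^sup>+w. ennreal (gauss t w) * energy2 \<mu> (\<lambda>x. wave w x * g x) \<partial>lborel)"
    by (simp add: energy2_def nn_integral_cmult fourier_modulate)
  also have "\<dots> \<le> (\<integral>\<^sup>+w. ennreal (gauss t (w::'a)) * B \<partial>lborel)"
    by (intro nn_integral_mono mult_left_mono N) auto
  also have "\<dots> = B" by (simp add: nn_integral_multc gauss_integral(2)[OF t])
  finally show ?thesis .
qed

text \<open>By Tonelli the inner integral in \<open>G\<close> is the density of the smeared measure;
  once it is bounded by \<open>c\<close>, Plancherel finishes.\<close>

lemma energy2_smear_growth:
  assumes h: "integrable lborel h"
    and G: "\<And>u. (\<integral>\<^sup>+\<xi>. ennreal (gauss t (u - \<xi>)) \<partial>\<mu>) \<le> ennreal c"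
  shows "energy2 (smear t \<mu>) h \<le> ennreal c * (\<integral>\<^sup>+x. ennreal ((cmod (h x))\<^sup>2) \<partial>lborel)"
proof -
  interpret finite_measure \<mu> by (rule fin)
  interpret pair_sigma_finite \<mu> "lborel::'a measure" ..
  have [measurable]: "h \<in> borel_measurable borel"
    using borel_measurable_integrable[OF h] by auto
  let ?F = "\<lambda>u. ennreal ((cmod (fourier lborel h u))\<^sup>2)"
  have "energy2 (smear t \<mu>) h = (\<integral>\<^sup>+\<xi>. \<integral>\<^sup>+w. ennreal (gauss t w) * ?F (\<xi> + w) \<partial>lborel \<partial>\<mu>)"
    unfolding energy2_def by (rule nn_integral_smear[OF fin sets_mu t]) measurable
  also have "\<dots> = (\<integral>\<^sup>+\<xi>. \<integral>\<^sup>+u. ennreal (gauss t (u - \<xi>)) * ?F u \<partial>lborel \<partial>\<mu>)"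
  proof (rule nn_integral_cong)
    fix \<xi> :: 'a
    show "(\<integral>\<^sup>+w. ennreal (gauss t w) * ?F (\<xi> + w) \<partial>lborel) = (\<integral>\<^sup>+u. ennreal (gauss t (u - \<xi>)) * ?F u \<partial>lborel)"
      using nn_integral_lborel_translate[of "\<lambda>u. ennreal (gauss t (u - \<xi>)) * ?F u" \<xi>] by simp
  qed
  also have "\<dots> = (\<integral>\<^sup>+u. \<integral>\<^sup>+\<xi>. ennreal (gauss t (u - \<xi>)) * ?F u \<partial>\<mu> \<partial>lborel)"
    by (rule Fubini'[symmetric]) measurable
  also have "\<dots> = (\<integral>\<^sup>+u. (\<integral>\<^sup>+\<xi>. ennreal (gauss t (u - \<xi>)) \<partial>\<mu>) * ?F u \<partial>lborel)"
    by (simp add: nn_integral_multc)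
  also have "\<dots> \<le> (\<integral>\<^sup>+u. ennreal c * ?F u \<partial>lborel)"
    by (intro nn_integral_mono mult_right_mono G) auto
  also have "\<dots> = ennreal c * energy2 lborel h"
    by (simp add: nn_integral_cmult energy2_def)
  also have "\<dots> \<le> ennreal c * (\<integral>\<^sup>+x. ennreal ((cmod (h x))\<^sup>2) \<partial>lborel)"
    by (intro mult_left_mono Plancherel_le h) auto
  finally show ?thesis .
qed

end

text \<open>The two factors of the pairing are estimated in \<open>L\<^sup>2\<close> of the smeared measure, which has
  a bounded density.\<close>

lemma smear_pairing_le:
  fixes g h :: "'a::euclidean_space \<Rightarrow> complex"
  assumes "finite_measure \<mu>" and [measurable_cong]: "sets \<mu> = sets borel" and t: "t > 0"
    and g: "integrable lborel g" and h: "integrable lborel h"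
    and N: "\<And>w. energy2 \<mu> (\<lambda>x. wave w x * g x) \<le> ennreal B" "B \<ge> 0"
    and G: "\<And>u. (\<integral>\<^sup>+\<xi>. ennreal (gauss t (u - \<xi>)) \<partial>\<mu>) \<le> ennreal c" "c \<ge> 0"
    and H: "(\<integral>\<^sup>+x. ennreal ((cmod (h x))\<^sup>2) \<partial>lborel) \<le> ennreal H" "H \<ge> 0"
  shows "cmod (\<integral>\<xi>. fourier lborel g \<xi> * cnj (fourier lborel h \<xi>) \<partial>smear t \<mu>) \<le> sqrt B * sqrt (c * H)"
proof -
  have [measurable]: "g \<in> borel_measurable borel" "h \<in> borel_measurable borel"
    using borel_measurable_integrable[OF g] borel_measurable_integrable[OF h] by auto
  have A: "energy2 (smear t \<mu>) g \<le> ennreal B"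
    by (rule energy2_smear_modulate[OF assms(1-3) _ N(1)]) measurable
  have "energy2 (smear t \<mu>) h \<le> ennreal c * ennreal H"
    by (rule order_trans[OF energy2_smear_growth[OF assms(1-3) h G(1)]]) (intro mult_left_mono H, simp)
  then have B: "energy2 (smear t \<mu>) h \<le> ennreal (c * H)" using G H by (simp add: ennreal_mult)
  have CS: "(\<integral>\<^sup>+\<xi>. ennreal (cmod (fourier lborel g \<xi>) * cmod (fourier lborel h \<xi>)) \<partial>smear t \<mu>) \<le> ennreal (sqrt B * sqrt (c * H))"
    using A B N(2) G(2) H(2) by (intro nn_integral_Cauchy_Schwarz) (auto simp: energy2_def)
  show "cmod (\<integral>\<xi>. fourier lborel g \<xi> * cnj (fourier lborel h \<xi>) \<partial>smear t \<mu>) \<le> sqrt B * sqrt (c * H)"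
    using CS N(2) G(2) H(2) by (intro norm_integral_le_nn) (auto simp: norm_mult)
qed

section \<open>Splitting into low and high frequencies\<close>

lemma integrable_convolution_kernel:
  fixes g h k :: "'a::euclidean_space \<Rightarrow> complex"
  assumes g: "integrable lborel g" and h: "integrable lborel h"
    and [measurable]: "k \<in> borel_measurable borel" and k: "\<And>v. cmod (k v) \<le> B"
  shows "integrable (lborel \<Otimes>\<^sub>M lborel) (\<lambda>(x, y). g x * cnj (h y) * k (x - y))"
proof -
  have [measurable]: "g \<in> borel_measurable borel" "h \<in> borel_measurable borel"
    using borel_measurable_integrable[OF g] borel_measurable_integrable[OF h] by auto
  have "integrable (lborel \<Otimes>\<^sub>M lborel) (\<lambda>(x, y). g x * cnj (h y))"
  proof (rule lborel_pair.Fubini_integrable)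
    show "integrable lborel (\<lambda>x. \<integral>y. cmod (case (x, y) of (x, y) \<Rightarrow> g x * cnj (h y)) \<partial>lborel)"
      using g by (simp add: norm_mult)
    show "AE x in lborel. integrable lborel (\<lambda>y. case (x, y) of (x, y) \<Rightarrow> g x * cnj (h y))"
      using h by auto
  qed measurable
  then have i: "integrable (lborel \<Otimes>\<^sub>M lborel) (\<lambda>z. of_real B * (case z of (x, y) \<Rightarrow> g x * cnj (h y)))"
    by (rule integrable_mult_right)
  have "B \<ge> 0" using k[of 0] norm_ge_zero order_trans by blast
  show ?thesis
  proof (rule Bochner_Integration.integrable_bound[OF i])
    show "AE z in lborel \<Otimes>\<^sub>M lborel. cmod (case z of (x, y) \<Rightarrow> g x * cnj (h y) * k (x - y))
        \<le> cmod (of_real B * (case z of (x, y) \<Rightarrow> g x * cnj (h y)))"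
    proof (intro AE_I2, clarify)
      fix x y
      have "cmod (k (x - y)) * cmod (g x * cnj (h y)) \<le> B * cmod (g x * cnj (h y))"
        by (intro mult_right_mono k) auto
      then show "cmod (g x * cnj (h y) * k (x - y)) \<le> cmod (of_real B * (g x * cnj (h y)))"
        using \<open>B \<ge> 0\<close> by (simp add: norm_mult mult_ac)
    qed
  qed measurable
qed

text \<open>Additivity of iterated Bochner integrals needs integrability of each piece, so the
  integrals pass through the product measure, where boundedness of the kernels provides it.\<close>

lemma convolution_kernel_sum:
  fixes g h :: "'a::euclidean_space \<Rightarrow> complex"
  assumes g: "integrable lborel g" and h: "integrable lborel h"
    and k [measurable]: "\<And>i. i \<in> I \<Longrightarrow> k i \<in> borel_measurable borel"
    and B: "\<And>i v. i \<in> I \<Longrightarrow> cmod (k i v) \<le> B i"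
  shows "(\<integral>x. \<integral>y. g x * cnj (h y) * (\<Sum>i\<in>I. c i * k i (x - y)) \<partial>lborel \<partial>lborel)
    = (\<Sum>i\<in>I. c i * (\<integral>x. \<integral>y. g x * cnj (h y) * k i (x - y) \<partial>lborel \<partial>lborel))"
proof -
  have i: "integrable (lborel \<Otimes>\<^sub>M lborel) (\<lambda>(x, y). g x * cnj (h y) * k i (x - y))" if "i \<in> I" for i
    by (rule integrable_convolution_kernel[OF g h k[OF that] B[OF that]])
  have I1: "(\<integral>x. \<integral>y. g x * cnj (h y) * (\<Sum>i\<in>I. c i * k i (x - y)) \<partial>lborel \<partial>lborel)
      = (\<integral>z. (case z of (x, y) \<Rightarrow> g x * cnj (h y) * (\<Sum>i\<in>I. c i * k i (x - y))) \<partial>(lborel \<Otimes>\<^sub>M lborel))"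
  proof (rule lborel_pair.integral_fst)
    show "integrable (lborel \<Otimes>\<^sub>M lborel) (\<lambda>(x, y). g x * cnj (h y) * (\<Sum>i\<in>I. c i * k i (x - y)))"
    proof (rule integrable_convolution_kernel[OF g h])
      show "cmod (\<Sum>i\<in>I. c i * k i v) \<le> (\<Sum>i\<in>I. cmod (c i) * B i)" for v
        by (intro order_trans[OF norm_sum] sum_mono) (auto simp: norm_mult intro!: mult_left_mono B)
    qed measurable
  qed
  have I2: "(\<integral>x. \<integral>y. g x * cnj (h y) * k i (x - y) \<partial>lborel \<partial>lborel)
     = (\<integral>z. (case z of (x, y) \<Rightarrow> g x * cnj (h y) * k i (x - y)) \<partial>(lborel \<Otimes>\<^sub>M lborel))" if "i \<in> I" for i
    by (rule lborel_pair.integral_fst[OF i[OF that]])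
  have "(\<integral>z. (case z of (x, y) \<Rightarrow> g x * cnj (h y) * (\<Sum>i\<in>I. c i * k i (x - y))) \<partial>(lborel \<Otimes>\<^sub>M lborel))
     = (\<integral>z. (\<Sum>i\<in>I. c i * (case z of (x, y) \<Rightarrow> g x * cnj (h y) * k i (x - y))) \<partial>(lborel \<Otimes>\<^sub>M lborel))"
    by (intro Bochner_Integration.integral_cong refl) (auto simp: sum_distrib_left mult_ac)
  also have "\<dots> = (\<Sum>i\<in>I. c i * (\<integral>z. (case z of (x, y) \<Rightarrow> g x * cnj (h y) * k i (x - y)) \<partial>(lborel \<Otimes>\<^sub>M lborel)))"
    using i by (subst Bochner_Integration.integral_sum) auto
  finally show ?thesis using I1 I2 by simp
qed

text \<open>The splitting is \<open>1 = (1 - G)\<^sup>M - \<Sum>\<^sub>i\<^sub>\<ge>\<^sub>1 (M choose i) (-G)\<^sup>i\<close> with \<open>G = exp (- pi t |v|\<^sup>2)\<close>;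
  multiplication of the transform of \<open>\<mu>\<close> by \<open>G\<^sup>i\<close> smears \<open>\<mu>\<close> at scale \<open>i t\<close>.\<close>

lemma frequency_split:
  fixes g h :: "'a::euclidean_space \<Rightarrow> complex"
  assumes fin: "finite_measure \<mu>" and sets_mu [measurable_cong]: "sets \<mu> = sets borel" and t: "t > 0"
    and g: "integrable lborel g" and h: "integrable lborel h"
    and L: "\<And>i. 1 \<le> i \<Longrightarrow> cmod (\<integral>\<xi>. fourier lborel g \<xi> * cnj (fourier lborel h \<xi>) \<partial>smear (real i * t) \<mu>) \<le> L"
    and H: "(\<integral>\<^sup>+x. \<integral>\<^sup>+y. ennreal (cmod (g x) * cmod (h y) * (cmod (fourier \<mu> (\<lambda>_. 1) (x - y)) * (1 - exp (- pi * t * (norm (x - y))\<^sup>2)) ^ M)) \<partial>lborel \<partial>lborel) \<le> ennreal H" "H \<ge> 0"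
  shows "cmod (\<integral>\<xi>. fourier lborel g \<xi> * cnj (fourier lborel h \<xi>) \<partial>\<mu>) \<le> H + 2 ^ M * L"
proof -
  interpret finite_measure \<mu> by (rule fin)
  let ?m = "fourier \<mu> (\<lambda>_. 1)"
  let ?G = "\<lambda>v::'a. complex_of_real (exp (- pi * t * (norm v)\<^sup>2))"
  let ?Q = "\<lambda>k. \<integral>x. \<integral>y. g x * cnj (h y) * k (x - y) \<partial>lborel \<partial>lborel"
  have m [measurable]: "?m \<in> borel_measurable borel"
    by (rule borel_measurable_fourier[OF sigma_finite_measure_axioms sets_mu]) measurable
  have G1: "0 \<le> exp (- pi * t * (norm v)\<^sup>2)" "exp (- pi * t * (norm v)\<^sup>2) \<le> 1" for v :: 'a
    using t by auto
  have mb: "cmod (?m v) \<le> measure \<mu> (space \<mu>)" for v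
    using fourier_bound[of \<mu> "\<lambda>_. 1" v] by simp
  \<comment> \<open>Index 0 is reserved for the high-frequency kernel, with coefficient 1; the
    indices from 1 on carry the smeared measures. One finite sum then represents the whole transform
    of \<mu>.\<close>
  define k where "k = (\<lambda>i v. if i = 0 then ?m v * (1 - ?G v) ^ M else ?m v * ?G v ^ i)"
  define c where "c = (\<lambda>i. if i = 0 then 1 else - of_nat (M choose i) * (- 1) ^ i :: complex)"
  have km: "k i \<in> borel_measurable borel" for i
    unfolding k_def by (cases "i = 0") (simp; measurable)+
  have kb: "cmod (k i v) \<le> measure \<mu> (space \<mu>)" for i v
  proof -
    have "1 - ?G v = of_real (1 - exp (- pi * t * (norm v)\<^sup>2))" by simp
    then have "cmod ((1 - ?G v) ^ M) \<le> 1"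
      using G1[of v] by (simp only: norm_power norm_of_real) (intro power_le_one, auto)
    moreover have "cmod (?G v ^ i) \<le> 1"
      using G1[of v] by (simp only: norm_power norm_of_real) (intro power_le_one, auto)
    ultimately show ?thesis
      using mult_mono[OF mb[of v], of _ 1] by (auto simp: k_def norm_mult)
  qed
  have ksum: "(\<Sum>i\<le>M. c i * k i v) = ?m v" for v
  proof -
    have "(1 - ?G v) ^ M = (- ?G v + 1) ^ M" by simp
    also have "\<dots> = (\<Sum>i\<le>M. of_nat (M choose i) * (- ?G v) ^ i)"
      by (subst binomial_ring) simp
    also have "\<dots> = 1 + (\<Sum>i\<in>{1..M}. of_nat (M choose i) * (- ?G v) ^ i)"
      by (simp add: atMost_atLeast0 sum.atLeast_Suc_atMost)
    finally have 1: "(1 - ?G v) ^ M - (\<Sum>i\<in>{1..M}. of_nat (M choose i) * (- ?G v) ^ i) = 1" by simp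
    have "(\<Sum>i\<le>M. c i * k i v) = ?m v * (1 - ?G v) ^ M + (\<Sum>i\<in>{1..M}. c i * k i v)"
      by (simp add: atMost_atLeast0 sum.atLeast_Suc_atMost c_def k_def)
    also have "(\<Sum>i\<in>{1..M}. c i * k i v) = (\<Sum>i\<in>{1..M}. ?m v * (- (of_nat (M choose i) * (- ?G v) ^ i)))"
      by (intro sum.cong refl) (simp only: c_def k_def power_minus[of "?G v"], auto)
    also have "\<dots> = ?m v * (- (\<Sum>i\<in>{1..M}. of_nat (M choose i) * (- ?G v) ^ i))"
      by (simp only: sum_distrib_left[symmetric] sum_negf)
    also have "?m v * (1 - ?G v) ^ M + \<dots> = ?m v * ((1 - ?G v) ^ M - (\<Sum>i\<in>{1..M}. of_nat (M choose i) * (- ?G v) ^ i))"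
      by (simp only: ring_distribs diff_conv_add_uminus)
    finally show ?thesis by (simp only: 1 mult_1_right)
  qed
  have "(\<integral>\<xi>. fourier lborel g \<xi> * cnj (fourier lborel h \<xi>) \<partial>\<mu>) = ?Q ?m"
    by (rule fourier_pairing[OF fin sets_mu g h])
  also have "\<dots> = (\<Sum>i\<le>M. c i * ?Q (k i))"
    unfolding ksum[symmetric] by (rule convolution_kernel_sum[OF g h km kb])
  also have "\<dots> = ?Q (k 0) + (\<Sum>i\<in>{1..M}. c i * ?Q (k i))"
    by (simp add: atMost_atLeast0 sum.atLeast_Suc_atMost c_def)
  also have "cmod \<dots> \<le> cmod (?Q (k 0)) + (\<Sum>i\<in>{1..M}. cmod (c i * ?Q (k i)))"
    by (intro order_trans[OF norm_triangle_ineq] add_left_mono norm_sum)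
  also have "\<dots> \<le> H + (\<Sum>i\<in>{1..M}. real (M choose i) * L)"
  proof (intro add_mono sum_mono)
    have "ennreal (cmod (?Q (k 0))) \<le> (\<integral>\<^sup>+x. \<integral>\<^sup>+y. ennreal (cmod (g x * cnj (h y) * k 0 (x - y))) \<partial>lborel \<partial>lborel)"
      by (rule norm_double_integral_le)
    also have "\<dots> = (\<integral>\<^sup>+x. \<integral>\<^sup>+y. ennreal (cmod (g x) * cmod (h y) * (cmod (?m (x - y)) * (1 - exp (- pi * t * (norm (x - y))\<^sup>2)) ^ M)) \<partial>lborel \<partial>lborel)"
    proof (intro nn_integral_cong arg_cong[where f=ennreal])
      fix x y :: 'a
      have "1 - ?G (x - y) = of_real (1 - exp (- pi * t * (norm (x - y))\<^sup>2))" by simp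
      then have "cmod (1 - ?G (x - y)) = 1 - exp (- pi * t * (norm (x - y))\<^sup>2)"
        using G1[of "x - y"] by (simp only: norm_of_real)
      then show "cmod (g x * cnj (h y) * k 0 (x - y)) = cmod (g x) * cmod (h y) * (cmod (?m (x - y)) * (1 - exp (- pi * t * (norm (x - y))\<^sup>2)) ^ M)"
        by (simp add: k_def norm_mult norm_power)
    qed
    finally have "ennreal (cmod (?Q (k 0))) \<le> ennreal H" using H(1) by (rule order_trans)
    then show "cmod (?Q (k 0)) \<le> H" using H(2) by (simp add: ennreal_le_iff)
  next
    fix i assume i: "i \<in> {1..M}"
    have it: "real i * t > 0" using i t by simp
    have "k i = fourier (smear (real i * t) \<mu>) (\<lambda>_. 1)"
    proof
      fix v
      have "?G v ^ i = of_real (exp (- pi * (real i * t) * (norm v)\<^sup>2))"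
        by (simp add: exp_of_nat_mult[symmetric] mult_ac flip: of_real_power)
      then show "k i v = fourier (smear (real i * t) \<mu>) (\<lambda>_. 1) v"
        using i unfolding fourier_smear[OF fin sets_mu it] by (simp add: k_def)
    qed
    then have "?Q (k i) = ?Q (fourier (smear (real i * t) \<mu>) (\<lambda>_. 1))" by simp
    also have "\<dots> = (\<integral>\<xi>. fourier lborel g \<xi> * cnj (fourier lborel h \<xi>) \<partial>smear (real i * t) \<mu>)"
      by (rule fourier_pairing[symmetric, OF finite_measure_smear[OF fin sets_mu it] _ g h]) simp
    finally have "cmod (?Q (k i)) \<le> L" using L[of i] i by simp
    then show "cmod (c i * ?Q (k i)) \<le> real (M choose i) * L"
      using i by (auto simp: c_def norm_mult norm_power intro!: mult_left_mono)
  qed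
  also have "(\<Sum>i\<in>{1..M}. real (M choose i) * L) = (\<Sum>i\<in>{1..M}. real (M choose i)) * L"
    by (simp add: sum_distrib_right)
  also have "\<dots> \<le> 2 ^ M * L"
  proof (rule mult_right_mono)
    have "(\<Sum>i\<in>{1..M}. M choose i) \<le> (\<Sum>i\<le>M. M choose i)" by (intro sum_mono2) auto
    then have "real (\<Sum>i\<in>{1..M}. M choose i) \<le> real (2 ^ M)" by (simp only: choose_row_sum of_nat_le_iff)
    then show "(\<Sum>i\<in>{1..M}. real (M choose i)) \<le> 2 ^ M" by simp
    show "L \<ge> 0" using L[of 1] norm_ge_zero order_trans by blast
  qed
  finally show ?thesis by simp
qed

section \<open>High frequencies: consequences of the energy condition\<close>

text \<open>For z \<le> 1 the left side is at most z^M, hence at most z^a; for z \<ge> 1 it is at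
  most 1. The large power \<open>M\<close> is what admits exponents beyond 1.\<close>

lemma one_minus_exp_power_le:
  fixes z a :: real
  assumes "z \<ge> 0" "0 \<le> a" "a \<le> real M" "M > 0"
  shows "(1 - exp (- z)) ^ M \<le> z powr a"
\<comment> \<open>At 0 both sides vanish: the left because M > 0, the right because
  \<open>0 powr a = 0\<close> even for a = 0.\<close>
proof (cases "z = 0")
  case True
  then show ?thesis using assms by (simp add: zero_power)
next
  case False
  then have z: "z > 0" using assms by simp
  show ?thesis
  proof (cases "z \<le> 1")
    case True
    have "1 - exp (- z) \<le> z" using exp_ge_add_one_self[of "- z"] by simp
    then have "(1 - exp (- z)) ^ M \<le> z ^ M" using z by (intro power_mono) auto
    also have "\<dots> = z powr real M" using z by (simp add: powr_realpow)
    also have "\<dots> \<le> z powr a" using True z assms by (intro powr_mono') auto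
    finally show ?thesis .
  next
    case False
    have "(1 - exp (- z)) ^ M \<le> 1" using z by (intro power_le_one) auto
    also have "1 \<le> z powr a" using False assms by (intro ge_one_powr_ge_zero) auto
    finally show ?thesis .
  qed
qed

text \<open>A form of Young's convolution inequality on sets, from
  \<open>V \<le> l + l powr (1 - q) * V powr q\<close> with the optimal level \<open>l\<close>.\<close>

lemma set_convolution_le:
  fixes V :: "'a::euclidean_space \<Rightarrow> real"
  assumes [measurable]: "V \<in> borel_measurable borel" "E \<in> sets borel" "F \<in> sets borel"
    and V: "\<And>x. V x \<ge> 0" and q: "q > 1"
    and W: "(\<integral>\<^sup>+x. ennreal (V x powr q) \<partial>lborel) \<le> ennreal w" "w > 0"
    and E: "emeasure lborel E = ennreal e" "e \<ge> 0" and F: "emeasure lborel F = ennreal f" "f \<ge> 0"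
  shows "(\<integral>\<^sup>+x. \<integral>\<^sup>+y. ennreal (indicator E x * indicator F y * V (x - y)) \<partial>lborel \<partial>lborel)
    \<le> ennreal (2 * w powr (1/q) * (e * f) powr (1 - 1 / (2 * q)))" (is "?L \<le> _")
proof (cases "e * f = 0")
  case True
  have "AE x in lborel. (\<integral>\<^sup>+y. ennreal (indicator E x * indicator F y * V (x - y)) \<partial>lborel) = 0"
  proof (cases "e = 0")
    case True
    then have "AE x in lborel. x \<notin> E" using E by (intro AE_not_in) (auto simp: null_sets_def)
    then show ?thesis by eventually_elim simp
  next
    case False
    then have "AE y in lborel. y \<notin> F" using \<open>e * f = 0\<close> F by (intro AE_not_in) (auto simp: null_sets_def)
    then have "AE y in lborel. ennreal (indicator E x * indicator F y * V (x - y)) = 0" for x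
      by eventually_elim simp
    then show ?thesis by (simp add: nn_integral_0_iff_AE)
  qed
  then have "?L = 0" by (simp add: nn_integral_0_iff_AE)
  then show ?thesis by simp
next
  case False
  then have ef: "e > 0" "f > 0" using E F by auto
  \<comment> \<open>Solves l e f = l^(1-q) (e f)^(1/2) w, the equality of the two terms to be added
    below.\<close>
  define l where "l = (w * (e * f) powr (-1/2)) powr (1/q)"
  have l: "l > 0" using ef W by (simp add: l_def)
  have Vl: "V x \<le> l + l powr (1 - q) * V x powr q" for x
  proof (cases "V x \<le> l")
    case True
    then show ?thesis by (simp add: add_increasing2)
  next
    case False
    have "V x = V x powr (1 - q) * V x powr q" using False l by (simp add: powr_add[symmetric])
    also have "\<dots> \<le> l powr (1 - q) * V x powr q"
      using False l q by (intro mult_right_mono powr_mono2') auto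
    finally show ?thesis using l by simp
  qed
  let ?c = "l powr (1 - q)"
  let ?I = "\<integral>\<^sup>+x. \<integral>\<^sup>+y. ennreal (indicator E x * indicator F y * V (x - y) powr q) \<partial>lborel \<partial>lborel"
  have I1: "?I \<le> ennreal (e * w)"
  proof -
    have "?I \<le> (\<integral>\<^sup>+x. indicator E x * (\<integral>\<^sup>+y. ennreal (V (x - y) powr q) \<partial>lborel) \<partial>lborel)"
      by (intro nn_integral_mono, subst nn_integral_cmult[symmetric], simp, intro nn_integral_mono)
         (auto split: split_indicator)
    also have "\<dots> = (\<integral>\<^sup>+x. indicator E x * (\<integral>\<^sup>+y. ennreal (V y powr q) \<partial>lborel) \<partial>lborel)"
      by (subst nn_integral_lborel_reflect[where f="\<lambda>y. ennreal (V y powr q)"]) auto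
    also have "\<dots> \<le> (\<integral>\<^sup>+x. indicator E x * ennreal w \<partial>lborel)"
      by (intro nn_integral_mono mult_left_mono W) auto
    also have "\<dots> = ennreal (e * w)" using E W by (simp add: nn_integral_multc ennreal_mult)
    finally show ?thesis .
  qed
  have I2: "?I \<le> ennreal (f * w)"
  proof -
    have "?I = (\<integral>\<^sup>+y. \<integral>\<^sup>+x. ennreal (indicator E x * indicator F y * V (x - y) powr q) \<partial>lborel \<partial>lborel)"
      by (rule lborel_pair.Fubini'[symmetric]) measurable
    also have "\<dots> \<le> (\<integral>\<^sup>+y. indicator F y * (\<integral>\<^sup>+x. ennreal (V (- y + x) powr q) \<partial>lborel) \<partial>lborel)"
      by (intro nn_integral_mono, subst nn_integral_cmult[symmetric], simp, intro nn_integral_mono)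
         (auto split: split_indicator)
    also have "\<dots> = (\<integral>\<^sup>+y. indicator F y * (\<integral>\<^sup>+x. ennreal (V x powr q) \<partial>lborel) \<partial>lborel)"
      by (subst nn_integral_lborel_translate[where f="\<lambda>y. ennreal (V y powr q)"]) auto
    also have "\<dots> \<le> (\<integral>\<^sup>+x. indicator F x * ennreal w \<partial>lborel)"
      by (intro nn_integral_mono mult_left_mono W) auto
    also have "\<dots> = ennreal (f * w)" using F W by (simp add: nn_integral_multc ennreal_mult)
    finally show ?thesis .
  qed
  \<comment> \<open>Integrating in either variable first gives the two bounds e w and f w; the
    geometric mean of e and f replaces the smaller one by a symmetric quantity.\<close>
  have mn: "min e f \<le> (e * f) powr (1/2)"
  proof -
    have "min e f = sqrt (min e f * min e f)" using ef by simp
    also have "\<dots> \<le> sqrt (e * f)" using ef by (intro real_sqrt_le_mono mult_mono) auto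
    finally show ?thesis using ef by (simp add: powr_half_sqrt)
  qed
  have "?I \<le> ennreal (min e f * w)" using I1 I2 by (cases "e \<le> f") (auto simp: min_def)
  also have "\<dots> \<le> ennreal ((e * f) powr (1/2) * w)"
    using mn W by (intro ennreal_leI mult_right_mono) auto
  finally have I: "?I \<le> ennreal ((e * f) powr (1/2) * w)" .
  have "?L \<le> (\<integral>\<^sup>+x. \<integral>\<^sup>+y. ennreal l * (indicator E x * indicator F y) + ennreal ?c * ennreal (indicator E x * indicator F y * V (x - y) powr q) \<partial>lborel \<partial>lborel)"
    using l Vl by (intro nn_integral_mono) (auto split: split_indicator simp flip: ennreal_mult' ennreal_plus)
  also have "\<dots> = (\<integral>\<^sup>+x. \<integral>\<^sup>+y. ennreal l * (indicator E x * indicator F y) \<partial>lborel \<partial>lborel) + ennreal ?c * ?I"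
    by (simp add: nn_integral_add nn_integral_cmult)
  also have "(\<integral>\<^sup>+x. \<integral>\<^sup>+y. ennreal l * (indicator E x * indicator F y) \<partial>lborel \<partial>lborel) = ennreal l * (ennreal e * ennreal f)"
    using E F by (simp add: nn_integral_cmult nn_integral_multc)
  also have "ennreal l * (ennreal e * ennreal f) + ennreal ?c * ?I \<le> ennreal l * (ennreal e * ennreal f) + ennreal ?c * ennreal ((e * f) powr (1/2) * w)"
    by (intro add_left_mono mult_left_mono I) auto
  also have "\<dots> = ennreal (l * (e * f) + ?c * ((e * f) powr (1/2) * w))"
    using l ef W by (simp flip: ennreal_mult' ennreal_plus)
  also have "l * (e * f) + ?c * ((e * f) powr (1/2) * w) = 2 * w powr (1/q) * (e * f) powr (1 - 1 / (2 * q))"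
  proof -
    define X where "X = e * f"
    have X: "X > 0" using ef by (simp add: X_def)
    have le: "l = w powr (1/q) * X powr (- (1/(2*q)))"
      using W X by (simp add: l_def X_def[symmetric] powr_mult powr_powr)
    have "l * X = w powr (1/q) * (X powr (- (1/(2*q))) * X powr 1)" using X by (simp add: le)
    also have "X powr (- (1/(2*q))) * X powr 1 = X powr (1 - 1/(2*q))" by (simp only: powr_add[symmetric]) simp
    finally have 1: "l * X = w powr (1/q) * X powr (1 - 1/(2*q))" .
    have "?c * (X powr (1/2) * w) = (w powr ((1/q) * (1 - q)) * w powr 1) * (X powr (- (1/(2*q)) * (1 - q)) * X powr (1/2))"
      using W X by (simp add: le powr_mult powr_powr)
    also have "\<dots> = w powr ((1/q) * (1 - q) + 1) * X powr (- (1/(2*q)) * (1 - q) + 1/2)"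
      by (simp only: powr_add)
    also have "(1/q) * (1 - q) + 1 = 1/q" using q by (simp add: field_simps)
    also have "- (1/(2*q)) * (1 - q) + 1/2 = 1 - 1/(2*q)" using q by (simp add: field_simps)
    finally show ?thesis using 1 by (simp add: X_def[symmetric])
  qed
  finally show ?thesis .
qed

text \<open>The endpoint q = infinity of \<open>set_convolution_le\<close>, needed for \<theta> =
  0.\<close>

lemma set_convolution_bounded:
  fixes V :: "'a::euclidean_space \<Rightarrow> real"
  assumes [measurable]: "E \<in> sets borel" "F \<in> sets borel"
    and V: "\<And>x. V x \<le> w" "w \<ge> 0"
    and E: "emeasure lborel E = ennreal e" "e \<ge> 0" and F: "emeasure lborel F = ennreal f" "f \<ge> 0"
  shows "(\<integral>\<^sup>+x. \<integral>\<^sup>+y. ennreal (indicator E x * indicator F y * V (x - y)) \<partial>lborel \<partial>lborel)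
    \<le> ennreal (w * (e * f))" (is "?L \<le> _")
proof -
  have "?L \<le> (\<integral>\<^sup>+x. \<integral>\<^sup>+y. ennreal w * (indicator E x * indicator F y) \<partial>lborel \<partial>lborel)"
    using V by (intro nn_integral_mono) (auto split: split_indicator intro: ennreal_leI)
  also have "\<dots> = ennreal w * (ennreal e * ennreal f)"
    using E F by (simp add: nn_integral_cmult nn_integral_multc)
  also have "\<dots> = ennreal (w * (e * f))" using E F V by (simp add: ennreal_mult)
  finally show ?thesis .
qed

text \<open>Take q = 2 / \<theta> and b = s / \<theta> - d. With a = b / (2 q) the factor (t
  |v|^2)^a from \<open>one_minus_exp_power_le\<close>, raised to the power q, is t^(b/2) times
  exactly the weight |v|^b of the energy. Convolution on sets then gives t^(b / (2 q)), and b / (2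
  q) = (s - d \<theta>) / 4.\<close>

lemma high_frequency_le:
  fixes \<mu> :: "'a::euclidean_space measure" and s \<theta> :: real
  assumes fin: "finite_measure \<mu>" and sets_mu [measurable_cong]: "sets \<mu> = sets borel"
    and \<theta>: "0 \<le> \<theta>" "\<theta> \<le> 1" and s: "real DIM('a) * \<theta> < s"
    and en: "fourier_energy s \<theta> \<mu> < \<infinity>"
  shows "\<exists>C>0. \<exists>M. \<forall>t>0. \<forall>E F e f. E \<in> sets borel \<longrightarrow> F \<in> sets borel \<longrightarrow>
      emeasure lborel E = ennreal e \<longrightarrow> e \<ge> 0 \<longrightarrow> emeasure lborel F = ennreal f \<longrightarrow> f \<ge> 0 \<longrightarrow>
      (\<integral>\<^sup>+x. \<integral>\<^sup>+y. ennreal (indicator E x * indicator F y *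
         (cmod (fourier \<mu> (\<lambda>_. 1) (x - y)) * (1 - exp (- pi * t * (norm (x - y))\<^sup>2)) ^ M)) \<partial>lborel \<partial>lborel)
      \<le> ennreal (C * t powr ((s - real DIM('a) * \<theta>) / 4) * (e * f) powr (1 - \<theta> / 4))"
proof -
  interpret finite_measure \<mu> by (rule fin)
  let ?m = "fourier \<mu> (\<lambda>_. 1)"
  have m [measurable]: "?m \<in> borel_measurable borel"
    by (rule borel_measurable_fourier[OF sigma_finite_measure_axioms sets_mu]) measurable
  \<comment> \<open>The exponents used below are s / 4 and (s - d \<theta>) / 4, both at most
    s.\<close>
  obtain M :: nat where M: "s \<le> real M" using real_arch_simple by blast
  have "s > 0" using s \<theta> by (smt (verit) mult_nonneg_nonneg of_nat_0_le_iff)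
  then have M0: "M > 0" using M by (cases M) auto
  define V where "V = (\<lambda>t v. cmod (?m v) * (1 - exp (- pi * t * (norm (v::'a))\<^sup>2)) ^ M)"
  have Vm [measurable]: "V t \<in> borel_measurable borel" for t unfolding V_def by measurable
  have V0: "V t v \<ge> 0" if "t > 0" for t v using that by (auto simp: V_def)
  have V1: "V t v \<le> cmod (?m v) * (pi * t * (norm v)\<^sup>2) powr a" if "t > 0" "0 \<le> a" "a \<le> real M" for t v a
    unfolding V_def using one_minus_exp_power_le[of "pi * t * (norm v)\<^sup>2" a M] that M0
    by (intro mult_left_mono) auto
  show ?thesis
  proof (cases "\<theta> = 0")
    case True
    define J where "J = enn2real (fourier_energy s \<theta> \<mu>)"
    have J0: "J \<ge> 0" by (simp add: J_def)
    have J: "(cmod (?m v))\<^sup>2 * norm v powr s \<le> J" for v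
    proof -
      have "ennreal ((cmod (?m v))\<^sup>2 * norm v powr s) \<le> fourier_energy s \<theta> \<mu>"
        unfolding fourier_energy_def True by (auto intro: SUP_upper)
      also have "\<dots> = ennreal J" using en by (simp add: J_def)
      finally show ?thesis using J0 by (simp add: ennreal_le_iff)
    qed
    define C where "C = sqrt J * pi powr (s / 4) + 1"
    have V2: "V t v \<le> C * t powr (s / 4)" if t: "t > 0" for t v
    proof (cases "v = 0")
      case True
      then show ?thesis using M0 J0 by (simp add: V_def C_def zero_power)
    next
      case False
      have "V t v \<le> cmod (?m v) * (pi * t * (norm v)\<^sup>2) powr (s / 4)"
        using t M \<open>s > 0\<close> by (intro V1) auto
      also have "(pi * t * (norm v)\<^sup>2) powr (s / 4) = pi powr (s/4) * t powr (s/4) * norm v powr (s / 2)"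
        using t False by (simp add: powr_mult powr_powr flip: powr_numeral)
      also have "cmod (?m v) * (pi powr (s/4) * t powr (s/4) * norm v powr (s / 2))
        = sqrt ((cmod (?m v))\<^sup>2 * norm v powr s) * pi powr (s/4) * t powr (s/4)"
        by (simp add: real_sqrt_mult powr_half_sqrt[symmetric] powr_powr)
      also have "\<dots> \<le> sqrt J * pi powr (s/4) * t powr (s/4)"
        by (intro mult_right_mono real_sqrt_le_mono J) auto
      also have "\<dots> \<le> C * t powr (s/4)" by (intro mult_right_mono) (auto simp: C_def)
      finally show ?thesis .
    qed
    have C: "C > 0" using J0 by (simp add: C_def add_nonneg_pos)
    show ?thesis
    proof (intro exI[of _ C] conjI C exI[of _ M] allI impI)
      fix t :: real and E F :: "'a set" and e f :: real
      assume A: "t > 0" "E \<in> sets borel" "F \<in> sets borel" "emeasure lborel E = ennreal e" "e \<ge> 0" "emeasure lborel F = ennreal f" "f \<ge> 0"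
      have "(\<integral>\<^sup>+x. \<integral>\<^sup>+y. ennreal (indicator E x * indicator F y * V t (x - y)) \<partial>lborel \<partial>lborel) \<le> ennreal (C * t powr (s/4) * (e * f))"
        using C by (intro set_convolution_bounded A V2) auto
      then show "(\<integral>\<^sup>+x. \<integral>\<^sup>+y. ennreal (indicator E x * indicator F y *
         (cmod (?m (x - y)) * (1 - exp (- pi * t * (norm (x - y))\<^sup>2)) ^ M)) \<partial>lborel \<partial>lborel)
        \<le> ennreal (C * t powr ((s - real DIM('a) * \<theta>) / 4) * (e * f) powr (1 - \<theta> / 4))"
        using True A by (simp add: V_def)
    qed
  next
    case False
    then have \<theta>0: "\<theta> > 0" using \<theta> by simp
    define q where "q = 2 / \<theta>"
    have q: "q > 1" using \<theta>0 \<theta> by (simp add: q_def field_simps)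
    define b where "b = s / \<theta> - real DIM('a)"
    have b: "b > 0" using s \<theta>0 by (simp add: b_def field_simps)
    let ?J = "\<integral>\<^sup>+\<xi>. ennreal (cmod (?m \<xi>) powr q * norm \<xi> powr b) \<partial>lborel"
    \<comment> \<open>The added 1 makes \<open>J\<close> positive, as
      \<open>set_convolution_le\<close> demands of its bound \<open>w\<close>.\<close>
    define J where "J = enn2real ?J + 1"
    have Jfin: "?J < \<infinity>" using en False by (auto simp: fourier_energy_def ennreal_powr_def q_def b_def split: if_splits simp: top.not_eq_extremum)
    have J0: "J > 0" by (simp add: J_def add_nonneg_pos)
    have J: "?J \<le> ennreal J" using Jfin by (simp add: J_def)
    define C where "C = 2 * (J * pi powr (b / 2)) powr (1 / q)"
    have C: "C > 0" using J0 by (simp add: C_def)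
    have VW: "(\<integral>\<^sup>+v. ennreal (V t v powr q) \<partial>lborel) \<le> ennreal (J * pi powr (b / 2) * t powr (b / 2))" if t: "t > 0" for t
    proof -
      have a: "0 \<le> b / (2 * q)" "b / (2 * q) \<le> real M"
      proof -
        show "0 \<le> b / (2 * q)" using b q by simp
        have "b / (2 * q) = (s - real DIM('a) * \<theta>) / 4" using \<theta>0 by (simp add: b_def q_def field_simps)
        also have "\<dots> \<le> s" using \<open>s > 0\<close> \<theta>0 by (simp add: field_simps)
        finally show "b / (2 * q) \<le> real M" using M by simp
      qed
      have "V t v powr q \<le> pi powr (b / 2) * t powr (b / 2) * (cmod (?m v) powr q * norm v powr b)" for v
      proof -
        have "V t v powr q \<le> (cmod (?m v) * (pi * t * (norm v)\<^sup>2) powr (b / (2 * q))) powr q"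
          using V0[OF t] V1[OF t a] q by (intro powr_mono2) auto
        also have "\<dots> = cmod (?m v) powr q * (pi * t * (norm v)\<^sup>2) powr (b / 2)"
          using q t by (simp add: powr_mult powr_powr)
        also have "(pi * t * (norm v)\<^sup>2) powr (b / 2) = pi powr (b / 2) * t powr (b / 2) * norm v powr b"
          using t by (cases "v = 0") (simp_all add: powr_mult powr_powr flip: powr_numeral)
        finally show ?thesis by (simp add: mult_ac)
      qed
      then have "(\<integral>\<^sup>+v. ennreal (V t v powr q) \<partial>lborel) \<le> (\<integral>\<^sup>+v. ennreal (pi powr (b / 2) * t powr (b / 2)) * ennreal (cmod (?m v) powr q * norm v powr b) \<partial>lborel)"
        by (intro nn_integral_mono) (simp flip: ennreal_mult)
      also have "\<dots> = ennreal (pi powr (b / 2) * t powr (b / 2)) * ?J" by (rule nn_integral_cmult) measurable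
      also have "\<dots> \<le> ennreal (pi powr (b / 2) * t powr (b / 2)) * ennreal J" by (intro mult_left_mono J) auto
      also have "\<dots> = ennreal (J * pi powr (b / 2) * t powr (b / 2))" using J0 by (simp add: mult_ac flip: ennreal_mult)
      finally show ?thesis .
    qed
    show ?thesis
    proof (intro exI[of _ C] conjI C exI[of _ M] allI impI)
      fix t :: real and E F :: "'a set" and e f :: real
      assume A: "t > 0" "E \<in> sets borel" "F \<in> sets borel" "emeasure lborel E = ennreal e" "e \<ge> 0" "emeasure lborel F = ennreal f" "f \<ge> 0"
      let ?w = "J * pi powr (b / 2) * t powr (b / 2)"
      have "(\<integral>\<^sup>+x. \<integral>\<^sup>+y. ennreal (indicator E x * indicator F y * V t (x - y)) \<partial>lborel \<partial>lborel)
         \<le> ennreal (2 * ?w powr (1/q) * (e * f) powr (1 - 1 / (2 * q)))"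
        using J0 A(1) by (intro set_convolution_le A V0 q VW) auto
      also have "2 * ?w powr (1/q) = C * t powr ((s - real DIM('a) * \<theta>) / 4)"
      proof -
        have "b / (2 * q) = (s - real DIM('a) * \<theta>) / 4" using \<theta>0 by (simp add: b_def q_def field_simps)
        moreover have "2 * ?w powr (1/q) = C * t powr (b / (2 * q))"
          using J0 A(1) by (simp add: C_def powr_mult powr_powr)
        ultimately show ?thesis by (simp only:)
      qed
      also have "1 - 1 / (2 * q) = 1 - \<theta> / 4" by (simp add: q_def)
      finally show "(\<integral>\<^sup>+x. \<integral>\<^sup>+y. ennreal (indicator E x * indicator F y *
         (cmod (?m (x - y)) * (1 - exp (- pi * t * (norm (x - y))\<^sup>2)) ^ M)) \<partial>lborel \<partial>lborel)
        \<le> ennreal (C * t powr ((s - real DIM('a) * \<theta>) / 4) * (e * f) powr (1 - \<theta> / 4))"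
        by (simp add: V_def)
    qed
  qed
qed

lemma integrable_indicator_bounded:
  fixes g :: "'a::euclidean_space \<Rightarrow> complex"
  assumes [measurable]: "g \<in> borel_measurable borel" "E \<in> sets borel"
    and E: "emeasure lborel E = ennreal e"
    and g: "\<And>x. cmod (g x) \<le> a * indicator E x"
  shows "integrable lborel g"
proof (rule Bochner_Integration.integrable_bound)
  show "integrable lborel (\<lambda>x. a * indicator E x :: real)"
    using E by (intro integrable_mult_right integrable_real_indicator) (auto simp: less_top[symmetric])
  show "AE x in lborel. norm (g x) \<le> norm (a * indicator E x :: real)"
    using g by (auto intro: order_trans[OF _ abs_ge_self])
qed measurable

section \<open>The two-term estimate of a pairing\<close>

text \<open>The two factors play different roles: \<open>g\<close> is controlled by an assumed
  restriction bound \<open>N\<close> for all its modulations, \<open>h\<close> by Plancherel.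
  Everything except the two constants is quantified inside, since the scale and the level sets will
  vary while the constants must not.\<close>

lemma pair_estimate:
  fixes \<mu> :: "'a::euclidean_space measure" and \<alpha> s \<theta> :: real
  assumes fin: "finite_measure \<mu>" and sets_mu [measurable_cong]: "sets \<mu> = sets borel"
    and \<alpha>: "0 < \<alpha>" "\<alpha> < real DIM('a)"
    and ball: "\<exists>C>0. \<forall>x. \<forall>r>0. measure \<mu> (ball x r) \<le> C * r powr \<alpha>"
    and \<theta>: "0 \<le> \<theta>" "\<theta> \<le> 1" and s: "real DIM('a) * \<theta> < s"
    and en: "fourier_energy s \<theta> \<mu> < \<infinity>"
  shows "\<exists>cH cL. cH > 0 \<and> cL > 0 \<and> (\<forall>t g h a b E F e f N. t > 0 \<longrightarrow>
    g \<in> borel_measurable borel \<longrightarrow> h \<in> borel_measurable borel \<longrightarrow> E \<in> sets borel \<longrightarrow> F \<in> sets borel \<longrightarrow>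
    emeasure lborel E = ennreal e \<longrightarrow> e \<ge> 0 \<longrightarrow> emeasure lborel F = ennreal f \<longrightarrow> f \<ge> 0 \<longrightarrow> a \<ge> 0 \<longrightarrow> b \<ge> 0 \<longrightarrow>
    (\<forall>x. cmod (g x) \<le> a * indicator E x) \<longrightarrow> (\<forall>x. cmod (h x) \<le> b * indicator F x) \<longrightarrow> N \<ge> 0 \<longrightarrow>
    (\<forall>w. energy2 \<mu> (\<lambda>x. wave w x * g x) \<le> ennreal N) \<longrightarrow>
    cmod (\<integral>\<xi>. fourier lborel g \<xi> * cnj (fourier lborel h \<xi>) \<partial>\<mu>)
      \<le> cH * t powr ((s - real DIM('a) * \<theta>) / 4) * (a * b) * (e * f) powr (1 - \<theta> / 4)
        + cL * t powr (- ((real DIM('a) - \<alpha>) / 4)) * sqrt N * (b * sqrt f))"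
proof -
  obtain C where C: "C > 0" "\<forall>x. \<forall>r>0. measure \<mu> (ball x r) \<le> C * r powr \<alpha>" using ball by blast
  obtain c where c: "c > 0" and gr: "\<And>t u. t > 0 \<Longrightarrow> (\<integral>\<^sup>+\<xi>. ennreal (gauss t (u - \<xi>)) \<partial>\<mu>) \<le> ennreal (c * t powr (- ((real DIM('a) - \<alpha>) / 2)))"
    using gauss_growth[OF fin sets_mu C(1) _ \<alpha>(1)] C(2) by blast
  obtain cH M where cH: "cH > 0" and hi: "\<forall>t>0. \<forall>E F e f. E \<in> sets borel \<longrightarrow> F \<in> sets borel \<longrightarrow>
      emeasure lborel E = ennreal e \<longrightarrow> e \<ge> 0 \<longrightarrow> emeasure lborel F = ennreal f \<longrightarrow> f \<ge> 0 \<longrightarrow>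
      (\<integral>\<^sup>+x. \<integral>\<^sup>+y. ennreal (indicator E x * indicator F y *
         (cmod (fourier \<mu> (\<lambda>_. 1) (x - y)) * (1 - exp (- pi * t * (norm (x - y))\<^sup>2)) ^ M)) \<partial>lborel \<partial>lborel)
      \<le> ennreal (cH * t powr ((s - real DIM('a) * \<theta>) / 4) * (e * f) powr (1 - \<theta> / 4))"
    using high_frequency_le[OF fin sets_mu \<theta> s en] by blast
  \<comment> \<open>2^M bounds the sum of the binomial coefficients of the splitting; the root comes
    from Cauchy-Schwarz.\<close>
  define cL where "cL = 2 ^ M * sqrt c"
  show ?thesis
  proof (rule exI[of _ cH], rule exI[of _ cL], intro conjI allI impI)
    show "cH > 0" by (rule cH)
    show "cL > 0" using c by (simp add: cL_def)
    fix t :: real and g h :: "'a \<Rightarrow> complex" and a b :: real and E F :: "'a set" and e f N :: real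
    assume t: "t > 0" and meas [measurable]: "g \<in> borel_measurable borel" "h \<in> borel_measurable borel"
      and EF [measurable]: "E \<in> sets borel" "F \<in> sets borel"
      and E: "emeasure lborel E = ennreal e" "e \<ge> 0" and F: "emeasure lborel F = ennreal f" "f \<ge> 0"
      and ab: "a \<ge> 0" "b \<ge> 0"
      and gE: "\<forall>x. cmod (g x) \<le> a * indicator E x" and hF: "\<forall>x. cmod (h x) \<le> b * indicator F x"
      and N: "N \<ge> 0" "\<forall>w. energy2 \<mu> (\<lambda>x. wave w x * g x) \<le> ennreal N"
    have g: "integrable lborel g" by (rule integrable_indicator_bounded[OF meas(1) EF(1) E(1)]) (use gE in blast)
    have h: "integrable lborel h" by (rule integrable_indicator_bounded[OF meas(2) EF(2) F(1)]) (use hF in blast)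
    have h2: "(\<integral>\<^sup>+x. ennreal ((cmod (h x))\<^sup>2) \<partial>lborel) \<le> ennreal (b\<^sup>2 * f)"
    proof -
      have "(\<integral>\<^sup>+x. ennreal ((cmod (h x))\<^sup>2) \<partial>lborel) \<le> (\<integral>\<^sup>+x. ennreal (b\<^sup>2) * indicator F x \<partial>lborel)"
      proof (intro nn_integral_mono)
        fix x
        have "(cmod (h x))\<^sup>2 \<le> (b * indicator F x)\<^sup>2" using hF by (intro power_mono) auto
        also have "\<dots> = b\<^sup>2 * indicator F x" by (auto split: split_indicator)
        finally show "ennreal ((cmod (h x))\<^sup>2) \<le> ennreal (b\<^sup>2) * indicator F x"
          by (auto split: split_indicator intro: ennreal_leI)
      qed
      also have "\<dots> = ennreal (b\<^sup>2 * f)" using F by (simp add: nn_integral_cmult_indicator ennreal_mult)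
      finally show ?thesis .
    qed
    let ?A = "real DIM('a) - \<alpha>"
    define L where "L = sqrt N * sqrt (c * t powr (- (?A / 2)) * (b\<^sup>2 * f))"
    have "cmod (\<integral>\<xi>. fourier lborel g \<xi> * cnj (fourier lborel h \<xi>) \<partial>\<mu>)
      \<le> cH * t powr ((s - real DIM('a) * \<theta>) / 4) * (a * b) * (e * f) powr (1 - \<theta> / 4) + 2 ^ M * L"
    proof (rule frequency_split[OF fin sets_mu t g h])
      fix i :: nat assume i: "1 \<le> i"
      then have it: "real i * t > 0" "t \<le> real i * t" using t by auto
      have "cmod (\<integral>\<xi>. fourier lborel g \<xi> * cnj (fourier lborel h \<xi>) \<partial>smear (real i * t) \<mu>)
        \<le> sqrt N * sqrt (c * (real i * t) powr (- (?A / 2)) * (b\<^sup>2 * f))"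
        using N h2 c ab F by (intro smear_pairing_le[OF fin sets_mu it(1) g h] gr it) auto
      \<comment> \<open>The density bound decreases with the scale, so its value at \<open>t\<close>
        serves for all multiples i t.\<close>
      also have "\<dots> \<le> L" unfolding L_def
        using c ab F it t \<alpha> by (intro mult_left_mono mult_right_mono real_sqrt_le_mono powr_mono2') (auto simp: N)
      finally show "cmod (\<integral>\<xi>. fourier lborel g \<xi> * cnj (fourier lborel h \<xi>) \<partial>smear (real i * t) \<mu>) \<le> L" .
    next
      let ?V = "\<lambda>v::'a. cmod (fourier \<mu> (\<lambda>_. 1) v) * (1 - exp (- pi * t * (norm v)\<^sup>2)) ^ M"
      have V0: "?V v \<ge> 0" for v using t by auto
      interpret finite_measure \<mu> by (rule fin)
      have m [measurable]: "fourier \<mu> (\<lambda>_. 1) \<in> borel_measurable borel"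
        by (rule borel_measurable_fourier[OF sigma_finite_measure_axioms sets_mu]) measurable
      have "(\<integral>\<^sup>+x. \<integral>\<^sup>+y. ennreal (cmod (g x) * cmod (h y) * ?V (x - y)) \<partial>lborel \<partial>lborel)
        \<le> (\<integral>\<^sup>+x. \<integral>\<^sup>+y. ennreal (a * b) * ennreal (indicator E x * indicator F y * ?V (x - y)) \<partial>lborel \<partial>lborel)"
      proof (intro nn_integral_mono)
        fix x y
        have "cmod (g x) * cmod (h y) \<le> (a * indicator E x) * (b * indicator F y)"
          using gE hF ab by (intro mult_mono) auto
        then have "cmod (g x) * cmod (h y) * ?V (x - y) \<le> (a * indicator E x) * (b * indicator F y) * ?V (x - y)"
          by (intro mult_right_mono V0)
        also have "\<dots> = (a * b) * (indicator E x * indicator F y * ?V (x - y))" by simp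
        finally show "ennreal (cmod (g x) * cmod (h y) * ?V (x - y)) \<le> ennreal (a * b) * ennreal (indicator E x * indicator F y * ?V (x - y))"
          using ab V0 by (subst ennreal_mult[symmetric]) (auto intro: ennreal_leI)
      qed
      also have "\<dots> = ennreal (a * b) * (\<integral>\<^sup>+x. \<integral>\<^sup>+y. ennreal (indicator E x * indicator F y * ?V (x - y)) \<partial>lborel \<partial>lborel)"
        by (simp add: nn_integral_cmult)
      also have "\<dots> \<le> ennreal (a * b) * ennreal (cH * t powr ((s - real DIM('a) * \<theta>) / 4) * (e * f) powr (1 - \<theta> / 4))"
        using hi t EF E F by (intro mult_left_mono) auto
      also have "\<dots> = ennreal (cH * t powr ((s - real DIM('a) * \<theta>) / 4) * (a * b) * (e * f) powr (1 - \<theta> / 4))"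
        using ab cH by (simp add: mult_ac flip: ennreal_mult)
      finally show "(\<integral>\<^sup>+x. \<integral>\<^sup>+y. ennreal (cmod (g x) * cmod (h y) * ?V (x - y)) \<partial>lborel \<partial>lborel)
        \<le> ennreal (cH * t powr ((s - real DIM('a) * \<theta>) / 4) * (a * b) * (e * f) powr (1 - \<theta> / 4))" .
    qed (use cH ab in auto)
    also have "2 ^ M * L = cL * t powr (- (?A / 4)) * sqrt N * (b * sqrt f)"
      using ab by (simp add: L_def cL_def real_sqrt_mult powr_half_sqrt[symmetric] powr_powr)
    finally show "cmod (\<integral>\<xi>. fourier lborel g \<xi> * cnj (fourier lborel h \<xi>) \<partial>\<mu>)
      \<le> cH * t powr ((s - real DIM('a) * \<theta>) / 4) * (a * b) * (e * f) powr (1 - \<theta> / 4)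
        + cL * t powr (- (?A / 4)) * sqrt N * (b * sqrt f)" .
  qed
qed

section \<open>The bootstrap\<close>

text \<open>The scale \<open>t\<close> balances both terms up to the factor \<open>2 powr (k - l)\<close>. All quantities are
  powers of 2, so that the balance is a linear identity between exponents.\<close>

lemma optimal_scale:
  fixes A B \<theta> p S x y k l cH cL n X \<kappa> :: real
  assumes A: "A > 0" and B: "B > 0" and \<theta>: "0 \<le> \<theta>" "\<theta> \<le> 1"
    and p: "p = 4 * (A + B) / (2 * B + 4 * A - A * \<theta>)"
    and \<kappa>: "\<kappa> \<le> (1 - p / 2) / 4" "\<kappa> \<le> (1 - p / 2) * B / (2 * A)"
    and S: "S > 0" and xy: "0 \<le> x" "x \<le> 1" "0 \<le> y" "y \<le> 1" and kl: "l \<le> k"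
    and c: "cH \<ge> 0" "cL \<ge> 0" and n: "n \<ge> 0"
    and X: "\<And>t. t > 0 \<Longrightarrow> X \<le> cH * t powr (B / 2) * (2 powr (k + 1) * 2 powr (l + 1)) *
        ((x * S * 2 powr (- k * p)) * (y * S * 2 powr (- l * p))) powr (1 - \<theta> / 4)
      + cL * t powr (- (A / 4)) * sqrt (n * (2 powr p * x * S) powr (2 / p)) * (2 powr (l + 1) * sqrt (y * S * 2 powr (- l * p)))"
  shows "X \<le> 4 * (cH + cL * sqrt n) * S powr (2 / p) * sqrt (x * y) * 2 powr (- \<kappa> * (k - l))"
proof -
  define D where "D = 2 * B + 4 * A - A * \<theta>"
  have A\<theta>: "A * \<theta> \<le> A * 1" using A \<theta> by (intro mult_left_mono) auto
  then have D: "D > 0" unfolding D_def using A B by linarith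
  have p0: "p > 0" using A B D p by (simp add: D_def[symmetric])
  define \<delta> where "\<delta> = 1 - p / 2"
  define r where "r = 1 - \<theta> / 4"
  have "p < 2" 
  proof -
    have "4 * (A + B) < 2 * (2 * B + 4 * A - P)" if "P \<le> A" for P using that A B by (simp add: distrib_left)
    from this[of "A * \<theta>"] have "4 * (A + B) < 2 * D" using A\<theta> by (simp only: D_def mult_1_right)
    then show ?thesis using D p by (simp add: D_def[symmetric] divide_less_eq)
  qed
  \<comment> \<open>This identity singles out \<open>p\<close>: it cancels the dependence of the
    high-frequency term on k + l once \<open>t\<close> is inserted.\<close>
  have e1: "p * r - 1 = \<delta> * B / A"
  proof -
    have pD: "p = 4 * (A + B) / D" by (simp add: p D_def)
    have "\<delta> = (D - 2 * (A + B)) / D" using D by (simp add: \<delta>_def pD field_simps)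
    also have "D - 2 * (A + B) = A * (2 - \<theta>)" by (simp add: D_def algebra_simps)
    finally have "\<delta> * B / A = B * (2 - \<theta>) / D" using A by simp
    moreover have "p * r - 1 = (4 * (A + B) * r - D) / D" using D by (simp add: pD diff_divide_distrib)
    moreover have "4 * (A + B) * r - D = B * (2 - \<theta>)" by (simp add: r_def D_def field_simps)
    ultimately show ?thesis by simp
  qed
  \<comment> \<open>The coefficient of log S in the same term, which has to be 2 / p because the
    estimate is quadratic in the norm.\<close>
  have e2: "2 * r - 2 * B / A * (1 / p - 1 / 2) = 2 / p"
  proof -
    have "2 * r = 2 / p * (p * r - 1) + 2 / p" using p0 by (simp add: field_simps)
    also have "p * r - 1 = (1 - p / 2) * (B / A)" using e1 by (simp add: \<delta>_def)
    also have "2 / p * ((1 - p / 2) * (B / A)) = 2 * B / A * (1 / p - 1 / 2)" using p0 A by (simp add: field_simps)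
    finally show ?thesis by simp
  qed
  define \<sigma> where "\<sigma> = log 2 S"
  have S2: "S = 2 powr \<sigma>" using S by (simp add: \<sigma>_def)
  \<comment> \<open>The first two summands balance both terms for k = l. With these alone the low
    term would decay at rate \<delta> / 2 in k - l and the high term not at all; the third summand
    gives up half of that rate, leaving \<delta> / 4 for the low and \<delta> B / (2 A) for the high
    term.\<close>
  define u where "u = \<sigma> * (1 / p - 1 / 2) - (k + l) * \<delta> / 2 + (k - l) * \<delta> / 4"
  define t where "t = 2 powr (u * (- 4 / A))"
  have tA: "t powr (- (A / 4)) = 2 powr u" using A by (simp add: t_def powr_powr)
  have tB: "t powr (B / 2) = 2 powr (- 2 * B / A * u)" by (simp add: t_def powr_powr mult_ac)
  \<comment> \<open>Since the mass fractions \<open>x\<close> and \<open>y\<close> are at most 1,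
    the powers r and 1 / p, both at least 1/2, may be lowered to square roots. This is the form that
    can be summed over the levels.\<close>
  have half: "z powr c \<le> sqrt z" if "0 \<le> z" "z \<le> 1" "1/2 \<le> c" for z c :: real
    using that powr_mono'[of "1/2" c z] by (simp add: powr_half_sqrt)
  have xy1: "x * y \<le> 1" "0 \<le> x * y" using xy mult_mono[of x 1 y 1] by auto
  have r12: "1 / 2 \<le> r" using \<theta> by (simp add: r_def)
  have high: "cH * t powr (B / 2) * (2 powr (k + 1) * 2 powr (l + 1)) *
        ((x * S * 2 powr (- k * p)) * (y * S * 2 powr (- l * p))) powr r
      \<le> 4 * cH * S powr (2 / p) * sqrt (x * y) * 2 powr (- \<kappa> * (k - l))" (is "?H \<le> _")
  proof -
    have "S * 2 powr (- k * p) * (S * 2 powr (- l * p)) = 2 powr (\<sigma> + - k * p + (\<sigma> + - l * p))"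
      by (simp only: S2 powr_add)
    also have "\<sigma> + - k * p + (\<sigma> + - l * p) = 2 * \<sigma> - (k + l) * p" by (simp add: algebra_simps)
    finally have "x * y * (S * 2 powr (- k * p) * (S * 2 powr (- l * p))) = x * y * 2 powr (2 * \<sigma> - (k + l) * p)"
      by simp
    then have E: "(x * S * 2 powr (- k * p)) * (y * S * 2 powr (- l * p)) = x * y * 2 powr (2 * \<sigma> - (k + l) * p)"
      by (simp only: mult_ac)
    have "((x * S * 2 powr (- k * p)) * (y * S * 2 powr (- l * p))) powr r = (x * y) powr r * 2 powr ((2 * \<sigma> - (k + l) * p) * r)"
      unfolding E using xy1 by (simp add: powr_mult powr_powr)
    then have "?H = cH * (x * y) powr r * (2 powr (- 2 * B / A * u) * 2 powr (k + 1) * 2 powr (l + 1) * 2 powr ((2 * \<sigma> - (k + l) * p) * r))"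
      by (simp add: tB)
    also have "2 powr (- 2 * B / A * u) * 2 powr (k + 1) * 2 powr (l + 1) * 2 powr ((2 * \<sigma> - (k + l) * p) * r)
        = 2 powr (- 2 * B / A * u + (k + 1) + (l + 1) + (2 * \<sigma> - (k + l) * p) * r)"
      by (simp only: powr_add)
    also have "- 2 * B / A * u + (k + 1) + (l + 1) + (2 * \<sigma> - (k + l) * p) * r
        = 2 + \<sigma> * (2 * r - 2 * B / A * (1 / p - 1 / 2)) - (k + l) * (p * r - 1 - \<delta> * B / A) - (\<delta> * B / (2 * A)) * (k - l)"
      using A by (simp add: u_def field_simps)
    also have "\<dots> = 2 + \<sigma> * (2 / p) - (\<delta> * B / (2 * A)) * (k - l)" unfolding e1 e2 by simp
    also have "2 powr \<dots> = 4 * S powr (2 / p) * 2 powr (- (\<delta> * B / (2 * A)) * (k - l))"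
      by (simp only: S2 powr_powr diff_conv_add_uminus powr_add) simp
    also have "cH * (x * y) powr r * (4 * S powr (2 / p) * 2 powr (- (\<delta> * B / (2 * A)) * (k - l)))
       \<le> cH * sqrt (x * y) * (4 * S powr (2 / p) * 2 powr (- \<kappa> * (k - l)))"
    proof (intro mult_mono mult_left_mono)
      show "(x * y) powr r \<le> sqrt (x * y)" by (rule half) (use xy1 r12 in auto)
      have "\<kappa> * (k - l) \<le> (\<delta> * B / (2 * A)) * (k - l)"
        using \<kappa>(2) kl by (intro mult_right_mono) (auto simp: \<delta>_def)
      then show "2 powr (- (\<delta> * B / (2 * A)) * (k - l)) \<le> 2 powr (- \<kappa> * (k - l))" by simp
    qed (use c xy1 in auto)
    finally show ?thesis by (simp add: mult_ac)
  qed
  have low: "cL * t powr (- (A / 4)) * sqrt (n * (2 powr p * x * S) powr (2 / p)) * (2 powr (l + 1) * sqrt (y * S * 2 powr (- l * p)))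
      \<le> 4 * cL * sqrt n * S powr (2 / p) * sqrt (x * y) * 2 powr (- \<kappa> * (k - l))" (is "?L \<le> _")
  proof -
    have F: "2 powr p * x * S = x * 2 powr (p + \<sigma>)" by (simp add: S2 powr_add)
    have "sqrt ((2 powr p * x * S) powr (2 / p)) = (2 powr p * x * S) powr (1 / p)"
      by (simp add: powr_half_sqrt[symmetric] powr_powr)
    also have "\<dots> = x powr (1 / p) * 2 powr ((p + \<sigma>) * (1 / p))"
      unfolding F using xy by (simp only: powr_mult powr_powr)
    finally have 1: "sqrt (n * (2 powr p * x * S) powr (2 / p)) = sqrt n * (x powr (1 / p) * 2 powr ((p + \<sigma>) * (1 / p)))"
      by (simp add: real_sqrt_mult)
    have G: "y * S * 2 powr (- l * p) = y * 2 powr (\<sigma> - l * p)"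
      using powr_add[of 2 \<sigma> "- l * p"] by (simp add: S2)
    have "sqrt (2 powr (\<sigma> - l * p)) = 2 powr ((\<sigma> - l * p) * (1 / 2))"
      by (simp only: powr_half_sqrt[symmetric] powr_ge_zero powr_powr)
    then have 2: "sqrt (y * S * 2 powr (- l * p)) = sqrt y * 2 powr ((\<sigma> - l * p) * (1 / 2))"
      unfolding G by (simp only: real_sqrt_mult)
    have "?L = cL * sqrt n * (x powr (1 / p) * sqrt y) * (2 powr u * 2 powr ((p + \<sigma>) * (1 / p)) * 2 powr (l + 1) * 2 powr ((\<sigma> - l * p) * (1 / 2)))"
      unfolding tA 1 2 by simp
    also have "2 powr u * 2 powr ((p + \<sigma>) * (1 / p)) * 2 powr (l + 1) * 2 powr ((\<sigma> - l * p) * (1 / 2))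
        = 2 powr (u + (p + \<sigma>) * (1 / p) + (l + 1) + (\<sigma> - l * p) * (1 / 2))"
      by (simp only: powr_add)
    also have "u + (p + \<sigma>) * (1 / p) + (l + 1) + (\<sigma> - l * p) * (1 / 2) = 2 + \<sigma> * (2 / p) - (\<delta> / 4) * (k - l)"
      using p0 by (simp add: u_def \<delta>_def field_simps)
    also have "2 powr \<dots> = 4 * S powr (2 / p) * 2 powr (- (\<delta> / 4) * (k - l))"
      by (simp only: S2 powr_powr diff_conv_add_uminus powr_add) simp
    also have "cL * sqrt n * (x powr (1 / p) * sqrt y) * (4 * S powr (2 / p) * 2 powr (- (\<delta> / 4) * (k - l)))
       \<le> cL * sqrt n * (sqrt x * sqrt y) * (4 * S powr (2 / p) * 2 powr (- \<kappa> * (k - l)))"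
    proof (intro mult_mono mult_left_mono mult_right_mono)
      show "x powr (1 / p) \<le> sqrt x" using xy \<open>p < 2\<close> p0 by (intro half) (auto simp: field_simps)
      have "\<kappa> * (k - l) \<le> (\<delta> / 4) * (k - l)"
        using \<kappa>(1) kl by (intro mult_right_mono) (auto simp: \<delta>_def)
      then show "2 powr (- (\<delta> / 4) * (k - l)) \<le> 2 powr (- \<kappa> * (k - l))" by simp
    qed (use c n xy in auto)
    finally show ?thesis by (simp add: mult_ac real_sqrt_mult)
  qed
  have "t > 0" by (simp add: t_def)
  from X[OF this] show ?thesis using high low by (simp add: r_def algebra_simps)
qed

section \<open>Geometric sums over levels, and truncated functions\<close>

text \<open>On each side of \<open>k\<close> the distance to \<open>k\<close> is injective, so each
  half is part of one geometric series.\<close>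

lemma sum_geometric_int:
  fixes \<rho> :: real and K :: "int set"
  assumes \<rho>: "0 < \<rho>" "\<rho> < 1" and K: "finite K"
  shows "(\<Sum>l\<in>K. \<rho> ^ nat \<bar>k - l\<bar>) \<le> 2 / (1 - \<rho>)"
proof -
  have *: "(\<Sum>l\<in>J. \<rho> ^ nat \<bar>k - l\<bar>) \<le> 1 / (1 - \<rho>)" if J: "finite J" "inj_on (\<lambda>l. nat \<bar>k - l\<bar>) J" for J
  proof -
    have "(\<Sum>l\<in>J. \<rho> ^ nat \<bar>k - l\<bar>) = (\<Sum>j\<in>(\<lambda>l. nat \<bar>k - l\<bar>) ` J. \<rho> ^ j)"
      using J by (simp add: sum.reindex)
    also have "\<dots> \<le> (\<Sum>j. \<rho> ^ j)" using J \<rho> by (intro sum_le_suminf summable_geometric) auto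
    also have "\<dots> = 1 / (1 - \<rho>)" using \<rho> by (intro suminf_geometric) auto
    finally show ?thesis .
  qed
  have "(\<Sum>l\<in>K. \<rho> ^ nat \<bar>k - l\<bar>) = (\<Sum>l\<in>(K \<inter> {k..}) \<union> (K \<inter> {..<k}). \<rho> ^ nat \<bar>k - l\<bar>)"
    by (intro sum.cong) auto
  also have "\<dots> = (\<Sum>l\<in>K \<inter> {k..}. \<rho> ^ nat \<bar>k - l\<bar>) + (\<Sum>l\<in>K \<inter> {..<k}. \<rho> ^ nat \<bar>k - l\<bar>)"
    using K by (intro sum.union_disjoint) auto
  also have "\<dots> \<le> 1 / (1 - \<rho>) + 1 / (1 - \<rho>)"
    using K by (intro add_mono *) (auto simp: inj_on_def)
  finally show ?thesis by simp
qed

text \<open>A class that is stable under modulation and restriction to Borel sets, and on which the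
  restriction inequality holds trivially with a constant depending on \<open>R\<close>.\<close>

definition truncated :: "real \<Rightarrow> ('a::euclidean_space \<Rightarrow> complex) \<Rightarrow> bool" where
  "truncated R f \<longleftrightarrow> f \<in> borel_measurable borel \<and>
     (\<forall>x. f x \<noteq> 0 \<longrightarrow> norm x \<le> R \<and> 1 / R \<le> cmod (f x) \<and> cmod (f x) \<le> R)"

text \<open>The p-th power of the norm, since masses add up over level sets; hence the power 2 / p
  in the estimates.\<close>

definition Lp_mass :: "real \<Rightarrow> ('a::euclidean_space \<Rightarrow> complex) \<Rightarrow> real" where
  "Lp_mass p f = (\<integral>x. cmod (f x) powr p \<partial>lborel)"

lemma Lp_mass_nonneg [simp]: "Lp_mass p f \<ge> 0"
  by (simp add: Lp_mass_def)

lemma emeasure_bounded_real: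
  fixes E :: "'a::euclidean_space set"
  assumes "E \<in> sets borel" "E \<subseteq> cball 0 R"
  shows "emeasure lborel E = ennreal (measure lborel E)"
proof (rule emeasure_eq_ennreal_measure)
  have "emeasure lborel E \<le> emeasure lborel (cball (0::'a) R)" by (rule emeasure_mono[OF assms(2)]) simp
  also have "\<dots> < \<infinity>" by (rule emeasure_bounded_finite[OF bounded_cball])
  finally show "emeasure lborel E \<noteq> top" by simp
qed

lemma truncated_measurable: "truncated R f \<Longrightarrow> f \<in> borel_measurable borel"
  by (simp add: truncated_def)

lemma truncated_le:
  assumes "truncated R f" "R > 0"
  shows "cmod (f x) \<le> R * indicator (cball 0 R) x"
  using assms by (cases "f x = 0") (auto simp: truncated_def split: split_indicator)

lemma truncated_integrable:
  assumes "truncated R f" "R > 0"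
  shows "integrable lborel f"
  by (rule integrable_indicator_bounded[OF truncated_measurable[OF assms(1)] _ emeasure_bounded_real[of "cball 0 R" R] truncated_le[OF assms]]) auto

lemma truncated_integrable_powr:
  assumes f: "truncated R f" "R > 0" and p: "p > 0"
  shows "integrable lborel (\<lambda>x. cmod (f x) powr p)"
proof (rule Bochner_Integration.integrable_bound)
  have [measurable]: "f \<in> borel_measurable borel" by (rule truncated_measurable[OF f(1)])
  show "integrable lborel (\<lambda>x::'a. R powr p * indicator (cball 0 R) x :: real)"
    using emeasure_bounded_finite[OF bounded_cball, of "0::'a" R]
    by (intro integrable_mult_right integrable_real_indicator) auto
  show "(\<lambda>x. cmod (f x) powr p) \<in> borel_measurable lborel" by measurable
  show "AE x in lborel. norm (cmod (f x) powr p) \<le> norm (R powr p * indicator (cball 0 R) x :: real)"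
  proof (intro AE_I2)
    fix x
    show "norm (cmod (f x) powr p) \<le> norm (R powr p * indicator (cball 0 R) x :: real)"
      using truncated_le[OF f, of x] p by (auto split: split_indicator intro!: powr_mono2)
  qed
qed

lemma truncated_modulate: "truncated R f \<Longrightarrow> truncated R (\<lambda>x. wave w x * f x)"
  by (auto simp: truncated_def norm_mult)

lemma truncated_restrict:
  "truncated R f \<Longrightarrow> E \<in> sets borel \<Longrightarrow> truncated R (\<lambda>x. f x * indicator E x)"
  by (auto simp: truncated_def split: split_indicator)

lemma energy2_eq_integral:
  assumes "finite_measure \<mu>" and [measurable_cong]: "sets \<mu> = sets borel" and f: "f \<in> borel_measurable borel"
  shows "energy2 \<mu> f = ennreal (\<integral>\<xi>. (cmod (fourier lborel f \<xi>))\<^sup>2 \<partial>\<mu>)"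
proof -
  interpret finite_measure \<mu> by fact
  note [measurable] = f
  have "integrable \<mu> (\<lambda>\<xi>. (cmod (fourier lborel f \<xi>))\<^sup>2)"
    by (rule integrable_const_bound[where B="(\<integral>x. cmod (f x) \<partial>lborel)\<^sup>2"])
       (auto intro!: power_mono fourier_bound)
  then show ?thesis unfolding energy2_def by (rule nn_integral_eq_integral) auto
qed

text \<open>The lower bound 1 / R on nonzero values gives |f| \<le> R^(p-1) |f|^p, so the supremum
  of the transform is controlled by the mass S. The upper bounds make S bounded, which turns S^2
  into S^(2/p). The constant is poor, but only its finiteness will matter.\<close>

lemma truncated_a_priori:
  fixes \<mu> :: "'a::euclidean_space measure"
  assumes fin: "finite_measure \<mu>" and sets_mu [measurable_cong]: "sets \<mu> = sets borel"
    and R: "R > 0" and p: "p > 1"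
  shows "\<exists>N\<ge>0. \<forall>f. truncated R f \<longrightarrow> energy2 \<mu> f \<le> ennreal (N * Lp_mass p f powr (2 / p))"
proof -
  interpret finite_measure \<mu> by (rule fin)
  define V where "V = R powr p * measure lborel (cball (0::'a) R)"
  have V: "V \<ge> 0" by (simp add: V_def)
  define N where "N = measure \<mu> (space \<mu>) * (R powr (p - 1))\<^sup>2 * V powr (2 - 2 / p)"
  show ?thesis
  proof (intro exI[of _ N] conjI allI impI)
    show "N \<ge> 0" by (simp add: N_def)
    fix f :: "'a \<Rightarrow> complex" assume f: "truncated R f"
    note [measurable] = truncated_measurable[OF f]
    let ?S = "Lp_mass p f"
    have 1: "(\<integral>x. cmod (f x) \<partial>lborel) \<le> R powr (p - 1) * ?S"
    proof -
      have "(\<integral>x. cmod (f x) \<partial>lborel) \<le> (\<integral>x. R powr (p - 1) * cmod (f x) powr p \<partial>lborel)"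
      proof (rule integral_mono)
        show "integrable lborel (\<lambda>x. cmod (f x))" using truncated_integrable[OF f R] by simp
        show "integrable lborel (\<lambda>x. R powr (p - 1) * cmod (f x) powr p)"
          using p by (intro integrable_mult_right truncated_integrable_powr[OF f R]) simp
        fix x
        show "cmod (f x) \<le> R powr (p - 1) * cmod (f x) powr p"
        proof (cases "f x = 0")
          case False
          then have "1 / R \<le> cmod (f x)" using f by (simp add: truncated_def)
          then have "1 \<le> R * cmod (f x)" using R by (simp add: field_simps)
          then have "1 \<le> (R * cmod (f x)) powr (p - 1)" using p by (intro ge_one_powr_ge_zero) auto
          then have "cmod (f x) * 1 \<le> cmod (f x) * (R * cmod (f x)) powr (p - 1)" by (intro mult_left_mono) auto
          also have "\<dots> = R powr (p - 1) * (cmod (f x) powr 1 * cmod (f x) powr (p - 1))"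
            using R by (simp add: powr_mult)
          also have "cmod (f x) powr 1 * cmod (f x) powr (p - 1) = cmod (f x) powr p"
            by (simp only: powr_add[symmetric]) simp
          finally show ?thesis by simp
        qed simp
      qed
      then show ?thesis by (simp add: Lp_mass_def)
    qed
    have 2: "?S \<le> V"
    proof -
      have "?S \<le> (\<integral>x. R powr p * indicator (cball (0::'a) R) x \<partial>lborel)"
        unfolding Lp_mass_def
      proof (rule integral_mono)
        show "integrable lborel (\<lambda>x. cmod (f x) powr p)" using p by (intro truncated_integrable_powr[OF f R]) simp
        show "integrable lborel (\<lambda>x::'a. R powr p * indicator (cball 0 R) x :: real)"
          using emeasure_bounded_finite[OF bounded_cball, of "0::'a" R]
          by (intro integrable_mult_right integrable_real_indicator) auto
        fix x
        show "cmod (f x) powr p \<le> R powr p * indicator (cball 0 R) x"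
          using truncated_le[OF f R, of x] p by (auto split: split_indicator intro!: powr_mono2)
      qed
      then show ?thesis by (simp add: V_def)
    qed
    have "?S\<^sup>2 = ?S powr (2 / p + (2 - 2 / p))" by (cases "?S = 0") (auto simp: powr_numeral)
    also have "\<dots> = ?S powr (2 / p) * ?S powr (2 - 2 / p)" by (rule powr_add)
    also have "\<dots> \<le> ?S powr (2 / p) * V powr (2 - 2 / p)"
      using 2 p by (intro mult_left_mono powr_mono2) (auto simp: field_simps)
    finally have 3: "?S\<^sup>2 \<le> ?S powr (2 / p) * V powr (2 - 2 / p)" .
    have "energy2 \<mu> f \<le> (\<integral>\<^sup>+\<xi>. ennreal ((R powr (p - 1) * ?S)\<^sup>2) \<partial>\<mu>)"
      unfolding energy2_def
      by (intro nn_integral_mono ennreal_leI power_mono order_trans[OF fourier_bound 1]) auto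
    also have "\<dots> = ennreal (measure \<mu> (space \<mu>) * ((R powr (p - 1))\<^sup>2 * ?S\<^sup>2))"
      by (simp add: emeasure_eq_measure power_mult_distrib mult.commute flip: ennreal_mult)
    also have "\<dots> \<le> ennreal (measure \<mu> (space \<mu>) * ((R powr (p - 1))\<^sup>2 * (?S powr (2 / p) * V powr (2 - 2 / p))))"
      by (intro ennreal_leI mult_left_mono 3) auto
    also have "\<dots> = ennreal (N * ?S powr (2 / p))" by (simp add: N_def mult_ac)
    finally show "energy2 \<mu> f \<le> ennreal (N * ?S powr (2 / p))" .
  qed
qed

text \<open>In \<open>pair\<close> the first term bounds the high frequencies of \<open>\<mu>\<close>. The second bounds the low ones
  by the restriction constant \<open>N\<close> itself, to the power 1/2 only: this closes the bootstrap.\<close>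

locale two_scale_estimate =
  fixes \<mu> :: "'a::euclidean_space measure" and A B \<theta> p cH cL :: real
  assumes fin: "finite_measure \<mu>" and sets_mu [measurable_cong]: "sets \<mu> = sets borel"
    and A: "A > 0" and B: "B > 0" and \<theta>: "0 \<le> \<theta>" "\<theta> \<le> 1"
    and p: "p = 4 * (A + B) / (2 * B + 4 * A - A * \<theta>)"
    and c: "cH > 0" "cL > 0"
    and pair: "\<And>t g h a b E F e f N. t > 0 \<Longrightarrow> g \<in> borel_measurable borel \<Longrightarrow> h \<in> borel_measurable borel \<Longrightarrow>
      E \<in> sets borel \<Longrightarrow> F \<in> sets borel \<Longrightarrow>
      emeasure lborel E = ennreal e \<Longrightarrow> e \<ge> 0 \<Longrightarrow> emeasure lborel F = ennreal f \<Longrightarrow> f \<ge> 0 \<Longrightarrow> a \<ge> 0 \<Longrightarrow> b \<ge> 0 \<Longrightarrow>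
      (\<And>x. cmod (g x) \<le> a * indicator E x) \<Longrightarrow> (\<And>x. cmod (h x) \<le> b * indicator F x) \<Longrightarrow> N \<ge> 0 \<Longrightarrow>
      (\<And>w. energy2 \<mu> (\<lambda>x. wave w x * g x) \<le> ennreal N) \<Longrightarrow>
      cmod (\<integral>\<xi>. fourier lborel g \<xi> * cnj (fourier lborel h \<xi>) \<partial>\<mu>)
        \<le> cH * t powr (B / 2) * (a * b) * (e * f) powr (1 - \<theta> / 4)
          + cL * t powr (- (A / 4)) * sqrt N * (b * sqrt f)"
begin

lemma exponent_bounds: "1 < p" "p < 2"
proof -
  \<comment> \<open>A variable in place of the product A \<theta> makes these inequalities
    linear.\<close>
  have D: "2 * B + 4 * A - P > 0" "4 * (A + B) < 2 * (2 * B + 4 * A - P)" "2 * B + 4 * A - P < 4 * (A + B)"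
    if "0 \<le> P" "P \<le> A" for P using that A B by auto
  have "0 \<le> A * \<theta>" "A * \<theta> \<le> A" using A \<theta> mult_left_mono[of \<theta> 1 A] by auto
  from D[OF this] show "1 < p" "p < 2" unfolding p by (simp_all add: divide_less_eq less_divide_eq)
qed

text \<open>The worse of the two rates that \<open>optimal_scale\<close> leaves to the low and to
  the high frequencies.\<close>

definition decay :: real where
  "decay = min ((1 - p / 2) / 4) ((1 - p / 2) * B / (2 * A))"

lemma decay_pos: "decay > 0"
  using exponent_bounds A B by (simp add: decay_def)

text \<open>Bounds the two-sided geometric series with ratio 2^(-\<open>decay\<close>), as in
  \<open>sum_geometric_int\<close>.\<close>

definition geom :: real where "geom = 2 / (1 - 2 powr (- decay))"

lemma geom_pos: "geom > 0"
proof -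
  have "2 powr (- decay) < 2 powr (0::real)" using decay_pos by (intro powr_less_mono) auto
  then show ?thesis by (simp add: geom_def)
qed

text \<open>A discrete Schur test: the arithmetic-geometric mean inequality separates the levels,
  and each row of the geometric matrix sums to at most \<open>geom\<close>.\<close>

lemma level_sum:
  fixes K :: "int set" and x :: "int \<Rightarrow> real"
  assumes K: "finite K" and x: "\<And>k. x k \<ge> 0" "(\<Sum>k\<in>K. x k) \<le> 1"
  shows "(\<Sum>k\<in>K. \<Sum>l\<in>K. sqrt (x k * x l) * 2 powr (- decay * \<bar>k - l\<bar>)) \<le> geom"
proof -
  define \<rho> where "\<rho> = 2 powr (- decay)"
  have "2 powr (- decay) < 2 powr (0::real)" using decay_pos by (intro powr_less_mono) auto
  then have \<rho>: "0 < \<rho>" "\<rho> < 1" by (auto simp: \<rho>_def)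
  have r: "2 powr (- decay * \<bar>k - l\<bar>) = \<rho> ^ nat \<bar>k - l\<bar>" for k l :: int
  proof -
    have "\<rho> ^ nat \<bar>k - l\<bar> = \<rho> powr real (nat \<bar>k - l\<bar>)" by (rule powr_realpow[symmetric, OF \<rho>(1)])
    also have "real (nat \<bar>k - l\<bar>) = \<bar>k - l\<bar>" by simp
    finally show ?thesis by (simp add: \<rho>_def powr_powr)
  qed
  have am: "sqrt (x k * x l) \<le> x k / 2 + x l / 2" for k l
    using arith_geo_mean_sqrt[OF x(1)[of k] x(1)[of l]] by simp
  have "(\<Sum>k\<in>K. \<Sum>l\<in>K. sqrt (x k * x l) * 2 powr (- decay * \<bar>k - l\<bar>))
     \<le> (\<Sum>k\<in>K. \<Sum>l\<in>K. (x k / 2 + x l / 2) * \<rho> ^ nat \<bar>k - l\<bar>)"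
    unfolding r using \<rho> by (intro sum_mono mult_right_mono am) auto
  also have "\<dots> = (\<Sum>k\<in>K. \<Sum>l\<in>K. x k / 2 * \<rho> ^ nat \<bar>k - l\<bar>) + (\<Sum>k\<in>K. \<Sum>l\<in>K. x l / 2 * \<rho> ^ nat \<bar>k - l\<bar>)"
    by (simp add: distrib_right sum.distrib)
  also have "(\<Sum>k\<in>K. \<Sum>l\<in>K. x l / 2 * \<rho> ^ nat \<bar>k - l\<bar>) = (\<Sum>l\<in>K. \<Sum>k\<in>K. x l / 2 * \<rho> ^ nat \<bar>l - k\<bar>)"
    by (subst sum.swap) (simp add: abs_minus_commute)
  also have "(\<Sum>k\<in>K. \<Sum>l\<in>K. x k / 2 * \<rho> ^ nat \<bar>k - l\<bar>) + (\<Sum>l\<in>K. \<Sum>k\<in>K. x l / 2 * \<rho> ^ nat \<bar>l - k\<bar>)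
     = (\<Sum>k\<in>K. x k * (\<Sum>l\<in>K. \<rho> ^ nat \<bar>k - l\<bar>))"
    by (simp add: sum_distrib_left sum.distrib[symmetric] field_simps)
  also have "\<dots> \<le> (\<Sum>k\<in>K. x k * geom)"
    unfolding geom_def \<rho>_def[symmetric] by (intro sum_mono mult_left_mono sum_geometric_int \<rho> K x)
  also have "\<dots> = (\<Sum>k\<in>K. x k) * geom" by (simp add: sum_distrib_right)
  also have "\<dots> \<le> 1 * geom" using geom_pos by (intro mult_right_mono x) auto
  finally show ?thesis by simp
qed

text \<open>What remains of 4 cH geom + 4 cL geom sqrt N after N / 2 has been split off by the
  arithmetic-geometric mean inequality.\<close>

definition const :: real where "const = 4 * cH * geom + 8 * (cL * geom)\<^sup>2"

lemma const_pos: "const > 0"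
  unfolding const_def using c geom_pos by (intro add_pos_nonneg) auto

text \<open>The hypothesis covers the whole class for this \<open>R\<close> because it is applied to
  modulated level pieces of \<open>f\<close>, not to \<open>f\<close>. The new constant does not
  involve \<open>R\<close>.\<close>

lemma bootstrap:
  assumes R: "R > 0" and N: "N \<ge> 0"
    and hyp: "\<And>f. truncated R f \<Longrightarrow> energy2 \<mu> f \<le> ennreal (N * Lp_mass p f powr (2 / p))"
    and f: "truncated R f"
  shows "energy2 \<mu> f \<le> ennreal ((N / 2 + const) * Lp_mass p f powr (2 / p))"
proof -
  interpret finite_measure \<mu> by (rule fin)
  have p1: "p > 0" using exponent_bounds by simp
  note fm [measurable] = truncated_measurable[OF f]
  define S where "S = Lp_mass p f"
  show ?thesis
  proof (cases "S = 0")
    case True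
    have "AE x in lborel. cmod (f x) powr p = 0"
      using True integral_nonneg_eq_0_iff_AE[OF truncated_integrable_powr[OF f R p1]] by (simp add: S_def Lp_mass_def)
    then have "AE x in lborel. f x = 0" by eventually_elim simp
    then have "fourier lborel f \<xi> = 0" for \<xi>
      unfolding fourier_wave by (intro integral_eq_zero_AE) (auto elim!: eventually_mono)
    then show ?thesis by (simp add: energy2_def)
  next
    case False
    then have S: "S > 0" by (simp add: S_def less_le)
    define lev where "lev = (\<lambda>x. \<lfloor>log 2 (cmod (f x))\<rfloor>)"
    \<comment> \<open>The bounds 1 / R and R on the nonzero values leave finitely many
      levels.\<close>
    define K where "K = {- \<lceil>\<bar>log 2 R\<bar>\<rceil>..\<lceil>\<bar>log 2 R\<bar>\<rceil>}"
    define E where "E = (\<lambda>k. {x. f x \<noteq> 0 \<and> lev x = k})"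
    define fk where "fk = (\<lambda>k x. f x * indicator (E k) x)"
    define e where "e = (\<lambda>k. measure lborel (E k))"
    \<comment> \<open>The fraction of the mass of \<open>f\<close> on level \<open>k\<close>, with
      |f| replaced by its lower bound 2^k there, so that the fractions sum to at most 1. The
      division is the reason for treating S = 0 apart.\<close>
    define x where "x = (\<lambda>k::int. 2 powr (k * p) * e k / S)"
    have K: "finite K" by (simp add: K_def)
    have Em [measurable]: "E k \<in> sets borel" for k unfolding E_def lev_def by measurable
    have EB: "E k \<subseteq> cball 0 R" for k using f by (auto simp: E_def truncated_def)
    have Ee: "emeasure lborel (E k) = ennreal (e k)" for k
      unfolding e_def by (rule emeasure_bounded_real[OF Em EB])
    have e0: "e k \<ge> 0" for k by (simp add: e_def)
    have lev: "2 powr (real_of_int (lev z)) \<le> cmod (f z)" "cmod (f z) \<le> 2 powr (real_of_int (lev z) + 1)" "lev z \<in> K" if z: "f z \<noteq> 0" for z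
    proof -
      have l: "of_int (lev z) \<le> log 2 (cmod (f z))" "log 2 (cmod (f z)) < of_int (lev z) + 1"
        unfolding lev_def by linarith+
      show "2 powr (real_of_int (lev z)) \<le> cmod (f z)" using l(1) z by (simp add: le_log_iff)
      show "cmod (f z) \<le> 2 powr (real_of_int (lev z) + 1)" using l(2) z by (simp add: log_less_iff less_imp_le)
      have "1 / R \<le> cmod (f z)" "cmod (f z) \<le> R" using f z by (auto simp: truncated_def)
      then have "log 2 (1 / R) \<le> log 2 (cmod (f z))" "log 2 (cmod (f z)) \<le> log 2 R"
        using R z by (simp_all add: log_le_cancel_iff)
      then have "- log 2 R \<le> log 2 (cmod (f z))" "log 2 (cmod (f z)) \<le> log 2 R" using R by (simp_all add: log_divide)
      then show "lev z \<in> K" unfolding K_def lev_def by (simp add: le_floor_iff floor_le_iff) linarith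
    qed
    have fk_le: "cmod (fk k z) \<le> 2 powr (real_of_int k + 1) * indicator (E k) z" for k z
      using lev(2)[of z] by (auto simp: fk_def E_def split: split_indicator)
    have fk_t: "truncated R (fk k)" for k unfolding fk_def by (rule truncated_restrict[OF f Em])
    have fk_m [measurable]: "fk k \<in> borel_measurable borel" for k by (rule truncated_measurable[OF fk_t])
    have fk_i: "integrable lborel (fk k)" for k by (rule truncated_integrable[OF fk_t R])
    have f_sum: "f z = (\<Sum>k\<in>K. fk k z)" for z
    proof (cases "f z = 0")
      case False
      have "(\<Sum>k\<in>K. fk k z) = (\<Sum>k\<in>K. if k = lev z then f z else 0)"
        using False by (intro sum.cong) (auto simp: fk_def E_def split: split_indicator)
      then show ?thesis using lev(3)[OF False] K by simp
    qed (simp add: fk_def)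
    have x0: "x k \<ge> 0" for k using S e0 by (simp add: x_def)
    have x_sum: "(\<Sum>k\<in>K. x k) \<le> 1"
    proof -
      have iE: "integrable lborel (\<lambda>z. 2 powr (real_of_int k * p) * indicator (E k) z)" for k
        using Ee by (intro integrable_mult_right integrable_real_indicator) (auto simp: less_top[symmetric])
      have "(\<Sum>k\<in>K. 2 powr (real_of_int k * p) * e k) = (\<integral>z. (\<Sum>k\<in>K. 2 powr (real_of_int k * p) * indicator (E k) z) \<partial>lborel)"
        using iE by (subst Bochner_Integration.integral_sum) (auto simp: e_def)
      also have "\<dots> \<le> (\<integral>z. cmod (f z) powr p \<partial>lborel)"
      proof (rule integral_mono)
        show "integrable lborel (\<lambda>z. \<Sum>k\<in>K. 2 powr (real_of_int k * p) * indicator (E k) z)" by (intro Bochner_Integration.integrable_sum iE)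
        show "integrable lborel (\<lambda>x. cmod (f x) powr p)" by (rule truncated_integrable_powr[OF f R p1])
        fix z
        show "(\<Sum>k\<in>K. 2 powr (real_of_int k * p) * indicator (E k) z) \<le> cmod (f z) powr p"
        proof (cases "f z = 0")
          case False
          have "(\<Sum>k\<in>K. 2 powr (real_of_int k * p) * indicator (E k) z) = (\<Sum>k\<in>K. if k = lev z then 2 powr (real_of_int (lev z) * p) else 0)"
            using False by (intro sum.cong) (auto simp: E_def split: split_indicator)
          also have "\<dots> = (2 powr (real_of_int (lev z))) powr p" using lev(3)[OF False] K by (simp add: powr_powr)
          also have "\<dots> \<le> cmod (f z) powr p" using lev(1)[OF False] p1 by (intro powr_mono2) auto
          finally show ?thesis .
        qed (simp add: E_def)
      qed
      finally have "(\<Sum>k\<in>K. 2 powr (real_of_int k * p) * e k) \<le> S" by (simp add: S_def Lp_mass_def)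
      then show ?thesis using S by (simp add: x_def sum_divide_distrib[symmetric])
    qed
    have x1: "x k \<le> 1" if "k \<in> K" for k
      using member_le_sum[OF that, of x] x0 K x_sum by auto
    have ex: "e k = x k * S * 2 powr (- real_of_int k * p)" for k
      using S by (simp add: x_def mult.assoc powr_add[symmetric])
    \<comment> \<open>On level \<open>k\<close> the modulus is at most 2^(k+1), twice the lower
      bound that enters \<open>x k\<close>; hence the factor \<open>2 powr p\<close>.\<close>
    have En: "energy2 \<mu> (\<lambda>z. wave w z * fk k z) \<le> ennreal (N * (2 powr p * x k * S) powr (2 / p))" for w k
    proof -
      have "Lp_mass p (\<lambda>z. wave w z * fk k z) \<le> (\<integral>z. 2 powr ((real_of_int k + 1) * p) * indicator (E k) z \<partial>lborel)"
        unfolding Lp_mass_def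
      proof (rule integral_mono)
        show "integrable lborel (\<lambda>z. cmod (wave w z * fk k z) powr p)"
          by (rule truncated_integrable_powr[OF truncated_modulate[OF fk_t] R p1])
        show "integrable lborel (\<lambda>z. 2 powr ((real_of_int k + 1) * p) * indicator (E k) z)"
          using Ee by (intro integrable_mult_right integrable_real_indicator) (auto simp: less_top[symmetric])
        fix z
        show "cmod (wave w z * fk k z) powr p \<le> 2 powr ((real_of_int k + 1) * p) * indicator (E k) z"
          using fk_le[of k z] p1 by (auto simp: norm_mult powr_powr[symmetric] split: split_indicator intro!: powr_mono2)
      qed
      also have "\<dots> = 2 powr ((real_of_int k + 1) * p) * e k" by (simp add: e_def)
      also have "\<dots> = 2 powr p * x k * S"
        using S by (simp add: x_def distrib_right powr_add)
      finally have m: "Lp_mass p (\<lambda>z. wave w z * fk k z) \<le> 2 powr p * x k * S" .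
      have "energy2 \<mu> (\<lambda>z. wave w z * fk k z) \<le> ennreal (N * Lp_mass p (\<lambda>z. wave w z * fk k z) powr (2 / p))"
        by (rule hyp[OF truncated_modulate[OF fk_t]])
      also have "\<dots> \<le> ennreal (N * (2 powr p * x k * S) powr (2 / p))"
        using m N p1 by (intro ennreal_leI mult_left_mono powr_mono2) auto
      finally show ?thesis .
    qed
    let ?I = "\<lambda>k l. \<integral>\<xi>. fourier lborel (fk k) \<xi> * cnj (fourier lborel (fk l) \<xi>) \<partial>\<mu>"
    let ?Y = "4 * (cH + cL * sqrt N) * S powr (2 / p)"
    have pr: "cmod (?I k l) \<le> ?Y * sqrt (x k * x l) * 2 powr (- decay * (real_of_int k - real_of_int l))"
      if kl: "k \<in> K" "l \<in> K" "l \<le> k" for k l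
    proof (rule optimal_scale[OF A B \<theta> p _ _ S x0 x1[OF kl(1)] x0 x1[OF kl(2)]])
      show "decay \<le> (1 - p / 2) / 4" "decay \<le> (1 - p / 2) * B / (2 * A)" by (simp_all only: decay_def min.cobounded1 min.cobounded2)
      show "real_of_int l \<le> real_of_int k" "cH \<ge> 0" "cL \<ge> 0" "N \<ge> 0" using kl c N by auto
      fix t :: real assume "t > 0"
      then show "cmod (?I k l) \<le> cH * t powr (B / 2) * (2 powr (real_of_int k + 1) * 2 powr (real_of_int l + 1)) *
          ((x k * S * 2 powr (- real_of_int k * p)) * (x l * S * 2 powr (- real_of_int l * p))) powr (1 - \<theta> / 4)
        + cL * t powr (- (A / 4)) * sqrt (N * (2 powr p * x k * S) powr (2 / p)) * (2 powr (real_of_int l + 1) * sqrt (x l * S * 2 powr (- real_of_int l * p)))"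
        unfolding ex[symmetric] using N
        by (intro pair[where E="E k" and F="E l"] fk_m Em Ee e0 fk_le En) auto
    qed
    \<comment> \<open>Hermitian symmetry reduces l > k to the case in which the Plancherel factor
      has the lower level.\<close>
    have sym: "cmod (?I k l) = cmod (?I l k)" for k l
    proof -
      have "?I k l = (\<integral>\<xi>. cnj (fourier lborel (fk l) \<xi> * cnj (fourier lborel (fk k) \<xi>)) \<partial>\<mu>)"
        by (simp add: mult.commute)
      then show ?thesis by (simp only: Bochner_Integration.integral_cnj complex_mod_cnj)
    qed
    have pr': "cmod (?I k l) \<le> ?Y * (sqrt (x k * x l) * 2 powr (- decay * \<bar>k - l\<bar>))" if kl: "k \<in> K" "l \<in> K" for k l
    proof (cases "l \<le> k")
      case True
      then show ?thesis using pr[OF kl True] by (simp add: mult.assoc)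
    next
      case False
      then show ?thesis using pr[OF kl(2,1)] sym[of k l] by (simp add: mult.assoc mult.commute[of "x k"])
    qed
    have F_sum: "fourier lborel f \<xi> = (\<Sum>k\<in>K. fourier lborel (fk k) \<xi>)" for \<xi>
    proof -
      have "fourier lborel f \<xi> = (\<integral>z. (\<Sum>k\<in>K. wave \<xi> z * fk k z) \<partial>lborel)"
        unfolding fourier_wave by (subst f_sum) (simp add: sum_distrib_left)
      also have "\<dots> = (\<Sum>k\<in>K. \<integral>z. wave \<xi> z * fk k z \<partial>lborel)"
        by (intro Bochner_Integration.integral_sum integrable_wave fk_i) auto
      finally show ?thesis by (simp add: fourier_wave)
    qed
    have iI: "integrable \<mu> (\<lambda>\<xi>. fourier lborel (fk k) \<xi> * cnj (fourier lborel (fk l) \<xi>))" for k l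
      by (rule integrable_const_bound[where B="(\<integral>z. cmod (fk k z) \<partial>lborel) * (\<integral>z. cmod (fk l z) \<partial>lborel)"])
         (auto simp: norm_mult intro!: mult_mono fourier_bound)
    have "(\<integral>\<xi>. (cmod (fourier lborel f \<xi>))\<^sup>2 \<partial>\<mu>) \<le> cmod (of_real (\<integral>\<xi>. (cmod (fourier lborel f \<xi>))\<^sup>2 \<partial>\<mu>))"
      by (metis abs_ge_self norm_of_real)
    also have "complex_of_real (\<integral>\<xi>. (cmod (fourier lborel f \<xi>))\<^sup>2 \<partial>\<mu>) = (\<integral>\<xi>. fourier lborel f \<xi> * cnj (fourier lborel f \<xi>) \<partial>\<mu>)"
      by (simp flip: integral_complex_of_real complex_norm_square)
    also have "\<dots> = (\<integral>\<xi>. (\<Sum>k\<in>K. \<Sum>l\<in>K. fourier lborel (fk k) \<xi> * cnj (fourier lborel (fk l) \<xi>)) \<partial>\<mu>)"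
      unfolding F_sum by (simp add: cnj_sum sum_product)
    also have "\<dots> = (\<Sum>k\<in>K. \<Sum>l\<in>K. ?I k l)"
      by (simp add: Bochner_Integration.integral_sum iI)
    also have "cmod \<dots> \<le> (\<Sum>k\<in>K. \<Sum>l\<in>K. ?Y * (sqrt (x k * x l) * 2 powr (- decay * \<bar>k - l\<bar>)))"
      by (intro sum_norm_le pr')
    also have "\<dots> = ?Y * (\<Sum>k\<in>K. \<Sum>l\<in>K. sqrt (x k * x l) * 2 powr (- decay * \<bar>k - l\<bar>))"
      by (simp add: sum_distrib_left)
    also have "\<dots> \<le> ?Y * geom"
      using c N by (intro mult_left_mono level_sum K x0 x_sum) auto
    also have "\<dots> = (4 * cH * geom + 4 * (cL * geom) * sqrt N) * S powr (2 / p)" by (simp add: algebra_simps)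
    also have "\<dots> \<le> (N / 2 + const) * S powr (2 / p)"
    proof (rule mult_right_mono)
      \<comment> \<open>Half of this square is N / 2 - 4 cL geom sqrt N + 8 (cL geom)^2.\<close>
      have "0 \<le> (sqrt N - 4 * (cL * geom))\<^sup>2" by simp
      also have "\<dots> = N - 8 * (cL * geom) * sqrt N + 16 * (cL * geom)\<^sup>2"
        using N by (simp add: power2_diff power_mult_distrib)
      finally show "4 * cH * geom + 4 * (cL * geom) * sqrt N \<le> N / 2 + const" by (simp add: const_def)
    qed simp
    finally show ?thesis
      by (subst energy2_eq_integral[OF fin sets_mu fm]) (simp add: S_def ennreal_leI)
  qed
qed

text \<open>Iterating N -> N / 2 + \<open>const\<close> from the a priori constant converges to the
  fixed point 2 \<open>const\<close>, and the dependence on \<open>R\<close> disappears in the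
  limit. No best constant has to be defined.\<close>

lemma truncated_restriction:
  assumes R: "R > 0" and f: "truncated R f"
  shows "energy2 \<mu> f \<le> ennreal (2 * const * Lp_mass p f powr (2 / p))"
proof -
  obtain N where N: "N \<ge> 0" "\<And>f. truncated R f \<Longrightarrow> energy2 \<mu> f \<le> ennreal (N * Lp_mass p f powr (2 / p))"
    using truncated_a_priori[OF fin sets_mu R exponent_bounds(1)] by blast
  have it: "energy2 \<mu> f \<le> ennreal ((N / 2 ^ n + 2 * const) * Lp_mass p f powr (2 / p))" if "truncated R f" for n f
    using that
  proof (induction n arbitrary: f)
    case 0
    have "energy2 \<mu> f \<le> ennreal (N * Lp_mass p f powr (2 / p))" by (rule N(2)[OF 0])
    also have "\<dots> \<le> ennreal ((N / 2 ^ 0 + 2 * const) * Lp_mass p f powr (2 / p))"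
      using const_pos by (intro ennreal_leI mult_right_mono) auto
    finally show ?case .
  next
    case (Suc n)
    have "energy2 \<mu> f \<le> ennreal (((N / 2 ^ n + 2 * const) / 2 + const) * Lp_mass p f powr (2 / p))"
      by (rule bootstrap[OF R _ Suc.IH Suc.prems]) (use N const_pos in auto)
    then show ?case by (simp add: field_simps)
  qed
  have "(\<lambda>n. N / 2 ^ n) \<longlonglongrightarrow> 0"
    by real_asymp
  then have "(\<lambda>n. (N / 2 ^ n + 2 * const) * Lp_mass p f powr (2 / p)) \<longlonglongrightarrow> (0 + 2 * const) * Lp_mass p f powr (2 / p)"
    by (intro tendsto_intros)
  then have "(\<lambda>n. ennreal ((N / 2 ^ n + 2 * const) * Lp_mass p f powr (2 / p))) \<longlonglongrightarrow> ennreal (2 * const * Lp_mass p f powr (2 / p))"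
    by (intro tendsto_ennrealI) simp
  then show ?thesis by (rule LIMSEQ_le_const) (use it[OF f] in blast)
qed

end

section \<open>Duality\<close>

lemma integrable_of_square:
  fixes g :: "'a::euclidean_space \<Rightarrow> complex"
  assumes "finite_measure \<mu>" and [measurable_cong]: "sets \<mu> = sets borel"
    and [measurable]: "g \<in> borel_measurable borel"
    and G: "(\<integral>\<^sup>+x. ennreal ((cmod (g x))\<^sup>2) \<partial>\<mu>) < \<infinity>"
  shows "integrable \<mu> g"
proof -
  interpret finite_measure \<mu> by fact
  have i: "integrable \<mu> (\<lambda>x. 1 + (cmod (g x))\<^sup>2)"
    using G by (intro Bochner_Integration.integrable_add integrable_const) (auto simp: integrable_iff_bounded)
  show ?thesis
  proof (rule Bochner_Integration.integrable_bound[OF i])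
    have "a \<le> 1 + a\<^sup>2" if "a \<ge> 0" for a :: real
      using that sum_squares_bound[of a 1] by simp
    then show "AE x in \<mu>. cmod (g x) \<le> norm (1 + (cmod (g x))\<^sup>2)"
      by (auto intro!: AE_I2 order_trans[OF _ abs_ge_self])
  qed measurable
qed

context two_scale_estimate
begin

definition q :: real where "q = p / (p - 1)"

lemma q_conj: "q > 1" "1 / p + 1 / q = 1" "(q - 1) * p = q"
  using exponent_bounds by (auto simp: q_def field_simps)

text \<open>The test function is the \<open>L\<^sup>q\<close>-dual of the transform, cut off to a truncated function.\<close>

lemma extension_estimate:
  assumes g [measurable]: "g \<in> borel_measurable borel"
    and G: "(\<integral>\<^sup>+x. ennreal ((cmod (g x))\<^sup>2) \<partial>\<mu>) \<le> ennreal G" "G \<ge> 0"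
  shows "(\<integral>\<^sup>+\<xi>. ennreal (cmod (fourier \<mu> g \<xi>) powr q) \<partial>lborel) \<le> ennreal ((sqrt (2 * const) * sqrt G) powr q)"
proof -
  interpret finite_measure \<mu> by (rule fin)
  define F where "F = fourier \<mu> g"
  have [measurable]: "F \<in> borel_measurable borel"
    unfolding F_def by (rule borel_measurable_fourier[OF sigma_finite_measure_axioms sets_mu g])
  have gi: "integrable \<mu> g"
    by (rule integrable_of_square[OF fin sets_mu g]) (use G in \<open>auto intro: le_less_trans\<close>)
  \<comment> \<open>The bounds concern |F|^(q-1), the modulus of the dual function, so that cutting
    off to \<open>Q n\<close> yields a \<open>truncated\<close> function with parameter n +
    1.\<close>
  define Q where "Q = (\<lambda>n::nat. {x::'a. norm x \<le> real (Suc n) \<and> 1 / real (Suc n) \<le> cmod (F x) powr (q - 1) \<and> cmod (F x) powr (q - 1) \<le> real (Suc n) \<and> F x \<noteq> 0})"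
  have [measurable]: "Q n \<in> sets borel" for n unfolding Q_def by measurable
  define f where "f = (\<lambda>n x. of_real (indicator (Q n) x * cmod (F x) powr (q - 2)) * cnj (F x))"
  have [measurable]: "f n \<in> borel_measurable borel" for n unfolding f_def by measurable
  have fn: "cmod (f n x) = indicator (Q n) x * cmod (F x) powr (q - 1)" for n x
  proof (cases "x \<in> Q n")
    case True
    then have "cmod (F x) > 0" by (simp add: Q_def)
    then have "cmod (F x) powr (q - 2) * cmod (F x) = cmod (F x) powr (q - 2 + 1)"
      by (subst powr_add) simp
    then show ?thesis using True by (simp add: f_def norm_mult)
  qed (simp add: f_def)
  have ft: "truncated (real (Suc n)) (f n)" for n
    unfolding truncated_def
  proof (intro conjI allI impI)
    fix x assume "f n x \<noteq> 0"
    then have "x \<in> Q n" by (auto simp: f_def split: split_indicator_asm)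
    then show "norm x \<le> real (Suc n)" "1 / real (Suc n) \<le> cmod (f n x)" "cmod (f n x) \<le> real (Suc n)"
      by (auto simp: fn Q_def)
  qed measurable
  have fp: "cmod (f n x) powr p = indicator (Q n) x * cmod (F x) powr q" for n x
    by (auto simp: fn powr_powr q_conj(3) split: split_indicator)
  have fF: "f n x * F x = of_real (cmod (f n x) powr p)" for n x
  proof (cases "x \<in> Q n")
    case True
    then have "cmod (F x) > 0" by (simp add: Q_def)
    then have "cmod (F x) powr (q - 2) * (cmod (F x))\<^sup>2 = cmod (F x) powr (q - 2 + 2)"
      by (subst powr_add) (simp add: powr_numeral)
    moreover have "f n x * F x = of_real (cmod (F x) powr (q - 2) * (cmod (F x))\<^sup>2)"
      using True complex_norm_square[of "F x"] by (simp add: f_def mult_ac)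
    ultimately show ?thesis using True by (simp add: fp)
  qed (simp add: f_def fp)
  have p1: "p > 0" using exponent_bounds by simp
  have main: "(\<integral>\<^sup>+x. ennreal (cmod (f n x) powr p) \<partial>lborel) \<le> ennreal ((sqrt (2 * const) * sqrt G) powr q)" for n
  proof -
    define S where "S = Lp_mass p (f n)"
    have S0: "S \<ge> 0" by (simp add: S_def)
    have fi: "integrable lborel (f n)" by (rule truncated_integrable[OF ft]) simp
    have "of_real S = (\<integral>x. f n x * fourier \<mu> g x \<partial>lborel)"
      by (simp add: S_def Lp_mass_def fF flip: F_def)
    also have "\<dots> = (\<integral>\<xi>. g \<xi> * fourier lborel (f n) \<xi> \<partial>\<mu>)"
      by (rule fourier_swap[OF sigma_finite_measure_axioms sigma_finite_lborel sets_mu _ gi fi]) simp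
    also have "cmod \<dots> \<le> sqrt G * sqrt (2 * const * S powr (2 / p))"
    proof (rule norm_integral_le_nn)
      show "(\<integral>\<^sup>+\<xi>. ennreal (cmod (g \<xi> * fourier lborel (f n) \<xi>)) \<partial>\<mu>) \<le> ennreal (sqrt G * sqrt (2 * const * S powr (2 / p)))"
        unfolding norm_mult
      proof (rule nn_integral_Cauchy_Schwarz)
        show "(\<integral>\<^sup>+\<xi>. ennreal ((cmod (fourier lborel (f n) \<xi>))\<^sup>2) \<partial>\<mu>) \<le> ennreal (2 * const * S powr (2 / p))"
          using truncated_restriction[OF _ ft] by (simp add: energy2_def S_def)
      qed (use G const_pos in auto)
    qed (use G const_pos in auto)
    finally have le: "S \<le> sqrt G * sqrt (2 * const * S powr (2 / p))" using S0 by simp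
    have "sqrt (2 * const * S powr (2 / p)) = sqrt (2 * const) * S powr (1 / p)"
      by (simp add: real_sqrt_mult powr_half_sqrt[symmetric] powr_powr)
    with le have le: "S \<le> (sqrt (2 * const) * sqrt G) * S powr (1 / p)" by (simp add: mult_ac)
    \<comment> \<open>Dividing by S^(1/p) leaves S^(1/q). The cutoff has made \<open>S\<close> a
      finite number, so the division is legitimate.\<close>
    have "S \<le> (sqrt (2 * const) * sqrt G) powr q"
    proof (cases "S = 0")
      case False
      then have S: "S > 0" using S0 by simp
      have "S powr (1 / q) * S powr (1 / p) = S"
        using S q_conj(2) by (simp add: powr_add[symmetric] add.commute)
      then have "S powr (1 / q) * S powr (1 / p) \<le> (sqrt (2 * const) * sqrt G) * S powr (1 / p)" using le by simp
      then have "S powr (1 / q) \<le> sqrt (2 * const) * sqrt G" using S by simp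
      then have "(S powr (1 / q)) powr q \<le> (sqrt (2 * const) * sqrt G) powr q"
        using q_conj(1) by (intro powr_mono2) auto
      then show ?thesis using S q_conj(1) by (simp add: powr_powr)
    qed simp
    moreover have "(\<integral>\<^sup>+x. ennreal (cmod (f n x) powr p) \<partial>lborel) = ennreal S"
      unfolding S_def Lp_mass_def by (rule nn_integral_eq_integral[OF truncated_integrable_powr[OF ft _ p1]]) auto
    ultimately show ?thesis by (simp add: ennreal_leI)
  qed
  show ?thesis unfolding F_def[symmetric]
  proof (rule nn_integral_le_of_tendsto[OF _ _ main])
    show "AE x in lborel. (\<lambda>n. ennreal (cmod (f n x) powr p)) \<longlonglongrightarrow> ennreal (cmod (F x) powr q)"
    proof (intro AE_I2)
      fix x
      show "(\<lambda>n. ennreal (cmod (f n x) powr p)) \<longlonglongrightarrow> ennreal (cmod (F x) powr q)"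
      proof (cases "F x = 0")
        case False
        define y where "y = cmod (F x) powr (q - 1)"
        have y: "y > 0" using False by (simp add: y_def)
        obtain N :: nat where N: "norm x + y + 1 / y \<le> real N" using real_arch_simple by blast
        have "x \<in> Q n" if "n \<ge> N" for n
        proof -
          have m: "norm x + y + 1 / y \<le> real (Suc n)" using N that by simp
          have "1 / y > 0" using y by simp
          then have "norm x \<le> real (Suc n)" "y \<le> real (Suc n)" "1 / y \<le> real (Suc n)"
            using m y norm_ge_zero[of x] by linarith+
          moreover from this(3) have "1 / real (Suc n) \<le> y" using y by (simp add: field_simps)
          ultimately show ?thesis using False by (simp add: Q_def y_def)
        qed
        then have "\<forall>\<^sub>F n in sequentially. ennreal (cmod (f n x) powr p) = ennreal (cmod (F x) powr q)"
          by (intro eventually_sequentiallyI[of N]) (simp add: fp)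
        then show ?thesis by (rule tendsto_eventually)
      qed (simp add: fp)
    qed
  qed measurable
qed

text \<open>Dualising back: the energy of \<open>f\<close> is the pairing of its transform with its
  own conjugate \<open>h\<close>, hence of \<open>f\<close> with the transform of \<open>h\<close>
  \<mu>, and Hoelder with \<open>extension_estimate\<close> bounds it by a multiple of its own
  square root. Integrability of \<open>f\<close> makes the energy finite, so the root can be
  cancelled.\<close>

lemma restriction_estimate:
  assumes f: "integrable lborel f"
    and P: "(\<integral>\<^sup>+x. ennreal (cmod (f x) powr p) \<partial>lborel) \<le> ennreal P" "P \<ge> 0"
  shows "energy2 \<mu> f \<le> ennreal (2 * const * P powr (2 / p))"
proof -
  interpret finite_measure \<mu> by (rule fin)
  have fm [measurable]: "f \<in> borel_measurable borel" using borel_measurable_integrable[OF f] by auto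
  define h where "h = (\<lambda>\<xi>. cnj (fourier lborel f \<xi>))"
  have hm [measurable]: "h \<in> borel_measurable borel" unfolding h_def by measurable
  have hi: "integrable \<mu> h"
    by (rule integrable_const_bound[where B="\<integral>x. cmod (f x) \<partial>lborel"]) (auto simp: h_def fourier_bound)
  define G where "G = (\<integral>\<xi>. (cmod (fourier lborel f \<xi>))\<^sup>2 \<partial>\<mu>)"
  have G0: "G \<ge> 0" by (simp add: G_def)
  have G: "energy2 \<mu> f = ennreal G" unfolding G_def by (rule energy2_eq_integral[OF fin sets_mu fm])
  have hG: "(\<integral>\<^sup>+\<xi>. ennreal ((cmod (h \<xi>))\<^sup>2) \<partial>\<mu>) \<le> ennreal G"
    using G by (simp add: h_def energy2_def)
  have Hm [measurable]: "fourier \<mu> h \<in> borel_measurable borel"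
    by (rule borel_measurable_fourier[OF sigma_finite_measure_axioms sets_mu hm])
  have "complex_of_real G = (\<integral>\<xi>. h \<xi> * fourier lborel f \<xi> \<partial>\<mu>)"
    unfolding G_def h_def mult.commute[of "cnj _"] by (simp flip: integral_complex_of_real complex_norm_square)
  also have "\<dots> = (\<integral>x. f x * fourier \<mu> h x \<partial>lborel)"
    by (rule fourier_swap[OF sigma_finite_lborel sigma_finite_measure_axioms _ sets_mu f hi]) simp
  also have "cmod \<dots> \<le> P powr (1 / p) * ((sqrt (2 * const) * sqrt G) powr q) powr (1 / q)"
  proof (rule norm_integral_le_nn)
    show "(\<integral>\<^sup>+x. ennreal (cmod (f x * fourier \<mu> h x)) \<partial>lborel) \<le> ennreal (P powr (1 / p) * ((sqrt (2 * const) * sqrt G) powr q) powr (1 / q))"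
      unfolding norm_mult
      by (rule nn_integral_Holder[OF exponent_bounds(1) q_conj(1,2)]) (use P extension_estimate[OF hm hG G0] in auto)
  qed simp
  also have "((sqrt (2 * const) * sqrt G) powr q) powr (1 / q) = sqrt (2 * const) * sqrt G"
    using const_pos G0 q_conj(1) by (simp add: powr_powr)
  finally have le: "G \<le> (P powr (1 / p) * sqrt (2 * const)) * sqrt G" using G0 by simp
  have "G \<le> 2 * const * P powr (2 / p)"
  proof (cases "G = 0")
    case False
    then have "sqrt G > 0" using G0 by simp
    moreover have "sqrt G * sqrt G \<le> (P powr (1 / p) * sqrt (2 * const)) * sqrt G" using le G0 by simp
    ultimately have "sqrt G \<le> P powr (1 / p) * sqrt (2 * const)" by (simp only: mult_le_cancel_right_pos)
    then have "(sqrt G)\<^sup>2 \<le> (P powr (1 / p) * sqrt (2 * const))\<^sup>2" using G0 by (intro power_mono) auto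
    moreover have "(P powr (1 / p))\<^sup>2 = P powr (2 / p)"
      by (cases "P = 0") (auto simp: powr_powr simp flip: powr_numeral)
    ultimately show ?thesis using G0 const_pos by (simp add: power_mult_distrib mult.commute)
  qed (use const_pos in simp)
  then show ?thesis using G by (simp add: ennreal_leI)
qed

end

section \<open>Norms as extended reals\<close>

lemma Lp_norm_eq:
  assumes "(\<integral>\<^sup>+x. ennreal (cmod (f x) powr p) \<partial>M) = ennreal P" "P \<ge> 0"
  shows "Lp_norm p M f = ennreal (P powr (1 / p))"
  using assms by (simp add: Lp_norm_def ennreal_powr_def)

lemma Lp_norm_le:
  assumes "(\<integral>\<^sup>+x. ennreal (cmod (f x) powr p) \<partial>M) \<le> ennreal P" "P \<ge> 0" "p > 0"
  shows "Lp_norm p M f \<le> ennreal (P powr (1 / p))"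
proof -
  obtain S where S: "(\<integral>\<^sup>+x. ennreal (cmod (f x) powr p) \<partial>M) = ennreal S" "S \<ge> 0"
    using assms(1) by (cases "\<integral>\<^sup>+x. ennreal (cmod (f x) powr p) \<partial>M") (auto simp: top_unique)
  then show ?thesis using assms by (subst Lp_norm_eq[OF S]) (auto intro!: ennreal_leI powr_mono2 simp: ennreal_le_iff)
qed

lemma Lp_norm_finite_iff:
  "Lp_norm p M f < \<infinity> \<longleftrightarrow> (\<integral>\<^sup>+x. ennreal (cmod (f x) powr p) \<partial>M) < \<infinity>"
  by (auto simp: Lp_norm_def ennreal_powr_def less_top)

lemma Lp_space_obtain:
  assumes "f \<in> Lp_space p M"
  obtains P where "(\<integral>\<^sup>+x. ennreal (cmod (f x) powr p) \<partial>M) = ennreal P" "P \<ge> 0" "f \<in> borel_measurable M"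
proof -
  have "(\<integral>\<^sup>+x. ennreal (cmod (f x) powr p) \<partial>M) < \<infinity>" "f \<in> borel_measurable M"
    using assms Lp_norm_finite_iff[of p M f] by (simp_all add: Lp_space_def)
  then show ?thesis using that by (cases "\<integral>\<^sup>+x. ennreal (cmod (f x) powr p) \<partial>M") auto
qed

lemma ennreal_tendsto_0_iff:
  fixes u :: "nat \<Rightarrow> ennreal"
  shows "u \<longlonglongrightarrow> 0 \<longleftrightarrow> (\<forall>\<epsilon>>0. \<forall>\<^sub>F n in sequentially. u n < ennreal \<epsilon>)"
proof
  assume "u \<longlonglongrightarrow> 0"
  then show "\<forall>\<epsilon>>0. \<forall>\<^sub>F n in sequentially. u n < ennreal \<epsilon>" by (auto intro: order_tendstoD(2))
next
  assume *: "\<forall>\<epsilon>>0. \<forall>\<^sub>F n in sequentially. u n < ennreal \<epsilon>"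
  show "u \<longlonglongrightarrow> 0"
  proof (rule order_tendstoI)
    fix a :: ennreal assume "0 < a"
    have "\<exists>r>0. ennreal r < a"
    proof (cases a)
      case (real b)
      then have "0 < b / 2" "ennreal (b / 2) < a" using \<open>0 < a\<close> by (auto simp: ennreal_less_iff)
      then show ?thesis by blast
    next
      case top
      then show ?thesis by (auto intro!: exI[of _ 1])
    qed
    then obtain r where r: "0 < r" "ennreal r < a" by blast
    have "\<forall>\<^sub>F n in sequentially. u n < ennreal r" using * r(1) by blast
    then show "\<forall>\<^sub>F n in sequentially. u n < a" by (rule eventually_mono) (use r(2) in \<open>auto intro: less_trans\<close>)
  qed simp
qed

text \<open>Allows all limits to be taken with p-th powers, which are additive in the
  integral.\<close>

lemma Lp_norm_tendsto_0_iff: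
  assumes p: "p > 0"
  shows "(\<lambda>n. Lp_norm p M (u n)) \<longlonglongrightarrow> 0 \<longleftrightarrow> (\<lambda>n. \<integral>\<^sup>+x. ennreal (cmod (u n x) powr p) \<partial>M) \<longlonglongrightarrow> 0"
proof -
  have *: "Lp_norm p M f < ennreal (\<epsilon> powr (1 / p)) \<longleftrightarrow> (\<integral>\<^sup>+x. ennreal (cmod (f x) powr p) \<partial>M) < ennreal \<epsilon>" if "\<epsilon> > 0" for f \<epsilon>
  proof (cases "\<integral>\<^sup>+x. ennreal (cmod (f x) powr p) \<partial>M")
    case (real r)
    have "r powr (1 / p) < \<epsilon> powr (1 / p) \<longleftrightarrow> r < \<epsilon>"
      using p that real by (metis powr_less_mono2 powr_mono2 divide_pos_pos less_eq_real_def linorder_not_less zero_less_one)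
    then show ?thesis using real that by (simp add: Lp_norm_eq[OF real(2,1)] ennreal_less_iff)
  next
    case top
    then show ?thesis by (simp add: Lp_norm_def ennreal_powr_def)
  qed
  show ?thesis unfolding ennreal_tendsto_0_iff
  proof (intro iffI allI impI)
    fix \<epsilon> :: real assume A: "\<forall>\<epsilon>>0. \<forall>\<^sub>F n in sequentially. Lp_norm p M (u n) < ennreal \<epsilon>" and e: "\<epsilon> > 0"
    then have "\<forall>\<^sub>F n in sequentially. Lp_norm p M (u n) < ennreal (\<epsilon> powr (1 / p))" by simp
    then show "\<forall>\<^sub>F n in sequentially. (\<integral>\<^sup>+x. ennreal (cmod (u n x) powr p) \<partial>M) < ennreal \<epsilon>"
      by (simp only: *[OF e])
  next
    fix \<epsilon> :: real assume A: "\<forall>\<epsilon>>0. \<forall>\<^sub>F n in sequentially. (\<integral>\<^sup>+x. ennreal (cmod (u n x) powr p) \<partial>M) < ennreal \<epsilon>" and e: "\<epsilon> > 0"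
    have e': "\<epsilon> powr p > 0" "(\<epsilon> powr p) powr (1 / p) = \<epsilon>" using e p by (auto simp: powr_powr)
    have "\<forall>\<^sub>F n in sequentially. (\<integral>\<^sup>+x. ennreal (cmod (u n x) powr p) \<partial>M) < ennreal (\<epsilon> powr p)" using A e' by blast
    then show "\<forall>\<^sub>F n in sequentially. Lp_norm p M (u n) < ennreal \<epsilon>"
      using *[OF e'(1)] by (simp only: e'(2))
  qed
qed

section \<open>Density of Schwartz functions\<close>

lemma schwartz_continuous:
  assumes "schwartz f"
  shows "continuous_on UNIV f"
proof -
  have "\<forall>x. iter_partial [] f differentiable (at x)" using assms unfolding schwartz_def by (metis empty_subsetI list.set(1))
  then show ?thesis
    by (auto simp: continuous_on_eq_continuous_within intro!: differentiable_imp_continuous_within)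
qed

lemma schwartz_measurable: "schwartz f \<Longrightarrow> f \<in> borel_measurable borel"
  by (intro borel_measurable_continuous_onI schwartz_continuous)

text \<open>The dominating function is the product of 1 / (1 + x_b^2) over the coordinates. Its
  reciprocal is at most (1 + |x|^2)^d \<le> 2^d (1 + |x|^(2 d)), so the decay conditions of orders 0
  and 2 d suffice.\<close>

lemma schwartz_integrable:
  fixes f :: "'a::euclidean_space \<Rightarrow> complex"
  assumes f: "schwartz f"
  shows "integrable lborel f"
proof -
  have bd: "\<exists>C. \<forall>x. norm x ^ k * cmod (f x) \<le> C" for k :: nat
  proof -
    have "bounded (range (\<lambda>x. norm x ^ k *\<^sub>R iter_partial [] f x))"
      using f unfolding schwartz_def by (metis empty_subsetI list.set(1))
    then show ?thesis by (auto simp: bounded_iff)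
  qed
  obtain C0 where C0: "\<And>x. norm x ^ 0 * cmod (f x) \<le> C0" using bd by blast
  obtain C1 where C1: "\<And>x. norm x ^ (2 * DIM('a)) * cmod (f x) \<le> C1" using bd by blast
  define C where "C = 2 ^ DIM('a) * (C0 + C1)"
  let ?g = "\<lambda>x::'a. \<Prod>b\<in>Basis. complex_of_real (inverse (1 + (x \<bullet> b)\<^sup>2))"
  have "set_integrable lborel (einterval (-\<infinity>) \<infinity>) (\<lambda>x::real. inverse (1 + x\<^sup>2))"
    by (rule integrable_inverse_1_plus_square)
  then have "integrable lborel (\<lambda>x::real. inverse (1 + x\<^sup>2))"
    by (simp add: set_integrable_def)
  then have "integrable lborel (\<lambda>x::real. complex_of_real (inverse (1 + x\<^sup>2)))"
    by (subst complex_of_real_integrable_eq)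
  then have i: "integrable lborel (\<lambda>x. of_real C * ?g x)"
    by (intro integrable_mult_right integrable_lborel_prod_Basis(1)) auto
  show ?thesis
  proof (rule Bochner_Integration.integrable_bound[OF i])
    show "f \<in> borel_measurable lborel" using schwartz_measurable[OF f] by simp
    show "AE x in lborel. norm (f x) \<le> norm (of_real C * ?g x)"
    proof (intro AE_I2)
      fix x :: 'a
      let ?P = "\<Prod>b\<in>(Basis::'a set). 1 + (x \<bullet> b)\<^sup>2"
      have P: "?P > 0" by (intro prod_pos) (auto intro: add_pos_nonneg)
      have "?P \<le> (\<Prod>b\<in>(Basis::'a set). 1 + (norm x)\<^sup>2)"
        by (intro prod_mono conjI add_left_mono) (auto simp: Basis_le_norm abs_le_square_iff[symmetric])
      also have "\<dots> = (1 + (norm x)\<^sup>2) ^ DIM('a)" by simp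
      also have "\<dots> \<le> (2 * max 1 ((norm x)\<^sup>2)) ^ DIM('a)" by (intro power_mono) auto
      also have "\<dots> = 2 ^ DIM('a) * max 1 ((norm x)\<^sup>2) ^ DIM('a)" by (simp add: power_mult_distrib)
      also have "max 1 ((norm x)\<^sup>2) ^ DIM('a) \<le> 1 + norm x ^ (2 * DIM('a))"
        by (cases "(norm x)\<^sup>2 \<le> 1") (auto simp: max_def power_mult)
      finally have "?P \<le> 2 ^ DIM('a) * (1 + norm x ^ (2 * DIM('a)))" by simp
      then have "?P * cmod (f x) \<le> 2 ^ DIM('a) * (1 + norm x ^ (2 * DIM('a))) * cmod (f x)" by (rule mult_right_mono) simp
      also have "\<dots> = 2 ^ DIM('a) * (norm x ^ 0 * cmod (f x) + norm x ^ (2 * DIM('a)) * cmod (f x))"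
        by (simp add: algebra_simps)
      also have "\<dots> \<le> C" unfolding C_def by (intro mult_left_mono add_mono C0 C1) auto
      finally have "cmod (f x) \<le> C * (1 / ?P)" using P by (simp add: field_simps)
      also have "1 / ?P = (\<Prod>b\<in>(Basis::'a set). 1 / (1 + (x \<bullet> b)\<^sup>2))"
        by (subst prod_dividef) simp
      also have "\<dots> = (\<Prod>b\<in>Basis. cmod (complex_of_real (inverse (1 + (x \<bullet> b)\<^sup>2))))"
        by (intro prod.cong refl) (simp only: norm_of_real inverse_eq_divide, simp)
      also have "\<dots> = cmod (?g x)" by (rule prod_norm)
      also have "C * \<dots> \<le> norm (of_real C * ?g x)" by (simp only: norm_mult norm_of_real) (intro mult_right_mono, auto)
      finally show "norm (f x) \<le> norm (of_real C * ?g x)" .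
    qed
  qed
qed

section \<open>Polynomials times exponentials of polynomials\<close>

text \<open>Polynomial directional derivatives are what closes \<open>poly_exp\<close> under
  \<open>iter_partial\<close>.\<close>

lemma real_polynomial_has_derivative:
  fixes P :: "'a::euclidean_space \<Rightarrow> real"
  assumes "real_polynomial_function P"
  shows "\<exists>P'. (\<forall>x. (P has_derivative P' x) (at x)) \<and> (\<forall>b. real_polynomial_function (\<lambda>x. P' x b))"
  using assms
proof induction
  case (linear f)
  then show ?case by (intro exI[of _ "\<lambda>x. f"]) (auto intro: bounded_linear_imp_has_derivative)
next
  case (const c)
  then show ?case by (intro exI[of _ "\<lambda>x b. 0"]) auto
next
  case (add f g)
  then obtain f' g' where *: "\<And>x. (f has_derivative f' x) (at x)" "\<And>x. (g has_derivative g' x) (at x)"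
    "\<And>b. real_polynomial_function (\<lambda>x. f' x b)" "\<And>b. real_polynomial_function (\<lambda>x. g' x b)" by blast
  show ?case
    by (rule exI[of _ "\<lambda>x b. f' x b + g' x b"]) (use * in \<open>auto intro!: has_derivative_add\<close>)
next
  case (mult f g)
  then obtain f' g' where *: "\<And>x. (f has_derivative f' x) (at x)" "\<And>x. (g has_derivative g' x) (at x)"
    "\<And>b. real_polynomial_function (\<lambda>x. f' x b)" "\<And>b. real_polynomial_function (\<lambda>x. g' x b)" by blast
  show ?case
    by (rule exI[of _ "\<lambda>x b. f x * g' x b + f' x b * g x"])
       (use * mult.hyps in \<open>auto intro!: has_derivative_mult real_polynomial_function.intros(3,4)\<close>)
qed

lemma real_polynomial_growth:
  fixes P :: "'a::euclidean_space \<Rightarrow> real"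
  assumes "real_polynomial_function P"
  shows "\<exists>C\<ge>0. \<exists>m. \<forall>x. \<bar>P x\<bar> \<le> C * (1 + norm x) ^ m"
  using assms
proof induction
  case (linear f)
  obtain K where K: "K > 0" "\<And>x. norm (f x) \<le> norm x * K" using bounded_linear.pos_bounded[OF linear] by blast
  show ?case
  proof (intro exI[of _ K] exI[of _ 1] conjI allI)
    fix x
    have "\<bar>f x\<bar> \<le> norm x * K" using K(2)[of x] by simp
    also have "\<dots> \<le> K * (1 + norm x) ^ 1" using K(1) by (simp add: algebra_simps)
    finally show "\<bar>f x\<bar> \<le> K * (1 + norm x) ^ 1" .
  qed (use K in simp)
next
  case (const c)
  show ?case by (intro exI[of _ "\<bar>c\<bar>"] exI[of _ 0] conjI allI) auto
next
  case (add f g)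
  then obtain C m D n where *: "C \<ge> 0" "\<And>x. \<bar>f x\<bar> \<le> C * (1 + norm x) ^ m" "D \<ge> 0" "\<And>x. \<bar>g x\<bar> \<le> D * (1 + norm x) ^ n" by blast
  show ?case
  proof (rule exI[of _ "C + D"], rule conjI, use * in simp, rule exI[of _ "m + n"], rule allI)
    fix x :: 'a
    have "\<bar>f x + g x\<bar> \<le> C * (1 + norm x) ^ m + D * (1 + norm x) ^ n" using *(2)[of x] *(4)[of x] by linarith
    also have "\<dots> \<le> C * (1 + norm x) ^ (m + n) + D * (1 + norm x) ^ (m + n)"
      using * by (intro add_mono mult_left_mono power_increasing) auto
    finally show "\<bar>f x + g x\<bar> \<le> (C + D) * (1 + norm x) ^ (m + n)" by (simp add: algebra_simps)
  qed
next
  case (mult f g)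
  then obtain C m D n where *: "C \<ge> 0" "\<And>x. \<bar>f x\<bar> \<le> C * (1 + norm x) ^ m" "D \<ge> 0" "\<And>x. \<bar>g x\<bar> \<le> D * (1 + norm x) ^ n" by blast
  show ?case
  proof (rule exI[of _ "C * D"], rule conjI, use * in simp, rule exI[of _ "m + n"], rule allI)
    fix x :: 'a
    have "\<bar>f x * g x\<bar> \<le> (C * (1 + norm x) ^ m) * (D * (1 + norm x) ^ n)"
      unfolding abs_mult using * by (intro mult_mono) auto
    then show "\<bar>f x * g x\<bar> \<le> (C * D) * (1 + norm x) ^ (m + n)" by (simp add: power_add mult_ac)
  qed
qed

text \<open>The witness combines (1 + r)^N \<le> N! exp(1 + r), one term of the exponential series,
  with r - c r^2 \<le> 1 / (4 c), a completed square.\<close>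

lemma power_exp_bounded:
  assumes c: "c > (0::real)"
  shows "\<exists>K\<ge>0. \<forall>r\<ge>0. (1 + r) ^ N * exp (- c * r\<^sup>2) \<le> K"
proof (intro exI[of _ "fact N * exp (1 + 1 / (4 * c))"] conjI allI impI)
  fix r :: real assume r: "r \<ge> 0"
  have "(1 + r) ^ N /\<^sub>R fact N \<le> (\<Sum>n. (1 + r) ^ n /\<^sub>R fact n)"
    using sum_le_suminf[OF summable_exp_generic, of "{N}" "1 + r"] r by simp
  also have "\<dots> = exp (1 + r)" by (simp add: exp_def)
  finally have "(1 + r) ^ N \<le> fact N * exp (1 + r)" by (simp add: field_simps)
  then have "(1 + r) ^ N * exp (- c * r\<^sup>2) \<le> fact N * exp (1 + r) * exp (- c * r\<^sup>2)" by (rule mult_right_mono) simp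
  also have "\<dots> = fact N * exp (1 + r - c * r\<^sup>2)" by (simp add: mult_exp_exp)
  also have "\<dots> \<le> fact N * exp (1 + 1 / (4 * c))"
  proof -
    have "0 \<le> (2 * c * r - 1)\<^sup>2" by simp
    then have "r - c * r\<^sup>2 \<le> 1 / (4 * c)" using c by (simp add: field_simps power2_eq_square)
    then show ?thesis by simp
  qed
  finally show "(1 + r) ^ N * exp (- c * r\<^sup>2) \<le> fact N * exp (1 + 1 / (4 * c))" .
qed simp

text \<open>A class closed under partial derivatives by mere algebra, so that induction over the
  list of directions yields smoothness and decay at once. Real and imaginary part are kept apart
  because polynomial functions are real valued here.\<close>

definition poly_exp :: "('a::euclidean_space \<Rightarrow> real) \<Rightarrow> ('a \<Rightarrow> complex) set" where
  "poly_exp Q = {f. \<exists>P1 P2. real_polynomial_function P1 \<and> real_polynomial_function P2 \<and>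
      f = (\<lambda>x. Complex (P1 x) (P2 x) * of_real (exp (- Q x)))}"

lemma poly_exp_partial:
  fixes Q :: "'a::euclidean_space \<Rightarrow> real"
  assumes Q: "real_polynomial_function Q" and f: "f \<in> poly_exp Q"
  shows "f differentiable (at x)" and "(\<lambda>x. frechet_derivative f (at x) b) \<in> poly_exp Q"
proof -
  obtain P1 P2 where P: "real_polynomial_function P1" "real_polynomial_function P2"
    "f = (\<lambda>x. Complex (P1 x) (P2 x) * of_real (exp (- Q x)))" using f by (auto simp: poly_exp_def)
  obtain Q' where Q': "\<And>x. (Q has_derivative Q' x) (at x)" "\<And>b. real_polynomial_function (\<lambda>x. Q' x b)"
    using real_polynomial_has_derivative[OF Q] by blast
  obtain P1' where P1': "\<And>x. (P1 has_derivative P1' x) (at x)" "\<And>b. real_polynomial_function (\<lambda>x. P1' x b)"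
    using real_polynomial_has_derivative[OF P(1)] by blast
  obtain P2' where P2': "\<And>x. (P2 has_derivative P2' x) (at x)" "\<And>b. real_polynomial_function (\<lambda>x. P2' x b)"
    using real_polynomial_has_derivative[OF P(2)] by blast
  \<comment> \<open>Written with \<open>+\<close> and \<open>-1 *\<close> so that the introduction
    rules for constants, sums and products of polynomials apply literally.\<close>
  have D: "(f has_derivative (\<lambda>b. Complex (P1' x b + -1 * (P1 x * Q' x b)) (P2' x b + -1 * (P2 x * Q' x b)) * of_real (exp (- Q x)))) (at x)" for x
    unfolding P(3) Complex_eq
    by (rule has_derivative_eq_rhs, (rule derivative_intros Q' P1' P2')+) (auto simp: fun_eq_iff algebra_simps)
  show "f differentiable (at x)" using D differentiable_def by blast
  have "(\<lambda>x. frechet_derivative f (at x) b) = (\<lambda>x. Complex (P1' x b + -1 * (P1 x * Q' x b)) (P2' x b + -1 * (P2 x * Q' x b)) * of_real (exp (- Q x)))"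
    using frechet_derivative_at[OF D] by (metis (no_types, lifting))
  moreover have "real_polynomial_function (\<lambda>x. P1' x b + -1 * (P1 x * Q' x b))" "real_polynomial_function (\<lambda>x. P2' x b + -1 * (P2 x * Q' x b))"
    using P(1,2) P1' P2' Q' by (intro real_polynomial_function.intros(2-4); blast)+
  ultimately show "(\<lambda>x. frechet_derivative f (at x) b) \<in> poly_exp Q" unfolding poly_exp_def by blast
qed

lemma poly_exp_decay:
  fixes Q :: "'a::euclidean_space \<Rightarrow> real"
  assumes c: "c > 0" and Q: "\<And>x. Q x \<ge> c * (norm x)\<^sup>2 - a" and f: "f \<in> poly_exp Q"
  shows "bounded (range (\<lambda>x. norm x ^ k *\<^sub>R f x))"
proof -
  obtain P1 P2 where P: "real_polynomial_function P1" "real_polynomial_function P2"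
    "f = (\<lambda>x. Complex (P1 x) (P2 x) * of_real (exp (- Q x)))" using f by (auto simp: poly_exp_def)
  have one: "\<exists>K. \<forall>x. norm x ^ k * \<bar>R x\<bar> * exp (- Q x) \<le> K" if R: "real_polynomial_function R" for R
  proof -
    obtain C m where C: "C \<ge> 0" "\<And>x. \<bar>R x\<bar> \<le> C * (1 + norm x) ^ m" using real_polynomial_growth[OF R] by blast
    obtain K where K: "K \<ge> 0" "\<And>r. r \<ge> 0 \<Longrightarrow> (1 + r) ^ (k + m) * exp (- c * r\<^sup>2) \<le> K" using power_exp_bounded[OF c] by blast
    show ?thesis
    proof (intro exI[of _ "C * exp a * K"] allI)
      fix x
      have "norm x ^ k * \<bar>R x\<bar> * exp (- Q x) \<le> (1 + norm x) ^ k * (C * (1 + norm x) ^ m) * exp (a - c * (norm x)\<^sup>2)"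
        using C Q[of x] by (intro mult_mono power_mono) auto
      also have "\<dots> = C * exp a * ((1 + norm x) ^ (k + m) * exp (- c * (norm x)\<^sup>2))"
        by (simp add: power_add exp_diff exp_minus field_simps)
      also have "\<dots> \<le> C * exp a * K" using C K by (intro mult_left_mono) auto
      finally show "norm x ^ k * \<bar>R x\<bar> * exp (- Q x) \<le> C * exp a * K" .
    qed
  qed
  obtain K1 K2 where K: "\<And>x. norm x ^ k * \<bar>P1 x\<bar> * exp (- Q x) \<le> K1" "\<And>x. norm x ^ k * \<bar>P2 x\<bar> * exp (- Q x) \<le> K2"
    using one[OF P(1)] one[OF P(2)] by blast
  show ?thesis unfolding bounded_iff
  proof (intro exI[of _ "K1 + K2"] ballI, clarify)
    fix x
    have "norm (norm x ^ k *\<^sub>R f x) = norm x ^ k * cmod (Complex (P1 x) (P2 x)) * exp (- Q x)"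
      by (simp add: P(3) norm_mult)
    also have "\<dots> \<le> norm x ^ k * (\<bar>P1 x\<bar> + \<bar>P2 x\<bar>) * exp (- Q x)"
      using cmod_le[of "Complex (P1 x) (P2 x)"] by (intro mult_right_mono mult_left_mono) auto
    also have "\<dots> \<le> K1 + K2" using K[of x] by (simp add: algebra_simps)
    finally show "norm (norm x ^ k *\<^sub>R f x) \<le> K1 + K2" .
  qed
qed

lemma poly_exp_schwartz:
  fixes Q :: "'a::euclidean_space \<Rightarrow> real"
  assumes Q: "real_polynomial_function Q" "c > 0" "\<And>x. Q x \<ge> c * (norm x)\<^sup>2 - a" and f: "f \<in> poly_exp Q"
  shows "schwartz f"
proof -
  have "iter_partial bs f \<in> poly_exp Q" for bs
    by (induction bs) (auto simp: f intro: poly_exp_partial(2)[OF Q(1)])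
  then show ?thesis unfolding schwartz_def
    using poly_exp_partial(1)[OF Q(1)] poly_exp_decay[OF Q(2,3)] by blast
qed

section \<open>Approximation in the p-th mean\<close>

text \<open>A quasi-triangle inequality, from |a + b| \<le> 2 max(|a|, |b|). It costs a factor 2^p
  but is additive in p-th powers; for qualitative density the factor is harmless.\<close>

lemma cmod_add_powr_le:
  assumes p: "p > 0"
  shows "cmod (a + b) powr p \<le> 2 powr p * cmod a powr p + 2 powr p * cmod b powr p"
proof -
  have "cmod (a + b) \<le> 2 * max (cmod a) (cmod b)" using norm_triangle_ineq[of a b] by simp
  then have "cmod (a + b) powr p \<le> (2 * max (cmod a) (cmod b)) powr p" using p by (intro powr_mono2) auto
  also have "\<dots> = 2 powr p * max (cmod a) (cmod b) powr p" by (simp add: powr_mult)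
  also have "\<dots> \<le> 2 powr p * (cmod a powr p + cmod b powr p)" by (intro mult_left_mono) (auto simp: max_def)
  finally show ?thesis by (simp add: distrib_left)
qed

lemma nn_integral_add_powr_le:
  assumes p: "p > 0" and [measurable]: "f \<in> borel_measurable M" "g \<in> borel_measurable M"
  shows "(\<integral>\<^sup>+x. ennreal (cmod (f x + g x) powr p) \<partial>M)
    \<le> ennreal (2 powr p) * (\<integral>\<^sup>+x. ennreal (cmod (f x) powr p) \<partial>M) + ennreal (2 powr p) * (\<integral>\<^sup>+x. ennreal (cmod (g x) powr p) \<partial>M)"
proof -
  have "(\<integral>\<^sup>+x. ennreal (cmod (f x + g x) powr p) \<partial>M)
    \<le> (\<integral>\<^sup>+x. ennreal (2 powr p) * ennreal (cmod (f x) powr p) + ennreal (2 powr p) * ennreal (cmod (g x) powr p) \<partial>M)"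
    by (intro nn_integral_mono) (simp add: cmod_add_powr_le[OF p] ennreal_leI flip: ennreal_mult' ennreal_plus)
  also have "\<dots> = ennreal (2 powr p) * (\<integral>\<^sup>+x. ennreal (cmod (f x) powr p) \<partial>M) + ennreal (2 powr p) * (\<integral>\<^sup>+x. ennreal (cmod (g x) powr p) \<partial>M)"
    by (simp add: nn_integral_add nn_integral_cmult)
  finally show ?thesis .
qed

lemma nn_integral_triangle_powr:
  assumes p: "p > 0" and [measurable]: "f \<in> borel_measurable M" "g \<in> borel_measurable M" "h \<in> borel_measurable M"
    and 1: "(\<integral>\<^sup>+x. ennreal (cmod (f x - g x) powr p) \<partial>M) \<le> ennreal a"
    and 2: "(\<integral>\<^sup>+x. ennreal (cmod (g x - h x) powr p) \<partial>M) \<le> ennreal b"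
    and ab: "a \<ge> 0" "b \<ge> 0"
  shows "(\<integral>\<^sup>+x. ennreal (cmod (f x - h x) powr p) \<partial>M) \<le> ennreal (2 powr p * (a + b))"
proof -
  have "(\<integral>\<^sup>+x. ennreal (cmod (f x - h x) powr p) \<partial>M) = (\<integral>\<^sup>+x. ennreal (cmod ((f x - g x) + (g x - h x)) powr p) \<partial>M)" by simp
  also have "\<dots> \<le> ennreal (2 powr p) * (\<integral>\<^sup>+x. ennreal (cmod (f x - g x) powr p) \<partial>M) + ennreal (2 powr p) * (\<integral>\<^sup>+x. ennreal (cmod (g x - h x) powr p) \<partial>M)"
    by (rule nn_integral_add_powr_le[OF p]) measurable
  also have "\<dots> \<le> ennreal (2 powr p) * ennreal a + ennreal (2 powr p) * ennreal b"
    by (intro add_mono mult_left_mono 1 2) auto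
  also have "\<dots> = ennreal (2 powr p * (a + b))" using ab by (simp add: distrib_left flip: ennreal_mult' ennreal_plus)
  finally show ?thesis .
qed

definition approximable :: "real \<Rightarrow> ('a::euclidean_space \<Rightarrow> complex) \<Rightarrow> bool" where
  "approximable p f \<longleftrightarrow> (\<forall>\<epsilon>>0. \<exists>\<phi>. schwartz \<phi> \<and> (\<integral>\<^sup>+x. ennreal (cmod (\<phi> x - f x) powr p) \<partial>lborel) \<le> ennreal \<epsilon>)"

lemma approximable_closure:
  assumes p: "p > 0" and [measurable]: "f \<in> borel_measurable borel"
    and ex: "\<And>\<epsilon>. \<epsilon> > 0 \<Longrightarrow> \<exists>g. g \<in> borel_measurable borel \<and> approximable p g \<and> (\<integral>\<^sup>+x. ennreal (cmod (g x - f x) powr p) \<partial>lborel) \<le> ennreal \<epsilon>"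
  shows "approximable p f"
  unfolding approximable_def
proof (intro allI impI)
  fix \<epsilon> :: real assume e: "\<epsilon> > 0"
  define \<eta> where "\<eta> = \<epsilon> / (2 powr p * 2)"
  have \<eta>: "\<eta> > 0" using e by (simp add: \<eta>_def)
  obtain g where g: "g \<in> borel_measurable borel" "approximable p g" "(\<integral>\<^sup>+x. ennreal (cmod (g x - f x) powr p) \<partial>lborel) \<le> ennreal \<eta>"
    using ex[OF \<eta>] by blast
  note [measurable] = g(1)
  obtain \<phi> where \<phi>: "schwartz \<phi>" "(\<integral>\<^sup>+x. ennreal (cmod (\<phi> x - g x) powr p) \<partial>lborel) \<le> ennreal \<eta>"
    using g(2) \<eta> unfolding approximable_def by blast
  note [measurable] = schwartz_measurable[OF \<phi>(1)]
  have "(\<integral>\<^sup>+x. ennreal (cmod (\<phi> x - f x) powr p) \<partial>lborel) \<le> ennreal (2 powr p * (\<eta> + \<eta>))"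
    using \<eta> by (intro nn_integral_triangle_powr[OF p _ _ _ \<phi>(2) g(3)]) auto
  also have "2 powr p * (\<eta> + \<eta>) = \<epsilon>" by (simp add: \<eta>_def)
  finally show "\<exists>\<phi>. schwartz \<phi> \<and> (\<integral>\<^sup>+x. ennreal (cmod (\<phi> x - f x) powr p) \<partial>lborel) \<le> ennreal \<epsilon>"
    using \<phi>(1) by blast
qed

lemma approximable_limit:
  assumes p: "p > 0" and "f \<in> borel_measurable borel"
    and g: "\<And>n. g n \<in> borel_measurable borel" "\<And>n. approximable p (g n)"
    and lim: "(\<lambda>n. \<integral>\<^sup>+x. ennreal (cmod (g n x - f x) powr p) \<partial>lborel) \<longlonglongrightarrow> 0"
  shows "approximable p f"
proof (rule approximable_closure[OF assms(1,2)])
  fix \<epsilon> :: real assume "\<epsilon> > 0"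
  then have "\<forall>\<^sub>F n in sequentially. (\<integral>\<^sup>+x. ennreal (cmod (g n x - f x) powr p) \<partial>lborel) < ennreal \<epsilon>"
    using lim by (simp add: ennreal_tendsto_0_iff)
  then obtain n where "(\<integral>\<^sup>+x. ennreal (cmod (g n x - f x) powr p) \<partial>lborel) < ennreal \<epsilon>"
    using eventually_happens' sequentially_bot by blast
  then show "\<exists>g. g \<in> borel_measurable borel \<and> approximable p g \<and> (\<integral>\<^sup>+x. ennreal (cmod (g x - f x) powr p) \<partial>lborel) \<le> ennreal \<epsilon>"
    using g less_imp_le by blast
qed

definition cube :: "real \<Rightarrow> 'a::euclidean_space set" where
  "cube h = {x. \<forall>b\<in>Basis. \<bar>x \<bullet> b\<bar> < h}"

lemma cube_eq_box: "cube h = box (- (\<Sum>b\<in>Basis. h *\<^sub>R b)) (\<Sum>b\<in>Basis. h *\<^sub>R (b::'a::euclidean_space))"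
  by (auto simp: cube_def mem_box abs_less_iff inner_sum_left_Basis minus_less_iff inner_minus_left)

lemma borel_cube [measurable]: "cube h \<in> sets borel"
  unfolding cube_eq_box by simp

lemma emeasure_cube: "emeasure lborel (cube h :: 'a::euclidean_space set) < \<infinity>"
  unfolding cube_eq_box by (rule emeasure_bounded_finite[OF bounded_box])

lemma AE_lborel_not_negligible:
  assumes "negligible N"
  shows "AE x in lborel. x \<notin> N"
proof -
  have "N \<in> null_sets (completion lborel)" using assms by (simp add: negligible_iff_null_sets)
  then obtain N' where "N' \<in> null_sets lborel" "N \<subseteq> N'" by (auto simp: null_sets_completion_iff2)
  then show ?thesis by (intro AE_I'[of N']) auto
qed

text \<open>The weights \<open>exp (- \<Sum>\<^sub>b (x\<^sub>b / h)\<^bsup>2n\<^esup>)\<close> converge to the indicator function of the cube.\<close>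

lemma approximable_polynomial_cube:
  fixes P1 P2 :: "'a::euclidean_space \<Rightarrow> real"
  assumes p: "p > 0" and h: "h > 0" and P: "real_polynomial_function P1" "real_polynomial_function P2"
  shows "approximable p (\<lambda>x. Complex (P1 x) (P2 x) * indicator (cube h) x)"
proof -
  \<comment> \<open>The exponents are even and start at 2: thus \<open>Q n\<close> is nonnegative
    and dominates a quadratic form already for n = 0.\<close>
  define Q where "Q = (\<lambda>n (x::'a). \<Sum>b\<in>Basis. ((1 / h) * (x \<bullet> b)) ^ (2 * Suc n))"
  define W where "W = (\<lambda>n x. exp (- Q n x))"
  define F where "F = (\<lambda>x. Complex (P1 x) (P2 x))"
  have Qp: "real_polynomial_function (Q n)" for n
    unfolding Q_def by (intro real_polynomial_function_sum real_polynomial_function_power real_polynomial_function.intros(4,2,1) bounded_linear_inner_left) auto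
  have nn: "(norm x)\<^sup>2 = (\<Sum>b\<in>Basis. (x \<bullet> b)\<^sup>2)" for x :: 'a
    unfolding power2_norm_eq_inner by (subst euclidean_inner) (simp add: power2_eq_square)
  define c where "c = 1 / h\<^sup>2"
  define d where "d = real DIM('a)"
  have c: "c > 0" using h by (simp add: c_def)
  \<comment> \<open>From u^2 - 1 \<le> u^(2n+2) in each coordinate. The same bound for all
    \<open>n\<close> gives both Schwartz decay and a dominating Gaussian independent of
    \<open>n\<close>.\<close>
  have Qlow: "Q n x \<ge> c * (norm x)\<^sup>2 - d" for n x
  proof -
    have "u\<^sup>2 - 1 \<le> u ^ (2 * Suc n)" for u :: real
    proof (cases "u\<^sup>2 \<le> 1")
      case True
      then have "u\<^sup>2 - 1 \<le> 0" by simp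
      also have "0 \<le> u ^ (2 * Suc n)" by (simp only: power_mult) simp
      finally show ?thesis .
    next
      case False
      then have "(u\<^sup>2) ^ 1 \<le> (u\<^sup>2) ^ Suc n" by (intro power_increasing) auto
      then show ?thesis by (simp only: power_mult) simp
    qed
    then have "(\<Sum>b\<in>Basis. ((1 / h) * (x \<bullet> b))\<^sup>2 - 1) \<le> Q n x" unfolding Q_def by (intro sum_mono)
    also have "(\<Sum>b\<in>Basis. ((1 / h) * (x \<bullet> b))\<^sup>2 - 1) = c * (norm x)\<^sup>2 - d"
      by (simp add: nn sum_subtractf c_def d_def sum_distrib_left power_divide sum_divide_distrib)
    finally show ?thesis .
  qed
  have Pm [measurable]: "P1 \<in> borel_measurable borel" "P2 \<in> borel_measurable borel" "Q n \<in> borel_measurable borel" for n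
    using P Qp by (auto intro!: borel_measurable_continuous_onI continuous_real_polymonial_function continuous_at_imp_continuous_on)
  have Fm [measurable]: "F \<in> borel_measurable borel" unfolding F_def Complex_eq by measurable
  have Wm [measurable]: "W n \<in> borel_measurable borel" for n unfolding W_def by measurable
  define g where "g = (\<lambda>n x. F x * of_real (W n x))"
  have gm [measurable]: "g n \<in> borel_measurable borel" for n unfolding g_def by measurable
  have gs: "schwartz (g n)" for n
    by (rule poly_exp_schwartz[OF Qp[of n] c Qlow]) (use P in \<open>auto simp: poly_exp_def g_def F_def W_def\<close>)
  have dom: "W n x \<le> exp d * exp (- c * (norm x)\<^sup>2)" "indicator (cube h) x \<le> exp d * exp (- c * (norm x)\<^sup>2)" for n x
  proof -
    have "W n x \<le> exp (d - c * (norm x)\<^sup>2)" unfolding W_def using Qlow[of x n] by simp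
    then show "W n x \<le> exp d * exp (- c * (norm x)\<^sup>2)" by (simp add: mult_exp_exp)
    show "indicator (cube h) x \<le> exp d * exp (- c * (norm x)\<^sup>2)"
    proof (cases "x \<in> cube h")
      case True
      have "(norm x)\<^sup>2 \<le> (\<Sum>b\<in>(Basis::'a set). h\<^sup>2)" unfolding nn
        using True by (intro sum_mono) (auto simp: cube_def abs_le_square_iff[symmetric] less_imp_le)
      also have "\<dots> = d * h\<^sup>2" by (simp add: d_def)
      finally have "0 \<le> d - c * (norm x)\<^sup>2" using h by (simp add: c_def field_simps)
      then have "1 \<le> exp (d - c * (norm x)\<^sup>2)" by simp
      then show ?thesis using True by (simp add: mult_exp_exp)
    qed simp
  qed
  obtain C1 m1 where C1: "C1 \<ge> 0" "\<And>x. \<bar>P1 x\<bar> \<le> C1 * (1 + norm x) ^ m1" using real_polynomial_growth[OF P(1)] by blast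
  obtain C2 m2 where C2: "C2 \<ge> 0" "\<And>x. \<bar>P2 x\<bar> \<le> C2 * (1 + norm x) ^ m2" using real_polynomial_growth[OF P(2)] by blast
  obtain K1 where K1: "\<And>r. r \<ge> 0 \<Longrightarrow> (1 + r) ^ m1 * exp (- (c / 2) * r\<^sup>2) \<le> K1" using power_exp_bounded[of "c / 2" m1] c by auto
  obtain K2 where K2: "\<And>r. r \<ge> 0 \<Longrightarrow> (1 + r) ^ m2 * exp (- (c / 2) * r\<^sup>2) \<le> K2" using power_exp_bounded[of "c / 2" m2] c by auto
  define K where "K = (C1 * K1 + C2 * K2) * exp d"
  \<comment> \<open>Half of the Gaussian absorbs the growth of the polynomials, the other half
    remains as the integrable majorant.\<close>
  have Fd: "cmod (F x) * (exp d * exp (- c * (norm x)\<^sup>2)) \<le> K * exp (- (c / 2) * (norm x)\<^sup>2)" for x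
  proof -
    have "cmod (F x) \<le> \<bar>P1 x\<bar> + \<bar>P2 x\<bar>" using cmod_le[of "F x"] by (simp add: F_def)
    also have "\<dots> \<le> C1 * (1 + norm x) ^ m1 + C2 * (1 + norm x) ^ m2" by (intro add_mono C1 C2)
    finally have "cmod (F x) * exp (- (c / 2) * (norm x)\<^sup>2) \<le> (C1 * (1 + norm x) ^ m1 + C2 * (1 + norm x) ^ m2) * exp (- (c / 2) * (norm x)\<^sup>2)"
      by (rule mult_right_mono) simp
    also have "\<dots> = C1 * ((1 + norm x) ^ m1 * exp (- (c / 2) * (norm x)\<^sup>2)) + C2 * ((1 + norm x) ^ m2 * exp (- (c / 2) * (norm x)\<^sup>2))"
      by (simp add: algebra_simps)
    also have "\<dots> \<le> C1 * K1 + C2 * K2" using C1 C2 by (intro add_mono mult_left_mono K1 K2) auto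
    finally have fin: "cmod (F x) * exp (- (c / 2) * (norm x)\<^sup>2) * (exp d * exp (- (c / 2) * (norm x)\<^sup>2)) \<le> (C1 * K1 + C2 * K2) * (exp d * exp (- (c / 2) * (norm x)\<^sup>2))"
      by (rule mult_right_mono) simp
    have GG: "exp (- (c / 2) * (norm x)\<^sup>2) * exp (- (c / 2) * (norm x)\<^sup>2) = exp (- c * (norm x)\<^sup>2)"
      by (simp add: mult_exp_exp)
    show ?thesis using fin unfolding K_def GG[symmetric] by (simp only: mult_ac)
  qed
  have K0: "K \<ge> 0"
  proof -
    have "0 \<le> cmod (F 0) * (exp d * exp (- c * (norm (0::'a))\<^sup>2))" by simp
    also have "\<dots> \<le> K" using Fd[of 0] by simp
    finally show ?thesis .
  qed
  let ?f = "\<lambda>x. F x * indicator (cube h) x"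
  let ?w = "\<lambda>x::'a. (K * exp (- (c / 2) * (norm x)\<^sup>2)) powr p"
  have "(\<lambda>n. \<integral>\<^sup>+x. ennreal (cmod (g n x - ?f x) powr p) \<partial>lborel) \<longlonglongrightarrow> (\<integral>\<^sup>+x. 0 \<partial>(lborel::'a measure))"
  proof (rule nn_integral_dominated_convergence[where w="\<lambda>x::'a. ennreal (?w x)"])
    show "AE x in lborel. ennreal (cmod (g n x - ?f x) powr p) \<le> ennreal (?w x)" for n
    proof (intro AE_I2 ennreal_leI powr_mono2)
      fix x :: 'a
      have "cmod (g n x - ?f x) = cmod (F x) * \<bar>W n x - indicator (cube h) x\<bar>"
      proof -
        have "g n x - ?f x = F x * of_real (W n x - indicator (cube h) x)"
          by (auto simp: g_def algebra_simps split: split_indicator)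
        then show ?thesis by (simp only: norm_mult norm_of_real)
      qed
      also have "\<dots> \<le> cmod (F x) * (exp d * exp (- c * (norm x)\<^sup>2))"
      proof (rule mult_left_mono)
        have "W n x \<ge> 0" "(indicator (cube h) x :: real) \<ge> 0" by (auto simp: W_def)
        then show "\<bar>W n x - indicator (cube h) x\<bar> \<le> exp d * exp (- c * (norm x)\<^sup>2)" using dom(1)[of n x] dom(2)[of x] by linarith
      qed simp
      also have "\<dots> \<le> K * exp (- (c / 2) * (norm x)\<^sup>2)" by (rule Fd)
      finally show "cmod (g n x - ?f x) \<le> K * exp (- (c / 2) * (norm x)\<^sup>2)" .
    qed (use p in auto)
    have "(\<integral>\<^sup>+x. ennreal (?w x) \<partial>lborel) = (\<integral>\<^sup>+x. ennreal (K powr p) * ennreal (exp (- pi * (p * c / 2 / pi) * (norm (0 - x::'a))\<^sup>2)) \<partial>lborel)"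
      using K0 by (intro nn_integral_cong) (simp add: powr_mult exp_powr_real mult_ac flip: ennreal_mult)
    also have "\<dots> = ennreal (K powr p) * (\<integral>\<^sup>+x. ennreal (exp (- pi * (p * c / 2 / pi) * (norm (0 - x::'a))\<^sup>2)) \<partial>lborel)"
      by (rule nn_integral_cmult) measurable
    also have "\<dots> = ennreal (K powr p) * ennreal ((p * c / 2 / pi) powr - (DIM('a) / 2))"
      using p c by (subst nn_integral_exp_norm) auto
    finally show "(\<integral>\<^sup>+x. ennreal (?w x) \<partial>lborel) < \<infinity>" by (simp add: ennreal_mult_less_top)
    show "AE x in lborel. (\<lambda>n. ennreal (cmod (g n x - ?f x) powr p)) \<longlonglongrightarrow> 0"
    proof -
      \<comment> \<open>On these hyperplanes, which contain the boundary of the cube, the weights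
        need not converge to the indicator.\<close>
      have "negligible (\<Union>b\<in>(Basis::'a set). {x. b \<bullet> x = h} \<union> {x. b \<bullet> x = - h})"
        by (intro negligible_Union) (auto intro!: negligible_Un negligible_hyperplane simp: nonzero_Basis)
      from AE_lborel_not_negligible[OF this] show ?thesis
      proof eventually_elim
        case (elim x)
        have W: "(\<lambda>n. W n x) \<longlonglongrightarrow> indicator (cube h) x"
        proof (cases "x \<in> cube h")
          case True
          have "(\<lambda>n. ((1 / h) * (x \<bullet> b)) ^ (2 * Suc n)) \<longlonglongrightarrow> 0" if b: "b \<in> Basis" for b
          proof -
            have "\<bar>(1 / h) * (x \<bullet> b)\<bar> < 1" using True b h by (simp add: cube_def abs_mult)
            then have "\<bar>((1 / h) * (x \<bullet> b))\<^sup>2\<bar> < 1" by (simp only: abs_square_less_1 power2_abs abs_power2)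
            then have "(\<lambda>n. (((1 / h) * (x \<bullet> b))\<^sup>2) ^ n) \<longlonglongrightarrow> 0" by (intro LIMSEQ_power_zero) simp
            then show ?thesis unfolding power_mult by (rule LIMSEQ_Suc)
          qed
          then have "(\<lambda>n. Q n x) \<longlonglongrightarrow> (\<Sum>b\<in>(Basis::'a set). 0)" unfolding Q_def by (intro tendsto_sum)
          then have "(\<lambda>n. exp (- Q n x)) \<longlonglongrightarrow> exp (- 0)" by (intro tendsto_intros) simp
          then show ?thesis using True by (simp add: W_def)
        next
          case False
          then obtain b where b: "b \<in> Basis" "\<not> \<bar>x \<bullet> b\<bar> < h" by (auto simp: cube_def)
          moreover have "x \<bullet> b \<noteq> h" "x \<bullet> b \<noteq> - h" using elim b by (auto simp: inner_commute)
          ultimately have gt: "\<bar>x \<bullet> b\<bar> > h" by linarith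
          define u where "u = ((1 / h) * (x \<bullet> b))\<^sup>2"
          have "1 < \<bar>(1 / h) * (x \<bullet> b)\<bar>" using gt h by (simp add: abs_mult)
          then have u: "u > 1" unfolding u_def by (metis one_less_power power2_abs pos2)
          have ge: "Q n x \<ge> u ^ Suc n" for n
            unfolding Q_def u_def power_mult[symmetric] by (rule member_le_sum[OF b(1)]) (auto simp only: power_mult finite_Basis, simp)
          have le: "W n x \<le> exp (- (u ^ Suc n))" for n unfolding W_def using ge[of n] by simp
          have "filterlim (\<lambda>n. u ^ n) at_top sequentially" using u by real_asymp
          then have "filterlim (\<lambda>n. u ^ Suc n) at_top sequentially" using filterlim_sequentially_Suc[of "\<lambda>n. u ^ n" at_top] by simp
          then have l1: "(\<lambda>n. exp (- (u ^ Suc n))) \<longlonglongrightarrow> 0"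
            by (intro filterlim_compose[OF exp_at_bot] filterlim_compose[OF filterlim_uminus_at_bot_at_top])
          have l2: "\<forall>\<^sub>F n in sequentially. 0 \<le> W n x" by (simp add: W_def)
          have l3: "\<forall>\<^sub>F n in sequentially. W n x \<le> exp (- (u ^ Suc n))" by (intro always_eventually allI le)
          have "(\<lambda>n. W n x) \<longlonglongrightarrow> 0" by (rule tendsto_sandwich[OF l2 l3 tendsto_const l1])
          then show ?thesis using False by simp
        qed
        have "(\<lambda>n. g n x) \<longlonglongrightarrow> F x * of_real (indicator (cube h) x)" unfolding g_def by (intro tendsto_mult tendsto_const tendsto_of_real W)
        then have "(\<lambda>n. cmod (g n x - F x * of_real (indicator (cube h) x))) \<longlonglongrightarrow> 0"
          by (simp add: tendsto_norm_zero_iff LIM_zero)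
        then have "(\<lambda>n. cmod (g n x - ?f x) powr p) \<longlonglongrightarrow> 0 powr p"
          using p by (intro tendsto_powr') (auto simp: of_real_indicator)
        then have "(\<lambda>n. ennreal (cmod (g n x - ?f x) powr p)) \<longlonglongrightarrow> ennreal (0 powr p)" by (rule tendsto_ennrealI)
        then show ?case by simp
      qed
    qed
  qed measurable
  then have lim: "(\<lambda>n. \<integral>\<^sup>+x. ennreal (cmod (g n x - ?f x) powr p) \<partial>lborel) \<longlonglongrightarrow> 0" by (simp only: nn_integral_const mult_zero_left)
  have "approximable p (g n)" for n
    unfolding approximable_def using gs by (intro allI impI exI[of _ "g n"]) (use p in auto)
  then have "approximable p ?f" by (intro approximable_limit[OF p _ gm _ lim]) auto
  then show ?thesis by (simp add: F_def)
qed

text \<open>Stone-Weierstrass on the closed cube, for real and imaginary part separately; uniform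
  closeness suffices because the cube has finite volume.\<close>

lemma approximable_continuous_cube:
  fixes g :: "'a::euclidean_space \<Rightarrow> complex"
  assumes p: "p > 0" and h: "h > 0" and g: "continuous_on UNIV g"
  shows "approximable p (\<lambda>x. g x * indicator (cube h) x)"
proof (rule approximable_closure[OF p])
  have [measurable]: "g \<in> borel_measurable borel" using g by (rule borel_measurable_continuous_onI)
  show "(\<lambda>x. g x * indicator (cube h) x) \<in> borel_measurable borel" by measurable
  fix \<epsilon> :: real assume e: "\<epsilon> > 0"
  define V where "V = measure lborel (cube h :: 'a set)"
  have V: "emeasure lborel (cube h :: 'a set) = ennreal V" "V \<ge> 0"
    using emeasure_cube[of h, where 'a='a] by (auto simp: V_def emeasure_eq_ennreal_measure)
  \<comment> \<open>Makes \<eta>^p V at most \<epsilon>; the added 1 keeps the quotient meaningful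
    without knowing V > 0.\<close>
  define \<eta> where "\<eta> = (\<epsilon> / (V + 1)) powr (1 / p)"
  have \<eta>: "\<eta> > 0" using e V by (simp add: \<eta>_def)
  let ?S = "cbox (- (\<Sum>b\<in>Basis. h *\<^sub>R b)) (\<Sum>b\<in>Basis. h *\<^sub>R (b::'a))"
  have sub: "cube h \<subseteq> ?S" unfolding cube_eq_box by (rule box_subset_cbox)
  have c: "continuous_on ?S (\<lambda>x. Re (g x))" "continuous_on ?S (\<lambda>x. Im (g x))"
    by (intro continuous_intros continuous_on_subset[OF g], simp)+
  obtain P1 where P1: "real_polynomial_function P1" "\<And>x. x \<in> ?S \<Longrightarrow> \<bar>Re (g x) - P1 x\<bar> < \<eta> / 2"
    using Stone_Weierstrass_real_polynomial_function[OF compact_cbox c(1), of "\<eta> / 2"] \<eta> by auto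
  obtain P2 where P2: "real_polynomial_function P2" "\<And>x. x \<in> ?S \<Longrightarrow> \<bar>Im (g x) - P2 x\<bar> < \<eta> / 2"
    using Stone_Weierstrass_real_polynomial_function[OF compact_cbox c(2), of "\<eta> / 2"] \<eta> by auto
  have [measurable]: "P1 \<in> borel_measurable borel" "P2 \<in> borel_measurable borel"
    using P1(1) P2(1) by (auto intro!: borel_measurable_continuous_onI continuous_real_polymonial_function continuous_at_imp_continuous_on)
  let ?F = "\<lambda>x. Complex (P1 x) (P2 x) * indicator (cube h) x"
  have Fm: "?F \<in> borel_measurable borel" unfolding Complex_eq by measurable
  have "(\<integral>\<^sup>+x. ennreal (cmod (?F x - g x * indicator (cube h) x) powr p) \<partial>lborel) \<le> (\<integral>\<^sup>+x. ennreal (\<epsilon> / (V + 1)) * indicator (cube h :: 'a set) x \<partial>lborel)"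
  proof (intro nn_integral_mono)
    fix x :: 'a
    show "ennreal (cmod (?F x - g x * indicator (cube h) x) powr p) \<le> ennreal (\<epsilon> / (V + 1)) * indicator (cube h) x"
    proof (cases "x \<in> cube h")
      case True
      then have x: "x \<in> ?S" using sub by blast
      have "cmod (Complex (P1 x) (P2 x) - g x) \<le> \<bar>Re (Complex (P1 x) (P2 x) - g x)\<bar> + \<bar>Im (Complex (P1 x) (P2 x) - g x)\<bar>"
        by (rule cmod_le)
      also have "\<dots> \<le> \<eta>" using P1(2)[OF x] P2(2)[OF x] by (simp add: abs_minus_commute)
      finally have "cmod (Complex (P1 x) (P2 x) - g x) powr p \<le> \<eta> powr p" using p by (intro powr_mono2) auto
      also have "\<eta> powr p = \<epsilon> / (V + 1)" using p e V by (simp add: \<eta>_def powr_powr)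
      finally show ?thesis using True by (simp add: ennreal_leI)
    qed (use p in simp)
  qed
  also have "\<dots> = ennreal (\<epsilon> / (V + 1)) * ennreal V"
    by (subst nn_integral_cmult_indicator) (simp_all only: V(1), measurable)
  also have "\<dots> = ennreal (\<epsilon> / (V + 1) * V)"
    using V e by (intro ennreal_mult[symmetric]) auto
  also have "\<dots> \<le> ennreal \<epsilon>" using V e by (intro ennreal_leI) (simp add: field_simps)
  finally show "\<exists>F. F \<in> borel_measurable borel \<and> approximable p F \<and>
      (\<integral>\<^sup>+x. ennreal (cmod (F x - g x * indicator (cube h) x) powr p) \<partial>lborel) \<le> ennreal \<epsilon>"
    using Fm approximable_polynomial_cube[OF p h P1(1) P2(1)] by blast
qed

text \<open>A measurable function is an almost everywhere limit of continuous ones. Projecting their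
  values to the nearest point of the disc of radius \<open>h\<close> keeps them continuous, fixes
  the values of \<open>f\<close>, and supplies the bound for dominated convergence.\<close>

lemma approximable_bounded_cube:
  fixes f :: "'a::euclidean_space \<Rightarrow> complex"
  assumes p: "p > 0" and h: "h > 0" and f [measurable]: "f \<in> borel_measurable borel"
    and bd: "\<And>x. cmod (f x) \<le> h" and supp: "\<And>x. x \<notin> cube h \<Longrightarrow> f x = 0"
  shows "approximable p f"
proof -
  have "f \<in> borel_measurable lebesgue" by (intro measurable_completion) simp
  then have "f measurable_on UNIV" by (intro lebesgue_measurable_imp_measurable_on) auto
  then obtain N g where N: "negligible N" and g: "\<And>n. continuous_on UNIV (g n)"
    and lim: "\<And>x. x \<notin> N \<Longrightarrow> (\<lambda>n. g n x) \<longlonglongrightarrow> f x" by (auto simp: measurable_on_def)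
  define \<kappa> where "\<kappa> = closest_point (cball (0::complex) h)"
  have cb: "convex (cball (0::complex) h)" "closed (cball (0::complex) h)" "cball (0::complex) h \<noteq> {}" using h by auto
  have \<kappa>c: "continuous_on UNIV \<kappa>" unfolding \<kappa>_def by (rule continuous_on_closest_point[OF cb])
  have \<kappa>b: "cmod (\<kappa> z) \<le> h" for z unfolding \<kappa>_def using closest_point_in_set[OF cb(2,3), of z] by simp
  have \<kappa>f: "\<kappa> (f x) = f x" for x unfolding \<kappa>_def using bd[of x] by (intro closest_point_self) simp
  define G where "G = (\<lambda>n x. \<kappa> (g n x) * indicator (cube h) x)"
  have Gc: "continuous_on UNIV (\<lambda>x. \<kappa> (g n x))" for n
    using continuous_on_compose2[OF \<kappa>c g] by auto
  have [measurable]: "(\<lambda>x. \<kappa> (g n x)) \<in> borel_measurable borel" for n using Gc by (rule borel_measurable_continuous_onI)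
  have Gm [measurable]: "G n \<in> borel_measurable borel" for n unfolding G_def by measurable
  have "(\<lambda>n. \<integral>\<^sup>+x. ennreal (cmod (G n x - f x) powr p) \<partial>lborel) \<longlonglongrightarrow> (\<integral>\<^sup>+x. 0 \<partial>(lborel :: 'a measure))"
  proof (rule nn_integral_dominated_convergence[where w="\<lambda>x. ennreal ((2 * h) powr p) * indicator (cube h) x"])
    show "AE x in lborel. ennreal (cmod (G n x - f x) powr p) \<le> ennreal ((2 * h) powr p) * indicator (cube h) x" for n
    proof (intro AE_I2)
      fix x
      show "ennreal (cmod (G n x - f x) powr p) \<le> ennreal ((2 * h) powr p) * indicator (cube h) x"
      proof (cases "x \<in> cube h")
        case True
        have "cmod (\<kappa> (g n x) - f x) \<le> 2 * h" using norm_triangle_ineq4[of "\<kappa> (g n x)" "f x"] \<kappa>b[of "g n x"] bd[of x] by linarith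
        then show ?thesis using True p by (simp add: G_def) (intro ennreal_leI powr_mono2, auto)
      qed (use p supp in \<open>simp add: G_def\<close>)
    qed
    show "(\<integral>\<^sup>+x. ennreal ((2 * h) powr p) * indicator (cube h :: 'a set) x \<partial>lborel) < \<infinity>"
      using emeasure_cube[of h, where 'a='a] by (simp add: nn_integral_cmult_indicator ennreal_mult_less_top)
    show "AE x in lborel. (\<lambda>n. ennreal (cmod (G n x - f x) powr p)) \<longlonglongrightarrow> 0"
      using AE_lborel_not_negligible[OF N]
    proof eventually_elim
      case (elim x)
      have "(\<lambda>n. \<kappa> (g n x)) \<longlonglongrightarrow> \<kappa> (f x)"
        using continuous_on_tendsto_compose[OF \<kappa>c lim[OF elim]] by simp
      then have "(\<lambda>n. G n x) \<longlonglongrightarrow> \<kappa> (f x) * indicator (cube h) x" unfolding G_def by (intro tendsto_mult tendsto_const)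
      moreover have "\<kappa> (f x) * indicator (cube h) x = f x" using supp[of x] by (cases "x \<in> cube h") (auto simp: \<kappa>f)
      ultimately have "(\<lambda>n. cmod (G n x - f x)) \<longlonglongrightarrow> 0" by (simp add: tendsto_norm_zero_iff LIM_zero)
      then have "(\<lambda>n. cmod (G n x - f x) powr p) \<longlonglongrightarrow> 0 powr p" using p by (intro tendsto_powr') auto
      then have "(\<lambda>n. ennreal (cmod (G n x - f x) powr p)) \<longlonglongrightarrow> ennreal (0 powr p)" by (rule tendsto_ennrealI)
      then show ?case by simp
    qed
  qed measurable
  then have l: "(\<lambda>n. \<integral>\<^sup>+x. ennreal (cmod (G n x - f x) powr p) \<partial>lborel) \<longlonglongrightarrow> 0"
    by (simp only: nn_integral_const mult_zero_left)
  show ?thesis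
    by (rule approximable_limit[OF p f Gm _ l]) (unfold G_def, rule approximable_continuous_cube[OF p h Gc])
qed

text \<open>Cutting off in domain and range at once; |f|^p dominates the error.\<close>

lemma approximable_Lp:
  fixes f :: "'a::euclidean_space \<Rightarrow> complex"
  assumes p: "p > 0" and f [measurable]: "f \<in> borel_measurable borel"
    and fin: "(\<integral>\<^sup>+x. ennreal (cmod (f x) powr p) \<partial>lborel) < \<infinity>"
  shows "approximable p f"
proof -
  define Q where "Q = (\<lambda>n. {x. x \<in> cube (real (Suc n)) \<and> cmod (f x) \<le> real (Suc n)})"
  have "Q n = cube (real (Suc n)) \<inter> {x. cmod (f x) \<le> real (Suc n)}" for n by (auto simp: Q_def)
  then have [measurable]: "Q n \<in> sets borel" for n by simp
  define G where "G = (\<lambda>n x. f x * indicator (Q n) x)"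
  have Gm [measurable]: "G n \<in> borel_measurable borel" for n unfolding G_def by measurable
  have "(\<lambda>n. \<integral>\<^sup>+x. ennreal (cmod (G n x - f x) powr p) \<partial>lborel) \<longlonglongrightarrow> (\<integral>\<^sup>+x. 0 \<partial>(lborel :: 'a measure))"
  proof (rule nn_integral_dominated_convergence[where w="\<lambda>x. ennreal (cmod (f x) powr p)"])
    show "AE x in lborel. ennreal (cmod (G n x - f x) powr p) \<le> ennreal (cmod (f x) powr p)" for n
      by (auto simp: G_def split: split_indicator)
    show "AE x in lborel. (\<lambda>n. ennreal (cmod (G n x - f x) powr p)) \<longlonglongrightarrow> 0"
    proof (intro AE_I2)
      fix x
      obtain N :: nat where N: "norm x + cmod (f x) \<le> real N" using real_arch_simple by blast
      have "x \<in> Q n" if "n \<ge> N" for n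
      proof -
        have m: "norm x + cmod (f x) < real (Suc n)" using N that by simp
        then have "norm x < real (Suc n)" "cmod (f x) \<le> real (Suc n)"
          using norm_ge_zero[of x] norm_ge_zero[of "f x"] by linarith+
        then show ?thesis unfolding Q_def cube_def using Basis_le_norm le_less_trans by blast
      qed
      then have "\<forall>\<^sub>F n in sequentially. ennreal (cmod (G n x - f x) powr p) = 0"
        by (intro eventually_sequentiallyI[of N]) (simp add: G_def)
      then show "(\<lambda>n. ennreal (cmod (G n x - f x) powr p)) \<longlonglongrightarrow> 0" by (rule tendsto_eventually)
    qed
  qed (use fin in simp_all)
  then have l: "(\<lambda>n. \<integral>\<^sup>+x. ennreal (cmod (G n x - f x) powr p) \<partial>lborel) \<longlonglongrightarrow> 0"
    by (simp only: nn_integral_const mult_zero_left)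
  have "approximable p (G n)" for n
    by (rule approximable_bounded_cube[OF p, of "real (Suc n)"])
       (auto simp: G_def Q_def split: split_indicator)
  then show ?thesis by (intro approximable_limit[OF p f Gm _ l])
qed

lemma schwartz_approx_exists:
  fixes f :: "'a::euclidean_space \<Rightarrow> complex"
  assumes p: "p > 0" and f: "f \<in> Lp_space p lborel"
  shows "\<exists>\<phi>. schwartz_approx p f \<phi>"
proof -
  obtain P where P: "(\<integral>\<^sup>+x. ennreal (cmod (f x) powr p) \<partial>lborel) = ennreal P" "f \<in> borel_measurable lborel"
    using Lp_space_obtain[OF f] by metis
  have "approximable p f" by (rule approximable_Lp[OF p]) (use P in auto)
  then have "\<forall>n::nat. \<exists>\<phi>. schwartz \<phi> \<and> (\<integral>\<^sup>+x. ennreal (cmod (\<phi> x - f x) powr p) \<partial>lborel) \<le> ennreal (1 / real (Suc n))"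
    by (auto simp: approximable_def)
  then obtain \<phi> where \<phi>: "\<And>n. schwartz (\<phi> n)" "\<And>n. (\<integral>\<^sup>+x. ennreal (cmod (\<phi> n x - f x) powr p) \<partial>lborel) \<le> ennreal (1 / real (Suc n))"
    by metis
  let ?I = "\<lambda>n. \<integral>\<^sup>+x. ennreal (cmod (\<phi> n x - f x) powr p) \<partial>lborel"
  have l1: "(\<lambda>n. ennreal (1 / real (Suc n))) \<longlonglongrightarrow> ennreal 0"
    by (intro tendsto_ennrealI) real_asymp
  have l2: "\<forall>\<^sub>F n in sequentially. 0 \<le> ?I n" by simp
  have l3: "\<forall>\<^sub>F n in sequentially. ?I n \<le> ennreal (1 / real (Suc n))" by (intro always_eventually allI \<phi>)
  have "?I \<longlonglongrightarrow> 0" using tendsto_sandwich[OF l2 l3 tendsto_const] l1 by simp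
  then show ?thesis using \<phi>(1) by (auto simp: schwartz_approx_def Lp_norm_tendsto_0_iff[OF p])
qed

text \<open>Riesz--Fischer: along a fast subsequence the weighted sum \<open>\<Sum>\<^sub>k 2\<^sup>k |d\<^sub>k|\<^sup>2\<close> of the increments
  is integrable, which forces geometric decay of the increments almost everywhere.\<close>

lemma L2_complete:
  fixes F :: "nat \<Rightarrow> 'b \<Rightarrow> complex"
  assumes [measurable]: "\<And>n. F n \<in> borel_measurable M"
    and C: "\<And>\<epsilon>. \<epsilon> > 0 \<Longrightarrow> \<exists>N. \<forall>m\<ge>N. \<forall>n\<ge>N. (\<integral>\<^sup>+x. ennreal ((cmod (F m x - F n x))\<^sup>2) \<partial>M) \<le> ennreal \<epsilon>"
  shows "\<exists>g. g \<in> borel_measurable M \<and> (\<lambda>n. \<integral>\<^sup>+x. ennreal ((cmod (F n x - g x))\<^sup>2) \<partial>M) \<longlonglongrightarrow> 0"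
proof -
  \<comment> \<open>Rate 1/4 against the weight 2^k leaves the summable (1/2)^k.\<close>
  have "\<forall>k::nat. \<exists>N. \<forall>m\<ge>N. \<forall>n\<ge>N. (\<integral>\<^sup>+x. ennreal ((cmod (F m x - F n x))\<^sup>2) \<partial>M) \<le> ennreal ((1/4) ^ k)"
    using C by simp
  then obtain N where N: "\<And>k m n. N k \<le> m \<Longrightarrow> N k \<le> n \<Longrightarrow> (\<integral>\<^sup>+x. ennreal ((cmod (F m x - F n x))\<^sup>2) \<partial>M) \<le> ennreal ((1/4) ^ k)"
    by metis
  \<comment> \<open>The partial sums make \<open>r\<close> monotone and at least \<open>N k\<close>,
    and the summand k drives it to infinity; no recursive choice is needed.\<close>
  define r where "r = (\<lambda>k. k + (\<Sum>j\<le>k. N j))"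
  have rN: "N k \<le> r k" for k using member_le_sum[of k "{..k}" N] by (auto simp: r_def)
  have rS: "r k \<le> r (Suc k)" and rk: "k \<le> r k" for k by (auto simp: r_def)
  have rN': "N k \<le> r (Suc k)" for k using rN rS by (rule order_trans)
  define d where "d = (\<lambda>k x. F (r (Suc k)) x - F (r k) x)"
  have [measurable]: "d k \<in> borel_measurable M" for k unfolding d_def by measurable
  have dI: "(\<integral>\<^sup>+x. ennreal (2 ^ k * (cmod (d k x))\<^sup>2) \<partial>M) \<le> ennreal ((1/2) ^ k)" for k
  proof -
    have "(\<integral>\<^sup>+x. ennreal (2 ^ k * (cmod (d k x))\<^sup>2) \<partial>M) = (\<integral>\<^sup>+x. ennreal (2 ^ k) * ennreal ((cmod (d k x))\<^sup>2) \<partial>M)"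
      by (simp add: ennreal_mult)
    also have "\<dots> = ennreal (2 ^ k) * (\<integral>\<^sup>+x. ennreal ((cmod (d k x))\<^sup>2) \<partial>M)" by (rule nn_integral_cmult) measurable
    also have "\<dots> \<le> ennreal (2 ^ k) * ennreal ((1/4) ^ k)"
      unfolding d_def by (intro mult_left_mono N rN rN') auto
    also have "\<dots> = ennreal ((1/2) ^ k)" by (simp add: power_mult_distrib[symmetric] flip: ennreal_mult)
    finally show ?thesis .
  qed
  have "(\<integral>\<^sup>+x. (\<Sum>k. ennreal (2 ^ k * (cmod (d k x))\<^sup>2)) \<partial>M) = (\<Sum>k. \<integral>\<^sup>+x. ennreal (2 ^ k * (cmod (d k x))\<^sup>2) \<partial>M)"
    by (rule nn_integral_suminf) measurable
  also have "\<dots> \<le> (\<Sum>k. ennreal ((1/2) ^ k))" by (intro suminf_le allI summableI dI)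
  also have "\<dots> = ennreal (\<Sum>k. (1/2) ^ k)" by (intro suminf_ennreal2 summable_geometric) auto
  also have "\<dots> < \<infinity>" by simp
  finally have "AE x in M. (\<Sum>k. ennreal (2 ^ k * (cmod (d k x))\<^sup>2)) \<noteq> \<infinity>"
    by (intro nn_integral_PInf_AE) auto
  then have conv: "AE x in M. convergent (\<lambda>k. F (r k) x)"
  proof eventually_elim
    case (elim x)
    then obtain S where S: "(\<Sum>k. ennreal (2 ^ k * (cmod (d k x))\<^sup>2)) = ennreal S" "S \<ge> 0"
      using ennreal_cases[of "\<Sum>k. ennreal (2 ^ k * (cmod (d k x))\<^sup>2)"] unfolding infinity_ennreal_def by metis
    have le: "cmod (d k x) \<le> sqrt S * (1 / sqrt 2) ^ k" for k
    proof -
      have "ennreal (2 ^ k * (cmod (d k x))\<^sup>2) \<le> ennreal S"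
        using ennreal_le_suminf[of "\<lambda>k. ennreal (2 ^ k * (cmod (d k x))\<^sup>2)" k] unfolding S(1) .
      then have "2 ^ k * (cmod (d k x))\<^sup>2 \<le> S" using S(2) by (simp only: ennreal_le_iff)
      then have "sqrt (2 ^ k * (cmod (d k x))\<^sup>2) \<le> sqrt S" by (rule real_sqrt_le_mono)
      then have "sqrt 2 ^ k * cmod (d k x) \<le> sqrt S" by (simp add: real_sqrt_mult real_sqrt_power)
      then show ?thesis by (simp add: power_divide field_simps)
    qed
    have "summable (\<lambda>k. sqrt S * (1 / sqrt 2) ^ k)" by (intro summable_mult summable_geometric) (simp add: field_simps)
    then have "summable (\<lambda>k. d k x)" by (rule summable_comparison_test') (use le in auto)
    then have "convergent (\<lambda>n. \<Sum>k<n. d k x)" by (simp add: summable_iff_convergent)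
    moreover have "(\<Sum>k<n. d k x) = F (r n) x - F (r 0) x" for n
      unfolding d_def by (rule sum_lessThan_telescope)
    ultimately have "convergent (\<lambda>n. (F (r n) x - F (r 0) x) + F (r 0) x)"
      by (intro convergent_add convergent_const) simp
    then show ?case by simp
  qed
  define g where "g = (\<lambda>x. lim (\<lambda>k. F (r k) x))"
  have gm [measurable]: "g \<in> borel_measurable M" unfolding g_def by (intro borel_measurable_lim_metric assms(1))
  show ?thesis
  proof (intro exI[of _ g] conjI gm)
    show "(\<lambda>n. \<integral>\<^sup>+x. ennreal ((cmod (F n x - g x))\<^sup>2) \<partial>M) \<longlonglongrightarrow> 0"
      unfolding ennreal_tendsto_0_iff
    proof (intro allI impI)
      fix \<epsilon> :: real assume e: "\<epsilon> > 0"
      obtain K where K: "\<And>m n. m \<ge> K \<Longrightarrow> n \<ge> K \<Longrightarrow> (\<integral>\<^sup>+x. ennreal ((cmod (F m x - F n x))\<^sup>2) \<partial>M) \<le> ennreal (\<epsilon> / 2)"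
        using C[of "\<epsilon> / 2"] e by auto
      have "(\<integral>\<^sup>+x. ennreal ((cmod (F n x - g x))\<^sup>2) \<partial>M) \<le> ennreal (\<epsilon> / 2)" if n: "n \<ge> K" for n
      proof (rule nn_integral_le_of_tendsto)
        show "AE x in M. (\<lambda>k. ennreal ((cmod (F n x - F (r (k + K)) x))\<^sup>2)) \<longlonglongrightarrow> ennreal ((cmod (F n x - g x))\<^sup>2)"
          using conv
        proof eventually_elim
          case (elim x)
          then have "(\<lambda>k. F (r k) x) \<longlonglongrightarrow> g x" unfolding g_def by (simp add: convergent_LIMSEQ_iff)
          then have "(\<lambda>k. F (r (k + K)) x) \<longlonglongrightarrow> g x" by (rule LIMSEQ_ignore_initial_segment)
          then show ?case by (intro tendsto_ennrealI tendsto_intros)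
        qed
        show "(\<integral>\<^sup>+x. ennreal ((cmod (F n x - F (r (k + K)) x))\<^sup>2) \<partial>M) \<le> ennreal (\<epsilon> / 2)" for k
          using rk[of "k + K"] by (intro K n) simp
      qed measurable
      moreover have "ennreal (\<epsilon> / 2) < ennreal \<epsilon>" using e by (intro ennreal_lessI) auto
      ultimately show "\<forall>\<^sub>F n in sequentially. (\<integral>\<^sup>+x. ennreal ((cmod (F n x - g x))\<^sup>2) \<partial>M) < ennreal \<epsilon>"
        by (intro eventually_sequentiallyI[of K]) (rule le_less_trans)
    qed
  qed
qed

section \<open>Extension of the restriction inequality by density\<close>

context two_scale_estimate
begin

lemma p_pos: "p > 0"
  using exponent_bounds by simp

lemma sqrt_const_powr: "(32 * const * P powr (2 / p)) powr (1 / 2) = sqrt (32 * const) * P powr (1 / p)"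
proof -
  have "sqrt (P powr (2 / p)) = P powr (1 / p)" by (simp add: powr_half_sqrt[symmetric] powr_powr)
  then show ?thesis using const_pos by (simp add: powr_half_sqrt real_sqrt_mult)
qed

lemma fourier_schwartz_diff:
  assumes \<phi>: "schwartz \<phi>" and \<psi>: "schwartz \<psi>"
    and a: "(\<integral>\<^sup>+x. ennreal (cmod (\<phi> x - \<psi> x) powr p) \<partial>lborel) \<le> ennreal a" "a \<ge> 0"
  shows "(\<integral>\<^sup>+\<xi>. ennreal ((cmod (fourier lborel \<phi> \<xi> - fourier lborel \<psi> \<xi>))\<^sup>2) \<partial>\<mu>) \<le> ennreal (2 * const * a powr (2 / p))"
proof -
  have i: "integrable lborel \<phi>" "integrable lborel \<psi>" by (intro schwartz_integrable \<phi> \<psi>)+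
  have "fourier lborel (\<lambda>x. \<phi> x - \<psi> x) \<xi> = fourier lborel \<phi> \<xi> - fourier lborel \<psi> \<xi>" for \<xi>
    unfolding fourier_wave right_diff_distrib
    by (intro Bochner_Integration.integral_diff integrable_wave i) auto
  then show ?thesis
    using restriction_estimate[OF Bochner_Integration.integrable_diff[OF i] a] by (simp add: energy2_def)
qed

text \<open>Two sequences are compared so that one statement serves twice: with equal sequences it
  is the Cauchy property, with different ones it shows that the limit does not depend on the
  sequence.\<close>

lemma fourier_schwartz_approx_close:
  assumes \<phi>: "schwartz_approx p f \<phi>" and \<psi>: "schwartz_approx p f \<psi>" and f: "f \<in> Lp_space p lborel" and e: "\<epsilon> > 0"
  shows "\<exists>N. \<forall>m\<ge>N. \<forall>n\<ge>N.
    (\<integral>\<^sup>+\<xi>. ennreal ((cmod (fourier lborel (\<phi> m) \<xi> - fourier lborel (\<psi> n) \<xi>))\<^sup>2) \<partial>\<mu>) \<le> ennreal \<epsilon>"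
proof -
  \<comment> \<open>Chosen so that 2 \<open>const\<close> a^(2/p) = \<epsilon>; \<eta> below then
    pays for the quasi-triangle inequality.\<close>
  define a where "a = (\<epsilon> / (2 * const)) powr (p / 2)"
  have a: "a > 0" using e const_pos by (simp add: a_def)
  define \<eta> where "\<eta> = a / (2 powr p * 2)"
  have \<eta>: "\<eta> > 0" using a by (simp add: \<eta>_def)
  have [measurable]: "f \<in> borel_measurable borel" using f by (simp add: Lp_space_def)
  have S: "schwartz (\<phi> n)" "schwartz (\<psi> n)" for n using \<phi> \<psi> by (auto simp: schwartz_approx_def)
  have [measurable]: "\<phi> n \<in> borel_measurable borel" "\<psi> n \<in> borel_measurable borel" for n
    by (intro schwartz_measurable S)+
  have "\<forall>\<^sub>F n in sequentially. (\<integral>\<^sup>+x. ennreal (cmod (\<phi> n x - f x) powr p) \<partial>lborel) < ennreal \<eta>"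
    "\<forall>\<^sub>F n in sequentially. (\<integral>\<^sup>+x. ennreal (cmod (\<psi> n x - f x) powr p) \<partial>lborel) < ennreal \<eta>"
    using \<phi> \<psi> \<eta> by (auto simp: schwartz_approx_def Lp_norm_tendsto_0_iff[OF p_pos] ennreal_tendsto_0_iff)
  then have "\<forall>\<^sub>F n in sequentially. (\<integral>\<^sup>+x. ennreal (cmod (\<phi> n x - f x) powr p) \<partial>lborel) < ennreal \<eta>
      \<and> (\<integral>\<^sup>+x. ennreal (cmod (\<psi> n x - f x) powr p) \<partial>lborel) < ennreal \<eta>"
    by (rule eventually_conj)
  then obtain N where N: "\<And>n. n \<ge> N \<Longrightarrow> (\<integral>\<^sup>+x. ennreal (cmod (\<phi> n x - f x) powr p) \<partial>lborel) < ennreal \<eta>"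
    "\<And>n. n \<ge> N \<Longrightarrow> (\<integral>\<^sup>+x. ennreal (cmod (\<psi> n x - f x) powr p) \<partial>lborel) < ennreal \<eta>"
    by (auto simp: eventually_sequentially)
  show ?thesis
  proof (intro exI[of _ N] allI impI)
    fix m n assume mn: "N \<le> m" "N \<le> n"
    have "(\<integral>\<^sup>+x. ennreal (cmod (\<phi> m x - \<psi> n x) powr p) \<partial>lborel) \<le> ennreal (2 powr p * (\<eta> + \<eta>))"
    proof (rule nn_integral_triangle_powr[OF p_pos, where g=f])
      show "(\<integral>\<^sup>+x. ennreal (cmod (\<phi> m x - f x) powr p) \<partial>lborel) \<le> ennreal \<eta>" using N(1)[OF mn(1)] by simp
      show "(\<integral>\<^sup>+x. ennreal (cmod (f x - \<psi> n x) powr p) \<partial>lborel) \<le> ennreal \<eta>" using N(2)[OF mn(2)] by (simp add: norm_minus_commute)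
    qed (use \<eta> in auto)
    also have "2 powr p * (\<eta> + \<eta>) = a" by (simp add: \<eta>_def)
    finally have "(\<integral>\<^sup>+\<xi>. ennreal ((cmod (fourier lborel (\<phi> m) \<xi> - fourier lborel (\<psi> n) \<xi>))\<^sup>2) \<partial>\<mu>) \<le> ennreal (2 * const * a powr (2 / p))"
      using a by (intro fourier_schwartz_diff S) auto
    also have "2 * const * a powr (2 / p) = \<epsilon>" using e const_pos p_pos by (simp add: a_def powr_powr)
    finally show "(\<integral>\<^sup>+\<xi>. ennreal ((cmod (fourier lborel (\<phi> m) \<xi> - fourier lborel (\<psi> n) \<xi>))\<^sup>2) \<partial>\<mu>) \<le> ennreal \<epsilon>" .
  qed
qed

text \<open>The limit exists by completeness of L^2(\<mu>). Its bound is 4 * 2 \<open>const\<close>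
  * (2^p P)^(2/p) = 32 \<open>const\<close> P^(2/p): one factor 4 comes from the quasi-triangle
  inequality in L^2(\<mu>), the other from the one in L^p.\<close>

lemma fourier_by_density_exists:
  assumes f: "f \<in> Lp_space p lborel"
  shows "\<exists>g. fourier_by_density p \<mu> f g \<and> Lp_norm 2 \<mu> g \<le> ennreal (sqrt (32 * const)) * Lp_norm p lborel f"
proof -
  obtain P where P: "(\<integral>\<^sup>+x. ennreal (cmod (f x) powr p) \<partial>lborel) = ennreal P" "P \<ge> 0" "f \<in> borel_measurable lborel"
    using Lp_space_obtain[OF f] by metis
  have fm [measurable]: "f \<in> borel_measurable borel" using P(3) by simp
  obtain \<phi> where \<phi>: "schwartz_approx p f \<phi>" using schwartz_approx_exists[OF p_pos f] by blast
  have Sm: "fourier lborel (\<psi> n) \<in> borel_measurable \<mu>" if "schwartz_approx p f \<psi>" for \<psi> n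
  proof -
    have [measurable]: "\<psi> n \<in> borel_measurable borel" using that by (intro schwartz_measurable) (simp add: schwartz_approx_def)
    show ?thesis by measurable
  qed
  obtain g where g [measurable]: "g \<in> borel_measurable \<mu>"
    and lim: "(\<lambda>n. \<integral>\<^sup>+\<xi>. ennreal ((cmod (fourier lborel (\<phi> n) \<xi> - g \<xi>))\<^sup>2) \<partial>\<mu>) \<longlonglongrightarrow> 0"
    using L2_complete[of "\<lambda>n. fourier lborel (\<phi> n)" \<mu>, OF Sm[OF \<phi>] fourier_schwartz_approx_close[OF \<phi> \<phi> f]] by blast
  have tri: "(\<integral>\<^sup>+\<xi>. ennreal ((cmod (u \<xi> - w \<xi>))\<^sup>2) \<partial>\<mu>) \<le> ennreal (4 * (a + b))"
    if "u \<in> borel_measurable \<mu>" "v \<in> borel_measurable \<mu>" "w \<in> borel_measurable \<mu>"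
      "(\<integral>\<^sup>+\<xi>. ennreal ((cmod (u \<xi> - v \<xi>))\<^sup>2) \<partial>\<mu>) \<le> ennreal a"
      "(\<integral>\<^sup>+\<xi>. ennreal ((cmod (v \<xi> - w \<xi>))\<^sup>2) \<partial>\<mu>) \<le> ennreal b" "a \<ge> 0" "b \<ge> 0" for u v w :: "'a \<Rightarrow> complex" and a b
    using nn_integral_triangle_powr[of 2 u \<mu> v w a b] that by simp
  have all: "(\<lambda>n. Lp_norm 2 \<mu> (\<lambda>\<xi>. fourier lborel (\<psi> n) \<xi> - g \<xi>)) \<longlonglongrightarrow> 0" if \<psi>: "schwartz_approx p f \<psi>" for \<psi>
  proof -
    have "(\<lambda>n. \<integral>\<^sup>+\<xi>. ennreal ((cmod (fourier lborel (\<psi> n) \<xi> - g \<xi>))\<^sup>2) \<partial>\<mu>) \<longlonglongrightarrow> 0"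
      unfolding ennreal_tendsto_0_iff
    proof (intro allI impI)
      fix \<epsilon> :: real assume e: "\<epsilon> > 0"
      \<comment> \<open>4 (\<epsilon> / 16 + \<epsilon> / 16) = \<epsilon> / 2 leaves room for the
        strict inequality.\<close>
      then have e': "\<epsilon> / 16 > 0" by simp
      obtain N where N: "\<And>m n. m \<ge> N \<Longrightarrow> n \<ge> N \<Longrightarrow> (\<integral>\<^sup>+\<xi>. ennreal ((cmod (fourier lborel (\<psi> m) \<xi> - fourier lborel (\<phi> n) \<xi>))\<^sup>2) \<partial>\<mu>) \<le> ennreal (\<epsilon> / 16)"
        using fourier_schwartz_approx_close[OF \<psi> \<phi> f e'] by blast
      have "\<forall>\<^sub>F n in sequentially. (\<integral>\<^sup>+\<xi>. ennreal ((cmod (fourier lborel (\<phi> n) \<xi> - g \<xi>))\<^sup>2) \<partial>\<mu>) < ennreal (\<epsilon> / 16)"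
        using lim e' unfolding ennreal_tendsto_0_iff by blast
      moreover have "\<forall>\<^sub>F n in sequentially. n \<ge> N" by (rule eventually_ge_at_top)
      ultimately show "\<forall>\<^sub>F n in sequentially. (\<integral>\<^sup>+\<xi>. ennreal ((cmod (fourier lborel (\<psi> n) \<xi> - g \<xi>))\<^sup>2) \<partial>\<mu>) < ennreal \<epsilon>"
      proof eventually_elim
        case (elim n)
        have "(\<integral>\<^sup>+\<xi>. ennreal ((cmod (fourier lborel (\<psi> n) \<xi> - g \<xi>))\<^sup>2) \<partial>\<mu>) \<le> ennreal (4 * (\<epsilon> / 16 + \<epsilon> / 16))"
          by (rule tri[OF Sm[OF \<psi>] Sm[OF \<phi>] g N[OF elim(2) elim(2)] less_imp_le[OF elim(1)]]) (use e in auto)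
        also have "\<dots> < ennreal \<epsilon>" using e by (intro ennreal_lessI) auto
        finally show ?case .
      qed
    qed
    then show ?thesis by (simp add: Lp_norm_tendsto_0_iff)
  qed
  \<comment> \<open>Here \<epsilon> bounds both errors of a single approximant, in L^2(\<mu>) and in
    L^p; it is sent to 0 afterwards.\<close>
  have bound: "(\<integral>\<^sup>+\<xi>. ennreal ((cmod (g \<xi>))\<^sup>2) \<partial>\<mu>) \<le> ennreal (4 * (\<epsilon> + 2 * const * (2 powr p * (\<epsilon> + P)) powr (2 / p)))" if e: "\<epsilon> > 0" for \<epsilon>
  proof -
    have "\<forall>\<^sub>F n in sequentially. (\<integral>\<^sup>+\<xi>. ennreal ((cmod (fourier lborel (\<phi> n) \<xi> - g \<xi>))\<^sup>2) \<partial>\<mu>) < ennreal \<epsilon>"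
      using lim e unfolding ennreal_tendsto_0_iff by blast
    moreover have "\<forall>\<^sub>F n in sequentially. (\<integral>\<^sup>+x. ennreal (cmod (\<phi> n x - f x) powr p) \<partial>lborel) < ennreal \<epsilon>"
      using \<phi> e by (auto simp: schwartz_approx_def Lp_norm_tendsto_0_iff[OF p_pos] ennreal_tendsto_0_iff)
    ultimately have "\<forall>\<^sub>F n in sequentially. (\<integral>\<^sup>+\<xi>. ennreal ((cmod (fourier lborel (\<phi> n) \<xi> - g \<xi>))\<^sup>2) \<partial>\<mu>) < ennreal \<epsilon>
      \<and> (\<integral>\<^sup>+x. ennreal (cmod (\<phi> n x - f x) powr p) \<partial>lborel) < ennreal \<epsilon>" by (rule eventually_conj)
    then obtain n where n: "(\<integral>\<^sup>+\<xi>. ennreal ((cmod (fourier lborel (\<phi> n) \<xi> - g \<xi>))\<^sup>2) \<partial>\<mu>) < ennreal \<epsilon>"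
      "(\<integral>\<^sup>+x. ennreal (cmod (\<phi> n x - f x) powr p) \<partial>lborel) < ennreal \<epsilon>"
      using eventually_happens' sequentially_bot by blast
    have Sn: "schwartz (\<phi> n)" using \<phi> by (simp add: schwartz_approx_def)
    note [measurable] = schwartz_measurable[OF Sn]
    have "(\<integral>\<^sup>+x. ennreal (cmod (\<phi> n x - 0) powr p) \<partial>lborel) \<le> ennreal (2 powr p * (\<epsilon> + P))"
      by (rule nn_integral_triangle_powr[OF p_pos, where g=f]) (use n P e in auto)
    then have "energy2 \<mu> (\<phi> n) \<le> ennreal (2 * const * (2 powr p * (\<epsilon> + P)) powr (2 / p))"
      using e P by (intro restriction_estimate schwartz_integrable Sn) auto
    then have "(\<integral>\<^sup>+\<xi>. ennreal ((cmod (fourier lborel (\<phi> n) \<xi> - 0))\<^sup>2) \<partial>\<mu>) \<le> ennreal (2 * const * (2 powr p * (\<epsilon> + P)) powr (2 / p))"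
      by (simp add: energy2_def)
    moreover have "(\<integral>\<^sup>+\<xi>. ennreal ((cmod (g \<xi> - fourier lborel (\<phi> n) \<xi>))\<^sup>2) \<partial>\<mu>) \<le> ennreal \<epsilon>"
      using n(1) by (simp add: norm_minus_commute)
    ultimately have "(\<integral>\<^sup>+\<xi>. ennreal ((cmod (g \<xi> - 0))\<^sup>2) \<partial>\<mu>) \<le> ennreal (4 * (\<epsilon> + 2 * const * (2 powr p * (\<epsilon> + P)) powr (2 / p)))"
      using e const_pos by (intro tri[OF g Sm[OF \<phi>]]) auto
    then show ?thesis by simp
  qed
  have le: "(\<integral>\<^sup>+\<xi>. ennreal ((cmod (g \<xi>))\<^sup>2) \<partial>\<mu>) \<le> ennreal (32 * const * P powr (2 / p))"
  proof (rule LIMSEQ_le_const)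
    have z: "(\<lambda>n. 1 / real (Suc n)) \<longlonglongrightarrow> 0" by real_asymp
    have "(\<lambda>n. 4 * (1 / real (Suc n) + 2 * const * (2 powr p * (1 / real (Suc n) + P)) powr (2 / p)))
        \<longlonglongrightarrow> 4 * (0 + 2 * const * (2 powr p * (0 + P)) powr (2 / p))"
      using P(2) p_pos by (intro tendsto_mult tendsto_add tendsto_const z tendsto_powr') (auto intro!: always_eventually)
    also have "4 * (0 + 2 * const * (2 powr p * (0 + P)) powr (2 / p)) = 32 * const * P powr (2 / p)"
      using P(2) p_pos by (simp add: powr_mult powr_powr)
    finally show "(\<lambda>n. ennreal (4 * (1 / real (Suc n) + 2 * const * (2 powr p * (1 / real (Suc n) + P)) powr (2 / p))))
        \<longlonglongrightarrow> ennreal (32 * const * P powr (2 / p))" by (rule tendsto_ennrealI)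
    show "\<exists>N. \<forall>n\<ge>N. (\<integral>\<^sup>+\<xi>. ennreal ((cmod (g \<xi>))\<^sup>2) \<partial>\<mu>) \<le> ennreal (4 * (1 / real (Suc n) + 2 * const * (2 powr p * (1 / real (Suc n) + P)) powr (2 / p)))"
      by (intro exI[of _ 0] allI impI bound) simp
  qed
  then have gL: "Lp_norm 2 \<mu> g \<le> ennreal ((32 * const * P powr (2 / p)) powr (1 / 2))"
    using const_pos by (intro Lp_norm_le) auto
  also have "(32 * const * P powr (2 / p)) powr (1 / 2) = sqrt (32 * const) * P powr (1 / p)"
    by (rule sqrt_const_powr)
  finally have nb: "Lp_norm 2 \<mu> g \<le> ennreal (sqrt (32 * const)) * Lp_norm p lborel f"
    using const_pos by (simp add: Lp_norm_eq[OF P(1,2)] ennreal_mult)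
  have "g \<in> Lp_space 2 \<mu>"
    using gL by (auto simp: Lp_space_def intro: le_less_trans)
  then have "fourier_by_density p \<mu> f g" using \<phi> all by (auto simp: fourier_by_density_def)
  then show ?thesis using nb by blast
qed

text \<open>The constant is enlarged to that of \<open>fourier_by_density_exists\<close> so that one
  constant covers both. An infinite norm of \<open>f\<close> makes the right side infinite, so
  membership in L^p needs no separate proof.\<close>

lemma fourier_schwartz_bound:
  assumes f: "schwartz f"
  shows "Lp_norm 2 \<mu> (fourier lborel f) \<le> ennreal (sqrt (32 * const)) * Lp_norm p lborel f"
proof (cases "Lp_norm p lborel f < \<infinity>")
  case True
  then have "f \<in> Lp_space p lborel" using schwartz_measurable[OF f] by (simp add: Lp_space_def)
  then obtain P where P: "(\<integral>\<^sup>+x. ennreal (cmod (f x) powr p) \<partial>lborel) = ennreal P" "P \<ge> 0"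
    using Lp_space_obtain by metis
  have "energy2 \<mu> f \<le> ennreal (2 * const * P powr (2 / p))"
    using P by (intro restriction_estimate schwartz_integrable f) auto
  also have "\<dots> \<le> ennreal (32 * const * P powr (2 / p))"
    using const_pos by (intro ennreal_leI mult_right_mono) auto
  finally have "Lp_norm 2 \<mu> (fourier lborel f) \<le> ennreal ((32 * const * P powr (2 / p)) powr (1 / 2))"
    using const_pos by (intro Lp_norm_le) (auto simp: energy2_def)
  also have "(32 * const * P powr (2 / p)) powr (1 / 2) = sqrt (32 * const) * P powr (1 / p)"
    by (rule sqrt_const_powr)
  finally show ?thesis
    using const_pos by (simp add: Lp_norm_eq[OF P] ennreal_mult)
next
  case False
  then have "Lp_norm p lborel f = top" by (simp add: less_top[symmetric])
  moreover have "ennreal (sqrt (32 * const)) \<noteq> 0" using const_pos by (simp only: ennreal_eq_0_iff) simp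
  ultimately show ?thesis by (simp only: ennreal_mult_top top_greatest if_False)
qed

lemma extension_bound:
  assumes f: "f \<in> Lp_space 2 \<mu>"
  shows "fourier \<mu> f \<in> Lp_space q lborel"
    and "Lp_norm q lborel (fourier \<mu> f) \<le> ennreal (sqrt (2 * const)) * Lp_norm 2 \<mu> f"
proof -
  interpret finite_measure \<mu> by (rule fin)
  obtain G where G: "(\<integral>\<^sup>+x. ennreal (cmod (f x) powr 2) \<partial>\<mu>) = ennreal G" "G \<ge> 0" "f \<in> borel_measurable \<mu>"
    using Lp_space_obtain[OF f] by metis
  have fm: "f \<in> borel_measurable borel" using G(3) unfolding measurable_cong_sets[OF sets_mu refl] .
  have "(\<integral>\<^sup>+\<xi>. ennreal (cmod (fourier \<mu> f \<xi>) powr q) \<partial>lborel) \<le> ennreal ((sqrt (2 * const) * sqrt G) powr q)"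
    using G by (intro extension_estimate fm) auto
  then have "Lp_norm q lborel (fourier \<mu> f) \<le> ennreal (((sqrt (2 * const) * sqrt G) powr q) powr (1 / q))"
    using q_conj(1) by (intro Lp_norm_le) auto
  also have "((sqrt (2 * const) * sqrt G) powr q) powr (1 / q) = sqrt (2 * const) * sqrt G"
    using q_conj(1) const_pos G(2) by (simp add: powr_powr)
  finally have le: "Lp_norm q lborel (fourier \<mu> f) \<le> ennreal (sqrt (2 * const) * sqrt G)" .
  then show "Lp_norm q lborel (fourier \<mu> f) \<le> ennreal (sqrt (2 * const)) * Lp_norm 2 \<mu> f"
    using const_pos G(2) by (simp add: Lp_norm_eq[OF G(1,2)] powr_half_sqrt ennreal_mult)
  have "fourier \<mu> f \<in> borel_measurable borel"
    by (rule borel_measurable_fourier[OF sigma_finite_measure_axioms sets_mu fm])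
  then show "fourier \<mu> f \<in> Lp_space q lborel" using le by (auto simp: Lp_space_def intro: le_less_trans)
qed

end

theorem theorem3p2:
  fixes \<mu> :: "'a::euclidean_space measure" and \<alpha> \<theta> s q\<^sub>0 q\<^sub>0' :: real
  assumes "0 < \<alpha>" and "\<alpha> < real DIM('a)"
    and "0 \<le> \<theta>" and "\<theta> \<le> 1" and "real DIM('a) * \<theta> < s"
    and "sets \<mu> = sets borel" and "finite_measure \<mu>" and "emeasure \<mu> UNIV \<noteq> 0"
    and "\<exists>K. compact K \<and> emeasure \<mu> (- K) = 0"
    and "\<exists>C>0. \<forall>x. \<forall>r>0. measure \<mu> (ball x r) \<le> C * r powr \<alpha>"
    and "fourier_energy s \<theta> \<mu> < \<infinity>"
    and "q\<^sub>0 = 2 + 2 * ((real DIM('a) - \<alpha>) * (2 - \<theta>) / (s - \<alpha> * \<theta>))"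
    and "q\<^sub>0' = 1 + (s - \<alpha> * \<theta>) / (s + 4 * (real DIM('a) - \<alpha>) - \<theta> * (2 * real DIM('a) - \<alpha>))"
  shows "(\<exists>C>0. \<forall>f \<in> Lp_space 2 \<mu>.
            fourier \<mu> f \<in> Lp_space q\<^sub>0 lborel \<and>
            Lp_norm q\<^sub>0 lborel (fourier \<mu> f) \<le> ennreal C * Lp_norm 2 \<mu> f) \<and>
         (\<exists>C>0. (\<forall>f. schwartz f \<longrightarrow>
            Lp_norm 2 \<mu> (fourier lborel f) \<le> ennreal C * Lp_norm q\<^sub>0' lborel f) \<and>
          (\<forall>f \<in> Lp_space q\<^sub>0' lborel. \<exists>g. fourier_by_density q\<^sub>0' \<mu> f g \<and>
            Lp_norm 2 \<mu> g \<le> ennreal C * Lp_norm q\<^sub>0' lborel f))"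
proof -
  let ?d = "real DIM('a)"
  define A where "A = ?d - \<alpha>"
  define B where "B = (s - ?d * \<theta>) / 2"
  have AB: "A > 0" "B > 0" using assms(2,5) by (auto simp: A_def B_def)
  obtain cH cL where c: "cH > 0" "cL > 0" and pair: "\<forall>t g h a b E F e f N. t > 0 \<longrightarrow>
    g \<in> borel_measurable borel \<longrightarrow> h \<in> borel_measurable borel \<longrightarrow> E \<in> sets borel \<longrightarrow> F \<in> sets borel \<longrightarrow>
    emeasure lborel E = ennreal e \<longrightarrow> e \<ge> 0 \<longrightarrow> emeasure lborel F = ennreal f \<longrightarrow> f \<ge> 0 \<longrightarrow> a \<ge> 0 \<longrightarrow> b \<ge> 0 \<longrightarrow>
    (\<forall>x. cmod (g x) \<le> a * indicator E x) \<longrightarrow> (\<forall>x. cmod (h x) \<le> b * indicator F x) \<longrightarrow> N \<ge> 0 \<longrightarrow>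
    (\<forall>w. energy2 \<mu> (\<lambda>x. wave w x * g x) \<le> ennreal N) \<longrightarrow>
    cmod (\<integral>\<xi>. fourier lborel g \<xi> * cnj (fourier lborel h \<xi>) \<partial>\<mu>)
      \<le> cH * t powr ((s - ?d * \<theta>) / 4) * (a * b) * (e * f) powr (1 - \<theta> / 4)
        + cL * t powr (- ((?d - \<alpha>) / 4)) * sqrt N * (b * sqrt f)"
    using pair_estimate[OF assms(7,6,1,2,10,3,4,5,11)] by blast
  have exps: "(s - ?d * \<theta>) / 4 = B / 2" "(?d - \<alpha>) / 4 = A / 4" by (auto simp: A_def B_def)
  have A\<theta>: "0 \<le> A * \<theta>" "A * \<theta> \<le> A" using AB(1) assms(3,4) mult_left_mono[of \<theta> 1 A] by auto
  \<comment> \<open>In terms of \<open>A\<close> and \<open>B\<close> both denominators are visibly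
    positive, and the exponents become \<open>4 * (A + B)\<close> divided by each of them.\<close>
  have D: "s + 4 * (?d - \<alpha>) - \<theta> * (2 * ?d - \<alpha>) = 2 * B + 4 * A - A * \<theta>" "s - \<alpha> * \<theta> = 2 * B + A * \<theta>"
    by (auto simp: A_def B_def field_simps)
  have D0: "2 * B + 4 * A - A * \<theta> > 0" "2 * B + A * \<theta> > 0" using A\<theta> AB by linarith+
  have p: "q\<^sub>0' = 4 * (A + B) / (2 * B + 4 * A - A * \<theta>)"
    unfolding assms(13) D using D0 by (simp add: add_divide_eq_iff)
  interpret two_scale_estimate \<mu> A B \<theta> q\<^sub>0' cH cL
    by (rule two_scale_estimate.intro; (fact assms(3,4,6,7) AB c p | (rule pair[unfolded exps, rule_format]; assumption)))
  \<comment> \<open>The two exponents of the theorem are conjugate, which is the sense in which its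
    two halves are equivalent.\<close>
  have q: "q\<^sub>0 = q"
  proof -
    have e1: "q\<^sub>0' - 1 = (2 * B + A * \<theta>) / (2 * B + 4 * A - A * \<theta>)" unfolding assms(13) D by (rule add_diff_cancel_left')
    have "q = q\<^sub>0' / (q\<^sub>0' - 1)" by (rule q_def)
    also have "\<dots> = 4 * (A + B) / (2 * B + A * \<theta>)" unfolding e1 unfolding p using D0 by simp
    finally have "q = 4 * (A + B) / (2 * B + A * \<theta>)" .
    moreover have "q\<^sub>0 = 4 * (A + B) / (2 * B + A * \<theta>)"
      unfolding assms(12) D A_def[symmetric] using D0 by (simp add: add_divide_eq_iff) (simp add: algebra_simps)
    ultimately show ?thesis by simp
  qed
  have C: "sqrt (2 * const) > 0" "sqrt (32 * const) > 0" using const_pos by (simp_all only: real_sqrt_gt_0_iff zero_less_mult_iff) simp_all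
  show ?thesis unfolding q
  proof (intro conjI)
    show "\<exists>C>0. \<forall>f\<in>Lp_space 2 \<mu>. fourier \<mu> f \<in> Lp_space q lborel \<and>
            Lp_norm q lborel (fourier \<mu> f) \<le> ennreal C * Lp_norm 2 \<mu> f"
      using C(1) extension_bound by blast
    show "\<exists>C>0. (\<forall>f. schwartz f \<longrightarrow>
            Lp_norm 2 \<mu> (fourier lborel f) \<le> ennreal C * Lp_norm q\<^sub>0' lborel f) \<and>
          (\<forall>f \<in> Lp_space q\<^sub>0' lborel. \<exists>g. fourier_by_density q\<^sub>0' \<mu> f g \<and>
            Lp_norm 2 \<mu> g \<le> ennreal C * Lp_norm q\<^sub>0' lborel f)"
      using C(2) fourier_schwartz_bound fourier_by_density_exists by blast
  qed
qed

end
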